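(* For a function $\varphi$ let $S(\varphi):=\{x\in\mathbb I:\lim_{n\to\infty}S_n(x)/\varphi(n)=1\}$. Then: (i) for $$\varphi(n)=\exp\left(c\cdot\frac{(\lfloor dn^{1-r}\rfloor)^{r/(1-r)}}{d^{r/(1-r)}}\right)$$ with $c,d\in(0,\infty)$ and $r\in[1/2,1)$, one has $\dim_{\rm H}S(\varphi)=\eta_d(c)$, where $\eta_d(c)$ is the unique solution $\theta\in(1/2,\infty)$ of $$\mathrm P(\theta)=cd(1-r)(2\theta-1);$$ (ii) for $$\varphi(n)=\exp\left(c\cdot\exp\left(\gamma\left\lfloor\frac{\log n}{\gamma}\right\rfloor\right)\right)$$ with $c,\gamma\in(0,\infty)$, one has $\dim_{\rm H}S(\varphi)=\xi_\gamma(c)$, where $\xi_\gamma(c)$ is the unique solution $\theta\in(1/2,\infty)$ of $$\mathrm P(\theta)=c\left(\frac{e^\gamma+1}{e^\gamma-1}\theta-\frac1{e^\gamma-1}\right).$$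
   Context: $\mathbb N=\{1,2,3,\dots\}$, $\mathbb I:=[0,1)\setminus\mathbb Q$, and $\lfloor y\rfloor$ is the greatest integer $\le y$. For $x\in\mathbb I$, $a_1(x),a_2(x),\dots\in\mathbb N$ are the coefficients (partial quotients) of its continued fraction expansion $x=[a_1(x),a_2(x),\dots]=1/(a_1(x)+1/(a_2(x)+\cdots))$, and $S_n(x):=\sum_{k=1}^n a_k(x)$. For positive integers $a_1,\dots,a_n$, $q_n(a_1,\dots,a_n)$ is the denominator (in lowest terms) of the rational number $[a_1,\dots,a_n]=1/(a_1+1/(a_2+\cdots+1/a_n))$. The Diophantine pressure function is $$\mathrm P(\theta):=\lim_{n\to\infty}\frac1n\log\sum_{a_1,\dots,a_n\in\mathbb N}q_n(a_1,\dots,a_n)^{-2\theta},\qquad \theta>\tfrac12.$$ $\dim_{\rm H}$ denotes Hausdorff dimension. *)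

theory Defs
  imports "HOL-Analysis.Analysis"
begin

definition unit_irrationals :: "real set" where
  "unit_irrationals = {0..<1} - \<rat>"

fun cf :: "nat list \<Rightarrow> rat" where
  "cf [] = 0"
| "cf (a # as) = 1 / (of_nat a + cf as)"

definition gauss_map :: "real \<Rightarrow> real" where
  "gauss_map x = frac (1 / x)"

text \<open>
  The coefficients of \<open>x\<close> are indexed from 1; the value at index 0 is meaningless and is
  never used.  Lemma \<open>cf_coeff_tendsto\<close> below shows that they are the coefficients of the
  continued fraction expansion of \<open>x\<close>.
\<close>

definition cf_coeff :: "nat \<Rightarrow> real \<Rightarrow> nat" where
  "cf_coeff k x = nat \<lfloor>1 / (gauss_map ^^ (k - 1)) x\<rfloor>"

definition coeff_sum :: "nat \<Rightarrow> real \<Rightarrow> nat" where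
  "coeff_sum n x = (\<Sum>k=1..n. cf_coeff k x)"

definition cf_denom :: "nat list \<Rightarrow> int" where
  "cf_denom as = snd (quotient_of (cf as))"

lemma gauss_map_unit_irrationals:
  assumes "x \<in> unit_irrationals"
  shows "gauss_map x \<in> unit_irrationals"
proof -
  have "gauss_map x \<notin> \<rat>"
  proof
    assume "gauss_map x \<in> \<rat>"
    then have "frac (1 / x) + of_int \<lfloor>1 / x\<rfloor> \<in> \<rat>"
      unfolding gauss_map_def by (intro Rats_add) auto
    then have "1 / x \<in> \<rat>"
      by (simp add: frac_def)
    then have "1 / (1 / x) \<in> \<rat>"
      by (rule Rats_divide[OF Rats_1])
    then have "x \<in> \<rat>"
      by simp
    with assms show False
      by (simp add: unit_irrationals_def)
  qed
  then show ?thesis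
    by (simp add: unit_irrationals_def gauss_map_def frac_lt_1)
qed

lemma cf_coeff_1:
  assumes "x \<in> unit_irrationals"
  shows "cf_coeff 1 x \<ge> 1" and "x = 1 / (real (cf_coeff 1 x) + gauss_map x)"
proof -
  have "x \<noteq> 0"
    using assms by (auto simp: unit_irrationals_def)
  then have x: "0 < x" "x < 1"
    using assms by (auto simp: unit_irrationals_def)
  then have fl: "1 \<le> \<lfloor>1 / x\<rfloor>"
    by (simp add: le_floor_iff)
  then have "1 \<le> nat \<lfloor>1 / x\<rfloor>"
    by linarith
  then show "cf_coeff 1 x \<ge> 1"
    by (simp add: cf_coeff_def)
  have "real (cf_coeff 1 x) = of_int \<lfloor>1 / x\<rfloor>"
    using x by (simp add: cf_coeff_def)
  then show "x = 1 / (real (cf_coeff 1 x) + gauss_map x)"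
    using x by (simp add: gauss_map_def frac_def)
qed

lemma cf_coeff_Suc:
  assumes "k \<ge> 1"
  shows "cf_coeff (Suc k) x = cf_coeff k (gauss_map x)"
  using assms by (cases k) (simp_all add: cf_coeff_def funpow_swap1)

lemma cf_coeff_pos:
  assumes "x \<in> unit_irrationals" "k \<ge> 1"
  shows "cf_coeff k x \<ge> 1"
  using assms(2,1)
proof (induction k arbitrary: x rule: dec_induct)
  case base
  then show ?case using cf_coeff_1(1) by simp
next
  case (step k)
  then show ?case by (metis cf_coeff_Suc gauss_map_unit_irrationals)
qed

lemma map_cf_coeff_Suc:
  "map (\<lambda>k. cf_coeff k x) [1..<Suc (Suc n)] =
     cf_coeff 1 x # map (\<lambda>k. cf_coeff k (gauss_map x)) [1..<Suc n]"
  by (rule nth_equalityI) (auto simp: nth_Cons cf_coeff_Suc simp del: upt_Suc split: nat.split)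

lemma cf_nonneg: "0 \<le> cf as"
  by (induction as) auto

lemma cf_step_contract:
  fixes a b s t :: real
  assumes "a \<ge> 1" "b \<ge> 1" "s \<ge> 0" "t \<ge> 0"
  shows "\<bar>1 / (a + 1 / (b + s)) - 1 / (a + 1 / (b + t))\<bar> \<le> \<bar>s - t\<bar> / 4"
proof -
  define u v where "u = a * (b + s) + 1" and "v = a * (b + t) + 1"
  have "1 * 1 \<le> a * (b + s)" "1 * 1 \<le> a * (b + t)"
    using assms by (intro mult_mono; simp)+
  then have uv: "u \<ge> 2" "v \<ge> 2"
    by (auto simp: u_def v_def)
  have "2 * 2 \<le> u * v"
    using uv by (intro mult_mono) auto
  then have "u * v \<ge> 4"
    by simp
  have 1: "1 / (a + 1 / (b + s)) = (b + s) / u" "1 / (a + 1 / (b + t)) = (b + t) / v"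
    using assms by (auto simp: u_def v_def field_simps)
  have "(b + s) / u - (b + t) / v = (s - t) / (u * v)"
    using uv by (simp add: diff_frac_eq) (simp add: u_def v_def algebra_simps)
  then have "\<bar>1 / (a + 1 / (b + s)) - 1 / (a + 1 / (b + t))\<bar> = \<bar>s - t\<bar> / (u * v)"
    using uv unfolding 1 by (simp add: abs_mult)
  also have "\<dots> \<le> \<bar>s - t\<bar> / 4"
    using \<open>u * v \<ge> 4\<close> by (intro divide_left_mono) auto
  finally show ?thesis .
qed

lemma cf_coeff_approx:
  assumes "x \<in> unit_irrationals"
  shows "\<bar>x - real_of_rat (cf (map (\<lambda>k. cf_coeff k x) [1..<Suc n]))\<bar> \<le> 2 * (1 / 2) ^ n"
  using assms
proof (induction n arbitrary: x rule: induct_nat_012)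
  case 0
  then show ?case by (simp add: unit_irrationals_def)
next
  case 1
  have "0 \<le> x" "x < 1"
    using 1 by (auto simp: unit_irrationals_def)
  moreover have "0 \<le> 1 / real (cf_coeff 1 x)" "1 / real (cf_coeff 1 x) \<le> 1"
    using cf_coeff_1(1)[OF 1] by auto
  ultimately have "\<bar>x - 1 / real (cf_coeff 1 x)\<bar> \<le> 1"
    by linarith
  then show ?case
    by (simp add: of_rat_divide)
next
  case (ge2 n)
  define y where "y = gauss_map x"
  define z where "z = gauss_map y"
  define t where "t = real_of_rat (cf (map (\<lambda>k. cf_coeff k z) [1..<Suc n]))"
  have y: "y \<in> unit_irrationals"
    using gauss_map_unit_irrationals ge2.prems y_def by simp
  then have z: "z \<in> unit_irrationals"
    using gauss_map_unit_irrationals z_def by simp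
  define a b where "a = real (cf_coeff 1 x)" and "b = real (cf_coeff 1 y)"
  have ab: "a \<ge> 1" "b \<ge> 1"
    using cf_coeff_1(1)[OF ge2.prems] cf_coeff_1(1)[OF y] by (auto simp: a_def b_def)
  have "x = 1 / (a + y)" "y = 1 / (b + z)"
    using cf_coeff_1(2)[OF ge2.prems] cf_coeff_1(2)[OF y] unfolding a_def b_def y_def z_def by auto
  then have x: "x = 1 / (a + 1 / (b + z))"
    by simp
  have c: "real_of_rat (cf (map (\<lambda>k. cf_coeff k x) [1..<Suc (Suc (Suc n))])) = 1 / (a + 1 / (b + t))"
    unfolding map_cf_coeff_Suc cf.simps y_def[symmetric] z_def[symmetric]
    by (simp add: of_rat_divide of_rat_add a_def b_def t_def del: upt_Suc)
  have "t \<ge> 0" "z \<ge> 0"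
    using z cf_nonneg by (auto simp: t_def unit_irrationals_def)
  then have "\<bar>1 / (a + 1 / (b + z)) - 1 / (a + 1 / (b + t))\<bar> \<le> \<bar>z - t\<bar> / 4"
    using ab by (intro cf_step_contract)
  also have "\<dots> \<le> 2 * (1 / 2) ^ n / 4"
    using ge2.IH(1)[OF z] by (simp add: t_def del: upt_Suc)
  finally show ?case
    unfolding c using x by simp
qed

lemma cf_coeff_tendsto:
  assumes "x \<in> unit_irrationals"
  shows "(\<lambda>n. real_of_rat (cf (map (\<lambda>k. cf_coeff k x) [1..<Suc n]))) \<longlonglongrightarrow> x"
proof -
  have "(\<lambda>n. 2 * (1 / 2) ^ n :: real) \<longlonglongrightarrow> 2 * 0"
    by (intro tendsto_intros) auto
  then have "(\<lambda>n. 2 * (1 / 2) ^ n :: real) \<longlonglongrightarrow> 0"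
    by simp
  then have "(\<lambda>n. real_of_rat (cf (map (\<lambda>k. cf_coeff k x) [1..<Suc n])) - x) \<longlonglongrightarrow> 0"
    by (rule Lim_null_comparison[rotated])
       (use cf_coeff_approx[OF assms] in \<open>simp add: abs_minus_commute del: upt_Suc\<close>)
  then show ?thesis
    by (rule LIM_zero_cancel)
qed

text \<open>Only meaningful for \<open>\<theta> > 1/2\<close>, where the sums and the limit exist.\<close>

definition pressure :: "real \<Rightarrow> real" where
  "pressure \<theta> =
     lim (\<lambda>n. 1 / real n *
       ln (\<Sum>\<^sub>\<infinity>as\<in>{as. length as = n \<and> (\<forall>a\<in>set as. 1 \<le> a)}.
             real_of_int (cf_denom as) powr (- 2 * \<theta>)))"

text \<open>
  Conventions: the empty set contributes 0, and a nonempty set contributes 1 when \<open>s = 0\<close>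
  (whereas \<^term>\<open>0 powr 0 = (0::real)\<close>).
\<close>

definition diam_gauge :: "real \<Rightarrow> 'a::metric_space set \<Rightarrow> real" where
  "diam_gauge s U = (if U = {} then 0 else if s = 0 then 1 else diameter U powr s)"

text \<open>Boundedness is required because \<^const>\<open>diameter\<close> is unspecified on unbounded sets.\<close>

definition hausdorff_premeasure :: "real \<Rightarrow> real \<Rightarrow> 'a::metric_space set \<Rightarrow> ennreal" where
  "hausdorff_premeasure s \<delta> A =
     (INF U \<in> {U :: nat \<Rightarrow> 'a set. A \<subseteq> (\<Union>i. U i) \<and> (\<forall>i. bounded (U i) \<and> diameter (U i) \<le> \<delta>)}.
        \<Sum>i. ennreal (diam_gauge s (U i)))"

definition hausdorff_measure :: "real \<Rightarrow> 'a::metric_space set \<Rightarrow> ennreal" where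
  "hausdorff_measure s A = (SUP \<delta>\<in>{0<..}. hausdorff_premeasure s \<delta> A)"

definition hausdorff_dim :: "'a::metric_space set \<Rightarrow> ennreal" where
  "hausdorff_dim A = (INF s\<in>{s. 0 \<le> s \<and> hausdorff_measure s A = 0}. ennreal s)"

definition asymp_sum_set :: "(nat \<Rightarrow> real) \<Rightarrow> real set" where
  "asymp_sum_set \<phi> =
     {x \<in> unit_irrationals. (\<lambda>n. real (coeff_sum n x) / \<phi> n) \<longlonglongrightarrow> 1}"

definition phi_poly :: "real \<Rightarrow> real \<Rightarrow> real \<Rightarrow> nat \<Rightarrow> real" where
  "phi_poly c d r n =
     exp (c * (real_of_int \<lfloor>d * real n powr (1 - r)\<rfloor> powr (r / (1 - r)) / d powr (r / (1 - r))))"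

definition phi_exp :: "real \<Rightarrow> real \<Rightarrow> nat \<Rightarrow> real" where
  "phi_exp c \<gamma> n = exp (c * exp (\<gamma> * real_of_int \<lfloor>ln (real n) / \<gamma>\<rfloor>))"

definition eta_eq :: "real \<Rightarrow> real \<Rightarrow> real \<Rightarrow> real \<Rightarrow> bool" where
  "eta_eq c d r \<theta> \<longleftrightarrow> 1 / 2 < \<theta> \<and> pressure \<theta> = c * d * (1 - r) * (2 * \<theta> - 1)"

definition eta :: "real \<Rightarrow> real \<Rightarrow> real \<Rightarrow> real" where
  "eta c d r = (THE \<theta>. eta_eq c d r \<theta>)"

definition xi_eq :: "real \<Rightarrow> real \<Rightarrow> real \<Rightarrow> bool" where
  "xi_eq c \<gamma> \<theta> \<longleftrightarrow> 1 / 2 < \<theta> \<and>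
     pressure \<theta> = c * ((exp \<gamma> + 1) / (exp \<gamma> - 1) * \<theta> - 1 / (exp \<gamma> - 1))"

definition xi :: "real \<Rightarrow> real \<Rightarrow> real" where
  "xi c \<gamma> = (THE \<theta>. xi_eq c \<gamma> \<theta>)"

end

theory Submission
  imports Defs "HOL-Probability.Infinite_Product_Measure" "HOL-Real_Asymp.Real_Asymp"
    "HOL-Library.Nat_Bijection"
begin

text \<open>
  Both functions \<open>\<phi>\<close> are constant, equal to \<open>exp (L k)\<close>, between jump times \<open>N k\<close>, and
  \<open>(\<Sum>j<k. L j) / N k \<rightarrow> \<alpha>\<close>, \<open>L k / N k \<rightarrow> \<beta>\<close>, with \<open>exp (L k)\<close> growing at least geometrically.
  If \<open>S\<^sub>n(x) \<sim> \<phi>(n)\<close>, then the coefficient at \<open>N k\<close> is comparable to \<open>exp (L k)\<close>, whereas the other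
  coefficients are almost free.  Grouping the points by the \<open>N k - 1\<close> first coefficients gives sets
  of diameter \<open>O(q\<^sup>-\<^sup>2 exp (- L k))\<close>, and the sum of the \<open>\<theta>\<close>-th powers of the diameters is
  \<open>exp (N k (P(\<theta>) - \<alpha> (2\<theta> - 1) - \<beta>\<theta> + o(1)))\<close>; so the dimension is at most the zero of the
  exponent.  Conversely, let the coefficient at \<open>N k\<close> range over a window of relative length
  \<open>1/(k+1)\<close> and the others over \<open>{1..M}\<close> with weights \<open>q\<^sup>-\<^sup>2\<^sup>s\<close>.  The resulting product measure
  satisfies a Frostman estimate with exponent \<open>s\<close> as soon as the pressure of the alphabet \<open>{1..M}\<close>
  exceeds \<open>\<alpha> (2s - 1) + \<beta>s\<close>.
\<close>

section \<open>Continued fractions and continuants\<close>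

text \<open>The exponent is a count of costs. A past jump coefficient of size
  \<open>exp (L j)\<close> has about \<open>exp (L j)\<close> values, each lowering the weight by
  \<open>exp (- 2 * \<theta> * L j)\<close>; together they contribute
  \<open>exp (- (2 * \<theta> - 1) * L j)\<close>. The current jump is treated differently: its
  admissible values fill one interval, so a single set is kept and the factor is
  \<open>exp (- \<theta> * L k)\<close>, which is the smaller one because \<theta> < 1. This is the
  origin of the \<beta> term. In the lower bound the windows must shrink relative to their position,
  or the sums would not be asymptotic to \<phi>. The price is a factor \<open>k + 1\<close> per
  jump, in total of order \<open>exp (k * ln k)\<close> in the exponent scale, and the assumption
  \<open>sparse\<close> makes it subexponential in \<open>N k\<close>. The assumption
  \<open>fast\<close> makes the other coefficients, bounded by \<open>M\<close>, negligible against
  \<open>exp (L k)\<close>. All such losses, and the constants from splitting words, are paid for by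
  the strict inequality between the pressure and the linear term.\<close>

fun num den :: "nat list \<Rightarrow> nat" where
  "num [] = 0"
| "num (a # w) = den w"
| "den [] = 1"
| "den (a # w) = a * den w + num w"

text \<open>Numerator and denominator of the preceding convergent, that is, of the word without its
  last letter; the empty word gets the conventional value 1/0.\<close>

fun num' den' :: "nat list \<Rightarrow> nat" where
  "num' [] = 1"
| "num' (a # w) = den' w"
| "den' [] = 0"
| "den' (a # w) = a * den' w + num' w"

text \<open>The inverse branch of the iterated Gauss map that prepends \<open>w\<close>; by
  \<open>ev_eq\<close> it is the Moebius map with matrix \<open>num'\<close>, \<open>num\<close>,
  \<open>den'\<close>, \<open>den\<close>.\<close>

fun ev :: "nat list \<Rightarrow> real \<Rightarrow> real" where
  "ev [] t = t"
| "ev (a # w) t = 1 / (real a + ev w t)"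

definition words :: "nat set \<Rightarrow> nat \<Rightarrow> nat list set" where
  "words A n = {w. length w = n \<and> set w \<subseteq> A}"

lemma num_append: "num (u @ v) = num u * den v + num' u * num v"
  and den_append: "den (u @ v) = den u * den v + den' u * num v"
  by (induction u) (auto simp: algebra_simps)

lemma num'_append: "num' (u @ v) = num u * den' v + num' u * num' v"
  and den'_append: "den' (u @ v) = den u * den' v + den' u * num' v"
  by (induction u) (auto simp: algebra_simps)

lemma coprime_num_den: "coprime (num w) (den w)"
proof (induction w)
  case (Cons a w)
  have "gcd (den w) (a * den w + num w) = gcd (den w) (num w)"
    by (metis add.commute gcd_add_mult)
  then show ?case using Cons by (simp add: coprime_iff_gcd_eq_1 gcd.commute)
qed simp

lemma den_pos: "0 \<notin> set w \<Longrightarrow> 0 < den w"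
  by (induction w) auto

lemma num_le_den: "0 \<notin> set w \<Longrightarrow> num w \<le> den w"
proof (cases w)
  case (Cons a v)
  assume "0 \<notin> set w"
  then have "1 * den v \<le> a * den v" using Cons by (intro mult_mono) auto
  then show ?thesis unfolding Cons num.simps den.simps by linarith
qed simp

text \<open>The second inequality carries the induction: \<open>num' w \<le> num w\<close> fails for
  the empty word, so \<open>num'\<close> can only be compared together with one copy of
  \<open>den'\<close>, which the first letter supplies.\<close>

lemma den'_le_den_aux: "0 \<notin> set w \<Longrightarrow> den' w \<le> den w \<and> den' w + num' w \<le> den w + num w"
proof (induction w)
  case (Cons a w)
  then obtain b where a: "a = Suc b" by (cases a) auto
  have "b * den' w \<le> b * den w" using Cons by auto
  moreover have "den' w \<le> den w" "den' w + num' w \<le> den w + num w" using Cons by auto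
  ultimately show ?case unfolding a den.simps num.simps den'.simps num'.simps mult_Suc by linarith
qed simp

lemma den'_le_den: "0 \<notin> set w \<Longrightarrow> den' w \<le> den w"
  using den'_le_den_aux by blast

lemma den_append_ge: "den u * den v \<le> den (u @ v)"
  by (simp add: den_append)

text \<open>Together with \<open>den_append_ge\<close>, denominators are multiplicative up to a
  factor 2. Every constant \<open>4 powr s\<close> below is this 2 raised to
  \<open>2 * s\<close>.\<close>

lemma den_append_le:
  assumes "0 \<notin> set u" "0 \<notin> set v"
  shows "den (u @ v) \<le> 2 * den u * den v"
  using mult_mono[OF den'_le_den[OF assms(1)] num_le_den[OF assms(2)]]
  by (simp add: den_append)

lemma length_le_den: "0 \<notin> set w \<Longrightarrow> length w \<le> den w"
proof (induction w)
  case (Cons a w)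
  then have a: "a \<ge> 1" by (cases a) auto
  show ?case
  proof (cases w)
    case Nil
    then show ?thesis using a by simp
  next
    case (Cons b v)
    have "1 * den w \<le> a * den w" using a by (intro mult_mono) auto
    moreover have "num w > 0" using Cons Cons.prems den_pos by auto
    moreover have "length w \<le> den w" using Cons.IH Cons.prems by simp
    ultimately show ?thesis unfolding den.simps list.size by linarith
  qed
qed simp

lemma cf_eq_num_den: "0 \<notin> set w \<Longrightarrow> cf w = of_nat (num w) / of_nat (den w)"
proof (induction w)
  case (Cons a w)
  then have "den w > 0" "den (a # w) > 0" using den_pos by (auto simp del: den.simps)
  moreover have "of_nat (den (a # w)) = (of_nat a * of_nat (den w) + of_nat (num w) :: rat)" by simp
  ultimately have "of_nat a + of_nat (num w) / of_nat (den w) = (of_nat (den (a # w)) / of_nat (den w) :: rat)"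
    by (simp add: field_simps del: den.simps)
  then show ?case using Cons by (simp del: den.simps)
qed simp

lemma cf_denom_eq_den: "0 \<notin> set w \<Longrightarrow> cf_denom w = int (den w)"
proof -
  assume w: "0 \<notin> set w"
  have "cf w = Rat.Fract (int (num w)) (int (den w))"
    by (simp add: cf_eq_num_den[OF w] Fract_of_int_quotient)
  moreover have "coprime (int (num w)) (int (den w))" using coprime_num_den by simp
  ultimately show ?thesis using den_pos[OF w]
    by (simp add: cf_denom_def quotient_of_Fract normalize_stable)
qed

lemma ev_append: "ev (u @ v) t = ev u (ev v t)"
  by (induction u) auto

lemma ev_nonneg: "0 \<le> t \<Longrightarrow> 0 \<le> ev w t"
  by (induction w) auto

lemma ev_le_1: "0 \<notin> set w \<Longrightarrow> 0 \<le> t \<Longrightarrow> t \<le> 1 \<Longrightarrow> ev w t \<le> 1"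
proof (cases w)
  case (Cons a v)
  assume "0 \<notin> set w" "0 \<le> t"
  then have "real a \<ge> 1" "ev v t \<ge> 0" using Cons ev_nonneg by (auto simp: Suc_le_eq)
  then show ?thesis using Cons by (simp add: divide_le_eq_1)
qed simp

lemma ev_eq:
  fixes t :: real
  assumes "0 \<notin> set w" "0 \<le> t"
  shows "ev w t = (num w + t * num' w) / (den w + t * den' w)"
  using assms
proof (induction w)
  case (Cons a w)
  have "real (den w) > 0" "real (den (a # w)) > 0"
    using Cons.prems den_pos[of w] den_pos[of "a # w"] by (auto simp del: den.simps)
  then have "real (den w) + t * den' w > 0" "real (den (a # w)) + t * den' (a # w) > 0"
    using Cons.prems by (intro add_pos_nonneg; simp)+
  moreover have "real a + (real (num w) + t * real (num' w)) / (real (den w) + t * real (den' w))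
      = (real (den (a # w)) + t * real (den' (a # w))) / (real (den w) + t * real (den' w))"
    using \<open>real (den w) + t * den' w > 0\<close> by (simp add: field_simps)
  ultimately show ?case using Cons by simp
qed simp

text \<open>Each letter multiplies by a matrix of determinant -1, hence the absolute value.\<close>

lemma det_num_den: "\<bar>int (num w) * int (den' w) - int (num' w) * int (den w)\<bar> = 1"
proof (induction w)
  case (Cons a w)
  have "int (num (a # w)) * int (den' (a # w)) - int (num' (a # w)) * int (den (a # w))
      = - (int (num w) * int (den' w) - int (num' w) * int (den w))" by (simp add: algebra_simps)
  then show ?case using Cons by (simp only: abs_minus_cancel)
qed simp

lemma abs_ev_diff:
  fixes t u :: real
  assumes w: "0 \<notin> set w" and t: "0 \<le> t" and u: "0 \<le> u"
  shows "\<bar>ev w t - ev w u\<bar> = \<bar>t - u\<bar> / ((den w + t * den' w) * (den w + u * den' w))"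
proof -
  have d: "real (den w) > 0" using den_pos[OF w] by simp
  have p: "den w + t * den' w > 0" "den w + u * den' w > 0"
    using d t u by (intro add_pos_nonneg; simp)+
  define D where "D = int (num w) * int (den' w) - int (num' w) * int (den w)"
  have D: "\<bar>real_of_int D\<bar> = 1" using det_num_den[of w] unfolding D_def by linarith
  have "ev w t - ev w u = (u - t) * real_of_int D / ((den w + t * den' w) * (den w + u * den' w))"
    unfolding ev_eq[OF w t] ev_eq[OF w u] using p
    by (simp add: diff_frac_eq) (simp add: D_def algebra_simps)
  then show ?thesis using p D by (simp add: abs_mult abs_minus_commute)
qed

lemma abs_ev_diff_le:
  fixes t u :: real
  assumes w: "0 \<notin> set w" and t: "0 \<le> t" and u: "0 \<le> u"
  shows "\<bar>ev w t - ev w u\<bar> \<le> \<bar>t - u\<bar> / (real (den w))\<^sup>2"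
proof -
  have d: "real (den w) > 0" using den_pos[OF w] by simp
  have "real (den w) * real (den w) \<le> (den w + t * den' w) * (den w + u * den' w)"
    using t u by (intro mult_mono) auto
  then show ?thesis unfolding abs_ev_diff[OF assms] power2_eq_square using d
    by (intro divide_left_mono) (auto intro!: mult_pos_pos add_pos_nonneg simp: t u)
qed

text \<open>For arguments in the unit interval \<open>den' w \<le> den w\<close> bounds each of the
  two denominators by \<open>2 * den w\<close>, hence the 4.\<close>

lemma abs_ev_diff_ge:
  fixes t u :: real
  assumes w: "0 \<notin> set w" and t: "0 \<le> t" "t \<le> 1" and u: "0 \<le> u" "u \<le> 1"
  shows "\<bar>ev w t - ev w u\<bar> \<ge> \<bar>t - u\<bar> / (4 * (real (den w))\<^sup>2)"
proof -
  have d: "real (den w) > 0" using den_pos[OF w] by simp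
  have "x * real (den' w) \<le> real (den w)" if "0 \<le> x" "x \<le> 1" for x
    using mult_mono[of x 1 "real (den' w)" "real (den w)"] den'_le_den[OF w] that by simp
  then have "(den w + t * den' w) * (den w + u * den' w) \<le> (2 * real (den w)) * (2 * real (den w))"
    using t u by (intro mult_mono) (fastforce)+
  then show ?thesis unfolding abs_ev_diff[OF w t(1) u(1)] power2_eq_square using d
    by (intro divide_left_mono) (auto intro!: mult_pos_pos add_pos_nonneg simp: t u)
qed

lemma gauss_map_funpow_unit_irrationals:
  "x \<in> unit_irrationals \<Longrightarrow> (gauss_map ^^ n) x \<in> unit_irrationals"
  by (induction n) (auto intro: gauss_map_unit_irrationals)

lemma ev_cf_coeff:
  assumes "x \<in> unit_irrationals"
  shows "ev (map (\<lambda>k. cf_coeff k x) [1..<Suc n]) ((gauss_map ^^ n) x) = x"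
  using assms
proof (induction n arbitrary: x)
  case (Suc n)
  have "ev (map (\<lambda>k. cf_coeff k x) [1..<Suc (Suc n)]) ((gauss_map ^^ Suc n) x)
      = 1 / (cf_coeff 1 x + gauss_map x)"
    unfolding map_cf_coeff_Suc using Suc.IH[OF gauss_map_unit_irrationals[OF Suc.prems]]
    by (simp add: funpow_swap1 del: upt_Suc)
  then show ?case using cf_coeff_1(2)[OF Suc.prems] by simp
qed simp

lemma cf_coeff_bound:
  assumes "x \<in> unit_irrationals"
  shows "(gauss_map ^^ n) x \<le> 1 / real (cf_coeff (Suc n) x)"
proof -
  define y where "y = (gauss_map ^^ n) x"
  have y: "y \<in> unit_irrationals" using gauss_map_funpow_unit_irrationals[OF assms] y_def by simp
  have "cf_coeff (Suc n) x = cf_coeff 1 y" by (simp add: cf_coeff_def y_def)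
  moreover have "y = 1 / (real (cf_coeff 1 y) + gauss_map y)" "cf_coeff 1 y \<ge> 1"
    using cf_coeff_1[OF y] by auto
  moreover have "gauss_map y \<ge> 0" using gauss_map_unit_irrationals[OF y] by (simp add: unit_irrationals_def)
  moreover have "1 / (real (cf_coeff 1 y) + gauss_map y) \<le> 1 / real (cf_coeff 1 y)"
    using calculation by (intro divide_left_mono) auto
  ultimately show ?thesis unfolding y_def[symmetric] by metis
qed

section \<open>Infinite continued fractions with prescribed coefficients, numbered from 0\<close>

definition cfval :: "(nat \<Rightarrow> nat) \<Rightarrow> real" where
  "cfval d = lim (\<lambda>n. ev (map d [0..<n]) 0)"

text \<open>The first \<open>n\<close> coefficients fix the value up to the inverse square of the
  denominator, and the linear growth \<open>length_le_den\<close> already makes the sequence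
  Cauchy.\<close>

lemma cfval_lim:
  assumes d: "\<And>i. d i > 0"
  shows "(\<lambda>n. ev (map d [0..<n]) 0) \<longlonglongrightarrow> cfval d"
proof -
  let ?X = "\<lambda>n. ev (map d [0..<n]) 0"
  have pos: "0 \<notin> set (map d l)" for l using d by (metis gr_implies_not0 ex_map_conv)
  have *: "\<bar>?X (n + m) - ?X n\<bar> \<le> 1 / real n" if "n > 0" for n m
  proof -
    have e: "map d [0..<n + m] = map d [0..<n] @ map d [n..<n+m]"
      by (metis map_append upt_add_eq_append zero_le)
    define u where "u = ev (map d [n..<n+m]) 0"
    have u: "0 \<le> u" "u \<le> 1" using ev_nonneg ev_le_1[OF pos] u_def by auto
    let ?q = "real (den (map d [0..<n]))"
    have q: "real n \<le> ?q" using length_le_den[OF pos, of "[0..<n]"] by simp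
    have "\<bar>?X (n + m) - ?X n\<bar> \<le> \<bar>u - 0\<bar> / ?q\<^sup>2"
      unfolding e ev_append u_def[symmetric] by (intro abs_ev_diff_le pos) (use u in auto)
    also have "\<dots> \<le> 1 / ?q\<^sup>2" using u by (intro divide_right_mono) auto
    also have "\<dots> \<le> 1 / real n"
    proof (intro divide_left_mono)
      have "real n * 1 \<le> ?q * ?q" using q that by (intro mult_mono) auto
      then show "real n \<le> ?q\<^sup>2" by (simp add: power2_eq_square)
    qed (use that q in auto)
    finally show ?thesis .
  qed
  have "Cauchy ?X"
  proof (rule metric_CauchyI)
    fix e :: real assume e: "e > 0"
    obtain n0 where n0: "1 / real (Suc n0) < e / 2" using e
      by (metis half_gt_zero nat_approx_posE)
    show "\<exists>M. \<forall>m\<ge>M. \<forall>n\<ge>M. dist (?X m) (?X n) < e"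
    proof (intro exI allI impI)
      fix m n assume mn: "m \<ge> Suc n0" "n \<ge> Suc n0"
      have "\<bar>?X m - ?X (Suc n0)\<bar> \<le> 1 / real (Suc n0)" "\<bar>?X n - ?X (Suc n0)\<bar> \<le> 1 / real (Suc n0)"
        using *[of "Suc n0" "m - Suc n0"] *[of "Suc n0" "n - Suc n0"] mn
        by (simp_all del: upt_Suc of_nat_Suc)
      then show "dist (?X m) (?X n) < e" using n0 unfolding dist_real_def by linarith
    qed
  qed
  then show ?thesis unfolding cfval_def by (simp add: Cauchy_convergent_iff convergent_LIMSEQ_iff)
qed

lemma cfval_nonneg: assumes d: "\<And>i. d i > 0" shows "0 \<le> cfval d"
  by (rule LIMSEQ_le_const[OF cfval_lim[of d, OF d]]) (auto intro: ev_nonneg)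

lemma cfval_step:
  assumes d: "\<And>i. d i > 0"
  shows "cfval d = 1 / (real (d 0) + cfval (\<lambda>i. d (Suc i)))"
proof -
  let ?e = "\<lambda>i. d (Suc i)"
  have "(\<lambda>n. ev (map d [0..<Suc n]) 0) \<longlonglongrightarrow> cfval d"
    using LIMSEQ_Suc[OF cfval_lim[of d, OF d]] .
  moreover have "ev (map d [0..<Suc n]) 0 = 1 / (real (d 0) + ev (map ?e [0..<n]) 0)" for n
    unfolding map_upt_Suc by simp
  ultimately have a: "(\<lambda>n. 1 / (real (d 0) + ev (map ?e [0..<n]) 0)) \<longlonglongrightarrow> cfval d" by simp
  have "real (d 0) + cfval ?e > 0" using cfval_nonneg[of ?e] d by (intro add_pos_nonneg) auto
  then have "(\<lambda>n. 1 / (real (d 0) + ev (map ?e [0..<n]) 0)) \<longlonglongrightarrow> 1 / (real (d 0) + cfval ?e)"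
    using d by (intro tendsto_intros cfval_lim) auto
  then show ?thesis using a LIMSEQ_unique by blast
qed

lemma cfval_bounds: assumes d: "\<And>i. d i > 0" shows "0 < cfval d" "cfval d < 1"
proof -
  let ?e = "\<lambda>i. d (Suc i)"
  have p: "0 < cfval d" if "\<And>i. d i > 0" for d
    using cfval_nonneg[of "\<lambda>i. d (Suc i)"] that
    by (metis cfval_step[of d, OF that] add_pos_nonneg of_nat_0_less_iff zero_less_divide_1_iff)
  show "0 < cfval d" using p[of d, OF d] .
  have "cfval ?e > 0" by (rule p) (rule d)
  moreover have "real (d 0) \<ge> 1" using d[of 0] by simp
  ultimately show "cfval d < 1" using cfval_step[of d, OF d] by (simp add: divide_less_eq_1)
qed

text \<open>Euclidean descent: if the value is \<open>p / q\<close>, dropping the first coefficient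
  gives a fraction with denominator \<open>p < q\<close>, again the value of a sequence of positive
  coefficients.\<close>

lemma cfval_irrational:
  assumes d: "\<And>i. d i > 0"
  shows "cfval d \<noteq> real p / real q"
  using assms
proof (induction q arbitrary: d p rule: less_induct)
  case (less q)
  let ?e = "\<lambda>i. d (Suc i)"
  show ?case
  proof
    assume eq: "cfval d = real p / real q"
    have b: "0 < cfval d" "cfval d < 1" using cfval_bounds[of d, OF less.prems] .
    then have pq: "0 < p" "p < q" using eq by (auto simp: zero_less_divide_iff divide_less_eq)
    have s: "cfval d = 1 / (real (d 0) + cfval ?e)" using cfval_step[of d, OF less.prems] .
    have e: "0 < cfval ?e" by (rule cfval_bounds) (rule less.prems)
    then have "real (d 0) + cfval ?e = real q / real p" using s eq pq
      by (simp add: field_simps)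
    then have c: "cfval ?e = (real q - real (d 0 * p)) / real p" using pq by (simp add: field_simps)
    then have "real q > real (d 0 * p)" using e pq by (simp add: zero_less_divide_iff)
    moreover from this have "d 0 * p \<le> q" by linarith
    ultimately have "cfval ?e = real (q - d 0 * p) / real p" using c by (simp only: of_nat_diff)
    then show False using less.IH[OF pq(2), of ?e, OF less.prems] by metis
  qed
qed

lemma cfval_unit_irrationals:
  assumes d: "\<And>i. d i > 0"
  shows "cfval d \<in> unit_irrationals"
proof -
  have b: "0 < cfval d" "cfval d < 1" using cfval_bounds[of d, OF d] .
  have "cfval d \<notin> \<rat>"
  proof
    assume "cfval d \<in> \<rat>"
    then obtain m n :: nat where "n \<noteq> 0" "\<bar>cfval d\<bar> = real m / real n" by (rule Rats_abs_nat_div_natE)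
    then show False using cfval_irrational[of d, OF d, of m n] b by simp
  qed
  then show ?thesis using b by (simp add: unit_irrationals_def)
qed

lemma gauss_map_cfval:
  assumes d: "\<And>i. d i > 0"
  shows "gauss_map (cfval d) = cfval (\<lambda>i. d (Suc i))" "nat \<lfloor>1 / cfval d\<rfloor> = d 0"
proof -
  let ?e = "\<lambda>i. d (Suc i)"
  have b: "0 < cfval ?e" "cfval ?e < 1" using cfval_bounds[of ?e, OF d] .
  have s: "1 / cfval d = real (d 0) + cfval ?e" using cfval_step[of d, OF d] by simp
  have "\<lfloor>1 / cfval d\<rfloor> = int (d 0)" unfolding s using b by linarith
  then show "gauss_map (cfval d) = cfval (\<lambda>i. d (Suc i))" "nat \<lfloor>1 / cfval d\<rfloor> = d 0"
    unfolding gauss_map_def frac_def using s by auto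
qed

lemma gauss_map_funpow_cfval:
  assumes d: "\<And>i. d i > 0"
  shows "(gauss_map ^^ n) (cfval d) = cfval (\<lambda>i. d (i + n))"
proof (induction n)
  case (Suc n)
  have "gauss_map (cfval (\<lambda>i. d (i + n))) = cfval (\<lambda>i. d (Suc i + n))"
    using gauss_map_cfval(1)[of "\<lambda>i. d (i + n)"] d by simp
  then show ?case using Suc by simp
qed simp

lemma cf_coeff_cfval:
  assumes d: "\<And>i. d i > 0"
  shows "cf_coeff (Suc n) (cfval d) = d n"
  using gauss_map_cfval(2)[of "\<lambda>i. d (i + n)"] d gauss_map_funpow_cfval[of d n]
  by (simp add: cf_coeff_def)

lemma cfval_ev:
  assumes d: "\<And>i. d i > 0"
  shows "cfval d = ev (map d [0..<n]) (cfval (\<lambda>i. d (i + n)))"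
proof -
  have "map (\<lambda>k. cf_coeff k (cfval d)) [1..<Suc n] = map d [0..<n]"
    by (rule nth_equalityI) (auto simp: cf_coeff_cfval[of d, OF d] simp del: upt_Suc)
  then show ?thesis using ev_cf_coeff[OF cfval_unit_irrationals[of d, OF d], of n]
    by (simp add: gauss_map_funpow_cfval[of d, OF d])
qed

section \<open>The pressure function\<close>

definition wt :: "real \<Rightarrow> nat list \<Rightarrow> real" where
  "wt s w = real (den w) powr (- 2 * s)"

definition conc :: "'a list set \<Rightarrow> 'a list set \<Rightarrow> 'a list set" where
  "conc S T = (\<lambda>(u, v). u @ v) ` (S \<times> T)"

definition Z :: "nat set \<Rightarrow> nat \<Rightarrow> real \<Rightarrow> real" where
  "Z A n s = (\<Sum>\<^sub>\<infinity>w\<in>words A n. wt s w)"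

definition pressure_on :: "nat set \<Rightarrow> real \<Rightarrow> real" where
  "pressure_on A s = lim (\<lambda>n. ln (Z A n s) / real n)"

lemma wt_nonneg: "0 \<le> wt s w"
  by (simp add: wt_def)

lemma wt_pos: "0 \<notin> set w \<Longrightarrow> 0 < wt s w"
  using den_pos by (simp add: wt_def)

lemma wt_append_le:
  assumes "0 \<notin> set u" "0 \<notin> set v" "0 \<le> s"
  shows "wt s (u @ v) \<le> wt s u * wt s v"
proof -
  have "real (den u) * real (den v) \<le> real (den (u @ v))"
    using den_append_ge by (metis of_nat_le_iff of_nat_mult)
  then have "real (den (u @ v)) powr (- 2 * s) \<le> (real (den u) * real (den v)) powr (- 2 * s)"
    using assms den_pos by (intro powr_mono2') auto
  then show ?thesis by (simp add: wt_def powr_mult)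
qed

lemma wt_append_ge:
  assumes "0 \<notin> set u" "0 \<notin> set v" "0 \<le> s"
  shows "4 powr (- s) * (wt s u * wt s v) \<le> wt s (u @ v)"
proof -
  have "real (den (u @ v)) \<le> 2 * real (den u) * real (den v)"
    using den_append_le[OF assms(1,2)] by (metis of_nat_le_iff of_nat_mult of_nat_numeral)
  then have "(2 * real (den u) * real (den v)) powr (- 2 * s) \<le> real (den (u @ v)) powr (- 2 * s)"
    using assms den_pos[of "u @ v"] by (intro powr_mono2') auto
  moreover have "(2::real) powr (- 2 * s) = 4 powr (- s)"
    using powr_powr[of 2 2 "- s"] by simp
  ultimately show ?thesis by (simp add: wt_def powr_mult mult.assoc)
qed

lemma inj_on_append: "(\<And>u. u \<in> S \<Longrightarrow> length u = n) \<Longrightarrow> inj_on (\<lambda>(u, v). u @ v) (S \<times> T)"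
  by (auto simp: inj_on_def)

lemma words_add: "words A (n + m) = conc (words A n) (words A m)"
proof
  show "words A (n + m) \<subseteq> conc (words A n) (words A m)"
  proof
    fix w assume w: "w \<in> words A (n + m)"
    then have "(take n w, drop n w) \<in> words A n \<times> words A m"
      by (auto simp: words_def dest: in_set_takeD in_set_dropD)
    then show "w \<in> conc (words A n) (words A m)"
      unfolding conc_def by (metis (mono_tags, lifting) append_take_drop_id case_prod_conv image_iff)
  qed
qed (auto simp: conc_def words_def)

lemma words_0: "words A 0 = {[]}"
  by (auto simp: words_def)

lemma words_1: "words A 1 = (\<lambda>a. [a]) ` A"
  by (auto simp: words_def length_Suc_conv)

lemma words_pos: "A \<subseteq> {1..} \<Longrightarrow> w \<in> words A n \<Longrightarrow> 0 \<notin> set w"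
  by (auto simp: words_def)

lemma wt_product_has_sum:
  assumes "wt s summable_on S" "wt s summable_on T"
  shows "((\<lambda>(u, v). wt s u * wt s v) has_sum (infsum (wt s) S * infsum (wt s) T)) (S \<times> T)"
proof -
  have i: "((\<lambda>v. (\<lambda>(u, v). wt s u * wt s v) (u, v)) has_sum (wt s u * infsum (wt s) T)) T" for u
    using has_sum_cmult_right[OF has_sum_infsum[OF assms(2)]] by simp
  have o: "((\<lambda>u. wt s u * infsum (wt s) T) has_sum (infsum (wt s) S * infsum (wt s) T)) S"
    by (rule has_sum_cmult_left[OF has_sum_infsum[OF assms(1)]])
  show ?thesis
  proof (rule has_sum_SigmaI[OF _ o])
    show "(\<lambda>(u, v). wt s u * wt s v) summable_on S \<times> T"
      by (rule summable_on_SigmaI[OF i]) (use o in \<open>auto simp: wt_nonneg summable_on_def\<close>)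
  qed (rule i)
qed

text \<open>Words in \<open>S\<close> have equal length, so the splitting \<open>u @ v\<close> is
  unique and a sum over \<open>conc S T\<close> is a sum over pairs, to which
  \<open>wt_append_le\<close> and \<open>wt_append_ge\<close> apply termwise.\<close>

lemma wt_conc:
  assumes "wt s summable_on S" "wt s summable_on T" "0 \<le> s"
    and len: "\<And>u. u \<in> S \<Longrightarrow> length u = n"
    and pos: "\<And>u. u \<in> S \<union> T \<Longrightarrow> 0 \<notin> set u"
  shows "wt s summable_on conc S T"
    and "infsum (wt s) (conc S T) \<le> infsum (wt s) S * infsum (wt s) T"
    and "4 powr (- s) * (infsum (wt s) S * infsum (wt s) T) \<le> infsum (wt s) (conc S T)"
proof -
  let ?g = "\<lambda>(u, v). wt s u * wt s v"
  let ?f = "\<lambda>(u, v). wt s (u @ v)"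
  note hs = wt_product_has_sum[OF assms(1,2)]
  have fg: "?f x \<le> ?g x" if "x \<in> S \<times> T" for x
    using wt_append_le pos that assms(3) by auto
  have fsum: "?f summable_on S \<times> T"
    by (rule summable_on_comparison_test[of ?g]) (use fg hs in \<open>auto simp: wt_nonneg summable_on_def\<close>)
  have inj: "inj_on (\<lambda>(u, v). u @ v) (S \<times> T)" using inj_on_append len by blast
  have comp: "wt s \<circ> (\<lambda>(u, v). u @ v) = ?f" by auto
  show "wt s summable_on conc S T"
    unfolding conc_def summable_on_reindex[OF inj] comp by (rule fsum)
  have e: "infsum (wt s) (conc S T) = infsum ?f (S \<times> T)"
    unfolding conc_def infsum_reindex[OF inj] comp ..
  show "infsum (wt s) (conc S T) \<le> infsum (wt s) S * infsum (wt s) T"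
    unfolding e by (rule has_sum_mono[OF has_sum_infsum[OF fsum] hs fg])
  have "4 powr (- s) * ?g x \<le> ?f x" if "x \<in> S \<times> T" for x
    using wt_append_ge pos that assms(3) by auto
  then show "4 powr (- s) * (infsum (wt s) S * infsum (wt s) T) \<le> infsum (wt s) (conc S T)"
    unfolding e by (rule has_sum_mono[OF has_sum_cmult_right[OF hs] has_sum_infsum[OF fsum]])
qed

lemma summable_powr_on:
  assumes "s > 1 / 2"
  shows "(\<lambda>a. real a powr (- 2 * s)) summable_on A"
proof -
  have "summable (\<lambda>a. real a powr (- 2 * s))" using assms by (subst summable_real_powr_iff) auto
  then have "(\<lambda>a. real a powr (- 2 * s)) summable_on UNIV"
    by (subst summable_on_UNIV_nonneg_real_iff) auto
  then show ?thesis by (rule summable_on_subset_banach) simp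
qed

lemma wt_singletons:
  assumes "s > 1 / 2"
  shows "wt s summable_on words A 1" "infsum (wt s) (words A 1) = (\<Sum>\<^sub>\<infinity>a\<in>A. real a powr (- 2 * s))"
proof -
  have inj: "inj_on (\<lambda>a. [a]) A" by (simp add: inj_on_def)
  have c: "wt s \<circ> (\<lambda>a. [a]) = (\<lambda>a. real a powr (- 2 * s))" by (auto simp: wt_def)
  show "wt s summable_on words A 1" unfolding words_1 summable_on_reindex[OF inj] c
    by (rule summable_powr_on[OF assms])
  show "infsum (wt s) (words A 1) = (\<Sum>\<^sub>\<infinity>a\<in>A. real a powr (- 2 * s))"
    unfolding words_1 infsum_reindex[OF inj] c ..
qed

lemma wt_summable_words:
  assumes "s > 1 / 2" "A \<subseteq> {1..}"
  shows "wt s summable_on words A n"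
proof (induction n)
  case (Suc n)
  have "wt s summable_on words A (n + 1)" unfolding words_add
    by (rule wt_conc(1)[OF Suc wt_singletons(1)[OF assms(1)]])
      (use assms words_pos[OF assms(2)] in \<open>auto simp: words_def\<close>)
  then show ?case by simp
qed (simp add: words_0)

section \<open>Almost additivity of \<open>ln Z\<close> and existence of the pressure\<close>

context
  fixes s :: real and A :: "nat set"
  assumes s: "s > 1 / 2" and A: "A \<subseteq> {1..}" and ne: "A \<noteq> {}"
begin

lemma Z_add_le: "Z A (n + m) s \<le> Z A n s * Z A m s"
  unfolding Z_def words_add
  by (rule wt_conc(2)[OF wt_summable_words[OF s A] wt_summable_words[OF s A]])
    (use s words_pos[OF A] in \<open>auto simp: words_def\<close>)

lemma Z_add_ge: "4 powr (- s) * (Z A n s * Z A m s) \<le> Z A (n + m) s"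
  unfolding Z_def words_add
  by (rule wt_conc(3)[OF wt_summable_words[OF s A] wt_summable_words[OF s A]])
    (use s words_pos[OF A] in \<open>auto simp: words_def\<close>)

lemma Z_ge_sum: "finite F \<Longrightarrow> F \<subseteq> words A n \<Longrightarrow> sum (wt s) F \<le> Z A n s"
  unfolding Z_def using wt_summable_words[OF s A] by (intro finite_sum_le_infsum) (auto simp: wt_nonneg)

lemma Z_pos: "0 < Z A n s"
proof -
  obtain a where a: "a \<in> A" using ne by auto
  then have r: "replicate n a \<in> words A n" by (auto simp: words_def)
  then have "wt s (replicate n a) \<le> Z A n s" using Z_ge_sum[of "{replicate n a}"] by simp
  then show ?thesis using wt_pos[OF words_pos[OF A r], of s] by linarith
qed

end

text \<open>Comparing \<open>u (n * m)\<close> with \<open>m * u n\<close> and with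
  \<open>n * u m\<close> gives \<open>\<bar>u n / n - u m / m\<bar> \<le> K / n + K / m\<close>,
  hence a Cauchy sequence; letting \<open>m\<close> tend to infinity leaves the error
  \<open>K\<close>. This explicit error is what later makes the convergence uniform in the exponent
  and turns the pressure into two-sided bounds on \<open>Z\<close> for every
  \<open>n\<close>.\<close>

lemma almost_additive_limit:
  fixes u :: "nat \<Rightarrow> real"
  assumes K: "\<And>n m. \<bar>u (n + m) - u n - u m\<bar> \<le> K"
  obtains p where "(\<lambda>n. u n / n) \<longlonglongrightarrow> p" "\<And>n. \<bar>u n - n * p\<bar> \<le> K"
proof -
  have K0: "K \<ge> 0" using K[of 0 0] by linarith
  have mul: "\<bar>u (Suc j * n) - Suc j * u n\<bar> \<le> j * K" for j n
  proof (induction j)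
    case (Suc j)
    have "u (Suc (Suc j) * n) = u (Suc j * n + n)" by (simp add: algebra_simps)
    then show ?case using Suc K[of "Suc j * n" n] by (simp add: algebra_simps)
  qed simp
  have mul': "\<bar>u (j * n) - j * u n\<bar> \<le> j * K" if "j > 0" for j n
  proof -
    obtain i where "j = Suc i" using \<open>j > 0\<close> gr0_implies_Suc by blast
    then show ?thesis using mul[of i n] K0 by (simp add: algebra_simps)
  qed
  have diff: "\<bar>u n / n - u m / m\<bar> \<le> K / n + K / m" if "n > 0" "m > 0" for n m
  proof -
    have "\<bar>m * u n - n * u m\<bar> \<le> m * K + n * K"
      using mul'[of n m] mul'[of m n] that by (simp add: mult.commute)
    then have "\<bar>m * u n - n * u m\<bar> / (real n * real m) \<le> (m * K + n * K) / (real n * real m)"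
      by (intro divide_right_mono) auto
    moreover have "u n / n - u m / m = (m * u n - n * u m) / (real n * real m)"
      "K / n + K / m = (m * K + n * K) / (real n * real m)" using that by (auto simp: field_simps)
    ultimately show ?thesis using that by (simp add: abs_mult)
  qed
  have "Cauchy (\<lambda>n. u n / n)"
  proof (rule metric_CauchyI)
    fix e :: real assume e: "e > 0"
    obtain n0 where n0: "n0 > 0" "K / real n0 < e / 2"
    proof -
      obtain n :: nat where n: "2 * (K + 1) / e < real n" using reals_Archimedean2 by blast
      have "n > 0" using n e K0 by (cases n) (auto simp: field_simps)
      then have "K / real n < e / 2" using n e by (simp add: field_simps)
      then show ?thesis using that \<open>n > 0\<close> by blast
    qed
    show "\<exists>M. \<forall>m\<ge>M. \<forall>n\<ge>M. dist (u m / m) (u n / n) < e"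
    proof (intro exI allI impI)
      fix m n assume mn: "m \<ge> n0" "n \<ge> n0"
      have "K / m \<le> K / n0" "K / n \<le> K / n0" using mn n0 K0 by (auto intro!: divide_left_mono)
      then show "dist (u m / m) (u n / n) < e"
        using diff[of m n] mn n0 unfolding dist_real_def by linarith
    qed
  qed
  then obtain p where p: "(\<lambda>n. u n / n) \<longlonglongrightarrow> p"
    using Cauchy_convergent convergent_def by blast
  have "\<bar>u n - n * p\<bar> \<le> K" for n
  proof (cases "n = 0")
    case True
    then show ?thesis using K[of 0 0] by auto
  next
    case False
    have "(\<lambda>m. \<bar>u n / n - u m / m\<bar>) \<longlonglongrightarrow> \<bar>u n / n - p\<bar>"
      using p by (intro tendsto_intros)
    moreover have "(\<lambda>m. K / n + K / real m) \<longlonglongrightarrow> K / n + 0"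
      by (intro tendsto_intros lim_const_over_n)
    ultimately have "\<bar>u n / n - p\<bar> \<le> K / n + 0"
      by (rule LIMSEQ_le) (use diff False in \<open>auto intro!: exI[of _ 1]\<close>)
    then have "n * \<bar>u n / n - p\<bar> \<le> n * (K / n)" by (intro mult_left_mono) auto
    moreover have "n * \<bar>u n / n - p\<bar> = \<bar>n * (u n / n - p)\<bar>" by (simp add: abs_mult)
    ultimately show ?thesis using False by (simp add: right_diff_distrib)
  qed
  then show ?thesis using that p by blast
qed

lemma ln_Z_pressure_on:
  assumes s: "s > 1 / 2" and A: "A \<subseteq> {1..}" and ne: "A \<noteq> {}"
  shows "\<bar>ln (Z A n s) - n * pressure_on A s\<bar> \<le> s * ln 4"
    and "(\<lambda>n. ln (Z A n s) / n) \<longlonglongrightarrow> pressure_on A s"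
proof -
  note pos = Z_pos[OF assms]
  have up: "ln (Z A (n + m) s) \<le> ln (Z A n s) + ln (Z A m s)" for n m
    using Z_add_le[OF assms, of n m] pos[of n] pos[of m] pos[of "n + m"]
    by (metis ln_le_cancel_iff ln_mult_pos mult_pos_pos)
  have lo: "ln (Z A n s) + ln (Z A m s) - s * ln 4 \<le> ln (Z A (n + m) s)" for n m
  proof -
    have "ln (4 powr (- s) * (Z A n s * Z A m s)) \<le> ln (Z A (n + m) s)"
      using Z_add_ge[OF assms, of n m] pos[of n] pos[of m] pos[of "n + m"]
      by (subst ln_le_cancel_iff) auto
    moreover have "ln (4 powr (- s) * (Z A n s * Z A m s)) = - s * ln 4 + (ln (Z A n s) + ln (Z A m s))"
      using pos by (subst ln_mult_pos; simp add: ln_mult_pos ln_powr)+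
    ultimately show ?thesis by linarith
  qed
  have "s * ln 4 \<ge> 0" using s by auto
  then have K: "\<bar>ln (Z A (n + m) s) - ln (Z A n s) - ln (Z A m s)\<bar> \<le> s * ln 4" for n m
    using up[of n m] lo[of n m] by linarith
  obtain p where p: "(\<lambda>n. ln (Z A n s) / n) \<longlonglongrightarrow> p" "\<And>n. \<bar>ln (Z A n s) - n * p\<bar> \<le> s * ln 4"
    using almost_additive_limit[of "\<lambda>n. ln (Z A n s)", OF K] by blast
  then have "pressure_on A s = p" unfolding pressure_on_def by (rule_tac limI)
  then show "\<bar>ln (Z A n s) - n * pressure_on A s\<bar> \<le> s * ln 4" "(\<lambda>n. ln (Z A n s) / n) \<longlonglongrightarrow> pressure_on A s"
    using p by auto
qed

lemma pressure_eq_pressure_on: "pressure s = pressure_on {1..} s"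
proof -
  have "(\<Sum>\<^sub>\<infinity>as\<in>{as. length as = n \<and> (\<forall>a\<in>set as. 1 \<le> a)}. real_of_int (cf_denom as) powr (- 2 * s))
      = Z {1..} n s" for n
    unfolding Z_def
  proof (rule infsum_cong_neutral)
    fix w :: "nat list"
    assume "w \<in> {as. length as = n \<and> (\<forall>a\<in>set as. 1 \<le> a)} \<inter> words {1..} n"
    then have "0 \<notin> set w" by auto
    then show "real_of_int (cf_denom w) powr (- 2 * s) = wt s w"
      by (simp add: cf_denom_eq_den wt_def)
  qed (auto simp: words_def)
  then show ?thesis unfolding pressure_def pressure_on_def by (simp add: field_simps)
qed

lemma Z_bounds:
  assumes s: "s > 1 / 2" and A: "A \<subseteq> {1..}" and ne: "A \<noteq> {}"
  shows "Z A n s \<le> 4 powr s * exp (n * pressure_on A s)" "4 powr (- s) * exp (n * pressure_on A s) \<le> Z A n s"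
proof -
  have e: "(4::real) powr x = exp (x * ln 4)" for x by (simp add: powr_def)
  have l: "Z A n s = exp (ln (Z A n s))" using Z_pos[OF assms] by simp
  have a: "\<bar>ln (Z A n s) - n * pressure_on A s\<bar> \<le> s * ln 4" by (rule ln_Z_pressure_on(1)[OF assms])
  have "ln (Z A n s) \<le> s * ln 4 + n * pressure_on A s" "- s * ln 4 + n * pressure_on A s \<le> ln (Z A n s)"
    using a by (auto simp: abs_le_iff)
  then have "exp (ln (Z A n s)) \<le> exp (s * ln 4 + n * pressure_on A s)"
    "exp (- s * ln 4 + n * pressure_on A s) \<le> exp (ln (Z A n s))" unfolding exp_le_cancel_iff by auto
  then show "Z A n s \<le> 4 powr s * exp (n * pressure_on A s)" "4 powr (- s) * exp (n * pressure_on A s) \<le> Z A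
    n s"
    unfolding exp_add e[symmetric] l[symmetric] by auto
qed

lemma Z_antimono:
  assumes "s > 1 / 2" "s \<le> t" "A \<subseteq> {1..}"
  shows "Z A n t \<le> Z A n s"
proof -
  have "wt t w \<le> wt s w" if "w \<in> words A n" for w
    using den_pos[OF words_pos[OF assms(3) that]] assms unfolding wt_def by (intro powr_mono) auto
  then show ?thesis unfolding Z_def using wt_summable_words assms
    by (intro infsum_mono) auto
qed

lemma pressure_on_antimono:
  assumes "s > 1 / 2" "s \<le> t" "A \<subseteq> {1..}" "A \<noteq> {}"
  shows "pressure_on A t \<le> pressure_on A s"
proof (rule LIMSEQ_le[OF ln_Z_pressure_on(2) ln_Z_pressure_on(2)])
  have "ln (Z A n t) \<le> ln (Z A n s)" for n
    using Z_antimono[OF assms(1-3)] Z_pos[of t A n] assms by (intro ln_mono) auto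
  then show "\<exists>N. \<forall>n\<ge>N. ln (Z A n t) / n \<le> ln (Z A n s) / n"
    by (auto intro!: divide_right_mono)
qed (use assms in auto)

text \<open>On \<open>{a..b}\<close> the series is dominated termwise by its value at
  \<open>a\<close>, because denominators are at least 1.\<close>

lemma continuous_on_Z:
  assumes "a > 1 / 2" "A \<subseteq> {1..}"
  shows "continuous_on {a..b} (\<lambda>s. Z A n s)"
  unfolding Z_def
proof (rule uniform_limit_theorem)
  show "uniform_limit {a..b} (\<lambda>X s. \<Sum>w\<in>X. wt s w) (\<lambda>s. \<Sum>\<^sub>\<infinity>w\<in>words A n. wt s w)
      (finite_subsets_at_top (words A n))"
  proof (rule Weierstrass_m_test_general)
    show "wt a summable_on words A n" using wt_summable_words assms by auto
    fix w s assume "w \<in> words A n" "s \<in> {a..b}"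
    then show "norm (wt s w) \<le> wt a w"
      using den_pos[OF words_pos[OF assms(2)], of w n] unfolding wt_def by (auto intro!: powr_mono simp:
        Suc_le_eq)
  qed
  show "\<forall>\<^sub>F X in finite_subsets_at_top (words A n). continuous_on {a..b} (\<lambda>s. \<Sum>w\<in>X. wt s w)"
  proof (rule eventually_finite_subsets_at_top_weakI)
    fix X assume "finite X" "X \<subseteq> words A n"
    then have "den w \<noteq> 0" if "w \<in> X" for w using den_pos[OF words_pos[OF assms(2)], of w] that by blast
    then show "continuous_on {a..b} (\<lambda>s. \<Sum>w\<in>X. wt s w)" unfolding wt_def
      by (intro continuous_intros) auto
  qed
qed simp

text \<open>By \<open>ln_Z_pressure_on\<close> the error after division by \<open>n\<close> is at
  most \<open>\<bar>b\<bar> * ln 4 / n\<close>, so the limit is uniform on the interval.\<close>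

lemma continuous_on_pressure_on:
  assumes a: "a > 1 / 2" and A: "A \<subseteq> {1..}" "A \<noteq> {}"
  shows "continuous_on {a..b} (pressure_on A)"
proof (rule uniform_limit_theorem)
  show "\<forall>\<^sub>F n in sequentially. continuous_on {a..b} (\<lambda>s. ln (Z A n s) / n)"
  proof (rule always_eventually, rule allI)
    fix n
    have "Z A n s > 0" if "s \<in> {a..b}" for s using Z_pos[of s A n] that a A by auto
    then show "continuous_on {a..b} (\<lambda>s. ln (Z A n s) / n)"
      unfolding divide_inverse using continuous_on_Z[OF a A(1)]
      by (intro continuous_intros) fastforce+
  qed
  show "uniform_limit {a..b} (\<lambda>n s. ln (Z A n s) / real n) (pressure_on A) sequentially"
  proof (rule uniform_limitI)
    fix e :: real assume e: "e > 0"
    have "(\<lambda>n. (\<bar>b\<bar> * ln 4) / real n) \<longlonglongrightarrow> 0" by (rule lim_const_over_n)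
    then have "\<forall>\<^sub>F n in sequentially. (\<bar>b\<bar> * ln 4) / real n < e" using e by (rule order_tendstoD)
    then show "\<forall>\<^sub>F n in sequentially. \<forall>s\<in>{a..b}. dist (ln (Z A n s) / real n) (pressure_on A s) < e"
      using eventually_gt_at_top[of 0]
    proof eventually_elim
      case (elim n)
      show ?case
      proof
        fix s assume s: "s \<in> {a..b}"
        then have "\<bar>ln (Z A n s) - n * pressure_on A s\<bar> \<le> s * ln 4" using a A by (intro ln_Z_pressure_on) auto
        also have "\<dots> \<le> \<bar>b\<bar> * ln 4" using s by (intro mult_right_mono) auto
        finally have "\<bar>ln (Z A n s) - n * pressure_on A s\<bar> / n \<le> \<bar>b\<bar> * ln 4 / n" by (intro
          divide_right_mono) auto
        moreover have "\<bar>ln (Z A n s) - n * pressure_on A s\<bar> / n = \<bar>ln (Z A n s) / n - pressure_on A s\<bar>"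
        proof -
          have "ln (Z A n s) / n - pressure_on A s = (ln (Z A n s) - n * pressure_on A s) / n"
            using elim by (simp add: field_simps)
          then show ?thesis by simp
        qed
        ultimately show "dist (ln (Z A n s) / real n) (pressure_on A s) < e"
          using elim unfolding dist_real_def by linarith
      qed
    qed
  qed
qed simp

section \<open>The pressure near 1/2 and at 1, and its approximation by finite alphabets\<close>

lemma harmonic_unbounded: "\<exists>m. K \<le> (\<Sum>a=1..m. real a powr (- 1))"
proof (rule ccontr)
  assume "\<not> ?thesis"
  then have b: "(\<Sum>a=1..m. real a powr (- 1)) \<le> K" for m by (meson linear)
  have "(\<Sum>a<m. real a powr (- 1)) \<le> K" for m
  proof -
    have "(\<Sum>a<m. real a powr (- 1)) \<le> (\<Sum>a\<le>m. real a powr (- 1))"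
      by (intro sum_mono2) auto
    also have "\<dots> = (\<Sum>a=1..m. real a powr (- 1))"
      by (intro sum.mono_neutral_right) auto
    finally show ?thesis using b[of m] by linarith
  qed
  then have "summable (\<lambda>a. real a powr (- 1))"
    by (intro summableI_nonneg_bounded[of _ K]) auto
  then show False by (subst (asm) summable_real_powr_iff) auto
qed

text \<open>Words of length 1 suffice. A partial sum of the harmonic series exceeds any bound, being
  finite it is continuous in the exponent, and \<open>ln Z\<close> at \<open>n = 1\<close> differs
  from the pressure by at most \<open>s * ln 4\<close>.\<close>

lemma pressure_on_unbounded: "\<exists>s>1/2. s < 1 \<and> K < pressure_on {1..} s"
proof -
  obtain m where m: "exp (K + ln 4) + 1 \<le> (\<Sum>a=1..m. real a powr (- 1))"
    using harmonic_unbounded by blast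
  let ?f = "\<lambda>s. \<Sum>a=1..m. real a powr (- 2 * s)"
  have "continuous (at (1/2)) ?f" by (intro continuous_intros) auto
  then have "?f \<midarrow>1/2\<rightarrow> ?f (1/2)" by (simp add: continuous_within)
  moreover have "?f (1/2) > exp (K + ln 4)" using m by simp
  ultimately have "\<forall>\<^sub>F s in at (1/2). ?f s > exp (K + ln 4)" by (rule order_tendstoD(1))
  then obtain d where d: "d > 0" "\<And>s. s \<noteq> 1/2 \<Longrightarrow> dist s (1/2) < d \<Longrightarrow> ?f s > exp (K + ln 4)"
    unfolding eventually_at by auto
  define s where "s = 1/2 + min d (1/2) / 2"
  have s: "s > 1/2" "s < 1" "dist s (1/2) < d" using d(1) by (auto simp: s_def dist_real_def)
  have "sum (wt s) ((\<lambda>a. [a]) ` {1..m}) \<le> Z {1..} 1 s"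
    by (rule Z_ge_sum) (use s in \<open>auto simp: words_def\<close>)
  moreover have "sum (wt s) ((\<lambda>a. [a]) ` {1..m}) = ?f s"
    by (subst sum.reindex) (auto simp: wt_def inj_on_def)
  ultimately have "exp (K + ln 4) < Z {1..} 1 s" using d(2)[of s] s by auto
  then have "K + ln 4 < ln (Z {1..} 1 s)" by (metis exp_gt_zero ln_exp ln_less_cancel_iff order_less_trans)
  moreover have "\<bar>ln (Z {1..} 1 s) - 1 * pressure_on {1..} s\<bar> \<le> s * ln 4"
    using ln_Z_pressure_on(1)[of s "{1..}" 1] s by simp
  moreover have "s * ln 4 \<le> 1 * ln 4" using s by (intro mult_right_mono) auto
  ultimately have "K < pressure_on {1..} s" by linarith
  then show ?thesis using s by auto
qed

text \<open>At a fixed large \<open>n\<close> finitely many words carry almost all of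
  \<open>Z\<close>, and they use finitely many letters. The error bound in
  \<open>ln_Z_pressure_on\<close> is the same for all alphabets, so the comparison at this one
  \<open>n\<close> is enough.\<close>

lemma pressure_on_restrict:
  assumes s: "s > 1 / 2" and b: "\<beta> < pressure_on {1..} s"
  shows "\<exists>M\<ge>2. \<beta> < pressure_on {1..M} s"
proof -
  \<comment> \<open>The length must beat the error \<open>s * ln 4\<close> twice, once for the full
    alphabet and once for \<open>{1..M}\<close>.\<close>
  obtain n :: nat where n: "(3 * (s * ln 4) + 3) / (pressure_on {1..} s - \<beta>) < real n" using
    reals_Archimedean2 by blast
  have nb: "(3 * (s * ln 4) + 3) < n * pressure_on {1..} s - n * \<beta>"
    using n b by (simp add: field_simps)
  have sl: "s * ln 4 \<ge> 0" using s by simp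
  have n0: "n > 0" using nb sl by (cases n) auto
  define K where "K = s * ln 4"
  have "\<bar>ln (Z {1..} n s) - n * pressure_on {1..} s\<bar> \<le> s * ln 4" by (rule ln_Z_pressure_on(1)) (use s in auto)
  then have "n * pressure_on {1..} s - s * ln 4 \<le> ln (Z {1..} n s)" by (simp add: abs_le_iff)
  moreover have "n * \<beta> + s * ln 4 < n * pressure_on {1..} s - s * ln 4"
  proof -
    show ?thesis using nb sl unfolding K_def[symmetric] by linarith
  qed
  ultimately have "n * \<beta> + s * ln 4 < ln (Z {1..} n s)" by (rule less_le_trans[rotated])
  then have Zb: "exp (n * \<beta> + s * ln 4) < Z {1..} n s"
    by (metis Z_pos[OF s] exp_less_cancel_iff exp_ln order_refl atLeast_iff empty_iff)
  have "\<exists>F. finite F \<and> F \<subseteq> words {1..} n \<and> exp (n * \<beta> + s * ln 4) < sum (wt s) F"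
  proof (rule ccontr)
    assume "\<not> ?thesis"
    then have "Z {1..} n s \<le> exp (n * \<beta> + s * ln 4)" unfolding Z_def
      by (intro infsum_le_finite_sums wt_summable_words) (use s in \<open>auto simp: not_less\<close>)
    then show False using Zb by simp
  qed
  then obtain F where F: "finite F" "F \<subseteq> words {1..} n" "exp (n * \<beta> + s * ln 4) < sum (wt s) F" by blast
  \<comment> \<open>Inserting 2 makes the alphabet contain the letter that opens every block of the
    Cantor set.\<close>
  define M where "M = Max (insert 2 (\<Union>w\<in>F. set w))"
  have fin: "finite (insert 2 (\<Union>w\<in>F. set w))" using F(1) by auto
  have M2: "M \<ge> 2" unfolding M_def using fin by (intro Max_ge) auto
  have "F \<subseteq> words {1..M} n"
  proof
    fix w assume w: "w \<in> F"
    have "a \<le> M" if "a \<in> set w" for a unfolding M_def using fin that w by (intro Max_ge) auto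
    moreover have "w \<in> words {1..} n" using F(2) w by blast
    ultimately show "w \<in> words {1..M} n" by (auto simp: words_def)
  qed
  then have "sum (wt s) F \<le> Z {1..M} n s" using Z_ge_sum[OF s _ _ F(1)] M2 by auto
  then have "exp (n * \<beta> + s * ln 4) < Z {1..M} n s" using F(3) by linarith
  then have "n * \<beta> + s * ln 4 < ln (Z {1..M} n s)" by (metis exp_gt_zero ln_exp ln_less_cancel_iff
    order_less_trans)
  moreover have "\<bar>ln (Z {1..M} n s) - n * pressure_on {1..M} s\<bar> \<le> s * ln 4" by (rule ln_Z_pressure_on(1))
    (use s M2 in auto)
  ultimately have "n * \<beta> < n * pressure_on {1..M} s" by linarith
  then have "\<beta> < pressure_on {1..M} s" using n0 by simp
  then show ?thesis using M2 by blast
qed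

text \<open>The length of the interval of numbers whose expansion starts with \<open>w\<close>.\<close>

definition cyl :: "nat list \<Rightarrow> real" where
  "cyl w = 1 / (real (den w) * (real (den w) + real (den' w)))"

lemma cyl_nonneg: "0 \<le> cyl w"
  by (simp add: cyl_def)

text \<open>The cylinders of \<open>u @ [a]\<close> tile that of \<open>u\<close>. With
  \<open>den (u @ [a]) = a * q + q'\<close> and \<open>den' (u @ [a]) = q\<close> the lengths
  telescope.\<close>

lemma sum_cyl_snoc_le:
  assumes "0 \<notin> set u"
  shows "(\<Sum>a=1..m. cyl (u @ [a])) \<le> cyl u"
proof -
  let ?q = "real (den u)" and ?q' = "real (den' u)"
  have q: "?q > 0" using den_pos[OF assms] by simp
  have c: "cyl (u @ [a]) = (1 / (a * ?q + ?q') - 1 / (Suc a * ?q + ?q')) / ?q" if "a \<ge> 1" for a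
  proof -
    have "a * ?q > 0" "Suc a * ?q > 0" using q that by (auto simp del: of_nat_Suc)
    then have "a * ?q + ?q' > 0" "Suc a * ?q + ?q' > 0" by (auto simp del: of_nat_Suc intro!: add_pos_nonneg)
    then have "1 / (a * ?q + ?q') - 1 / (Suc a * ?q + ?q') = ?q / ((a * ?q + ?q') * (Suc a * ?q + ?q'))"
      by (simp add: field_simps)
    moreover have "cyl (u @ [a]) = 1 / ((a * ?q + ?q') * (Suc a * ?q + ?q'))"
      by (simp add: cyl_def den_append den'_append algebra_simps)
    ultimately show ?thesis using q by simp
  qed
  have "(\<Sum>a=1..m. cyl (u @ [a])) = (\<Sum>a=1..m. 1 / (a * ?q + ?q') - 1 / (Suc a * ?q + ?q')) / ?q"
    unfolding sum_divide_distrib by (rule sum.cong) (use c in auto)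
  also have "(\<Sum>a=1..m. 1 / (a * ?q + ?q') - 1 / (Suc a * ?q + ?q')) = 1 / (?q + ?q') - 1 / (Suc m * ?q + ?q')"
    by (induction m) auto
  also have "(1 / (?q + ?q') - 1 / (Suc m * ?q + ?q')) / ?q \<le> 1 / (?q + ?q') / ?q"
    using q by (intro divide_right_mono) auto
  finally show ?thesis by (simp add: cyl_def mult.commute)
qed

text \<open>Cylinders of one generation are disjoint parts of the unit interval; the induction
  removes last letters instead of arguing with intervals.\<close>

lemma sum_cyl_le_1:
  assumes "finite F" "F \<subseteq> words {1..} n"
  shows "sum cyl F \<le> 1"
  using assms
proof (induction n arbitrary: F)
  case 0
  then have "F \<subseteq> {[]}" by (simp add: words_0)
  then have "sum cyl F \<le> sum cyl {[]}" by (intro sum_mono2) (auto simp: cyl_nonneg)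
  then show ?case by (simp add: cyl_def)
next
  case (Suc n)
  define G where "G = butlast ` F"
  define m where "m = Max (insert 1 (last ` F))"
  have fin: "finite (insert 1 (last ` F))" using Suc.prems by auto
  have G: "finite G" "G \<subseteq> words {1..} n"
    using Suc.prems by (auto simp: G_def words_def dest!: in_set_butlastD)
  have inj: "inj_on (\<lambda>(u, a). u @ [a]) (G \<times> {1..m})" by (auto simp: inj_on_def)
  have "F \<subseteq> (\<lambda>(u, a). u @ [a]) ` (G \<times> {1..m})"
  proof
    fix w assume w: "w \<in> F"
    then have ww: "length w = Suc n" "set w \<subseteq> {1..}" using Suc.prems by (auto simp: words_def)
    then have wn: "w \<noteq> []" by auto
    have "last w \<in> {1..}" using ww(2) last_in_set[OF wn] by blast
    then have "last w \<ge> 1" by simp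
    have "last w \<le> m" unfolding m_def using fin w by (intro Max_ge) auto
    then have "(butlast w, last w) \<in> G \<times> {1..m}" using w \<open>last w \<ge> 1\<close> by (auto simp: G_def)
    then show "w \<in> (\<lambda>(u, a). u @ [a]) ` (G \<times> {1..m})" using wn
      by (metis (mono_tags, lifting) append_butlast_last_id case_prod_conv image_iff)
  qed
  then have "sum cyl F \<le> sum cyl ((\<lambda>(u, a). u @ [a]) ` (G \<times> {1..m}))"
    using G by (intro sum_mono2) (auto simp: cyl_nonneg)
  also have "\<dots> = (\<Sum>u\<in>G. \<Sum>a=1..m. cyl (u @ [a]))"
    unfolding sum.reindex[OF inj] by (simp add: sum.cartesian_product o_def case_prod_unfold)
  also have "\<dots> \<le> (\<Sum>u\<in>G. cyl u)"
    using G(2) words_pos by (intro sum_mono sum_cyl_snoc_le) blast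
  also have "\<dots> \<le> 1" using Suc.IH G by blast
  finally show ?case .
qed

text \<open>At exponent 1 the weight is at most twice the length of the cylinder, since
  \<open>den' w \<le> den w\<close>; so \<open>Z\<close> stays below 2.\<close>

lemma pressure_on_1_le_0: "pressure_on {1..} 1 \<le> 0"
proof -
  have "Z {1..} n 1 \<le> 2" for n
    unfolding Z_def
  proof (rule infsum_le_finite_sums)
    fix F assume F: "finite F" "F \<subseteq> words {1..} n"
    have "wt 1 w \<le> 2 * cyl w" if "w \<in> F" for w
    proof -
      have w: "0 \<notin> set w" using that F words_pos by blast
      have q: "real (den w) > 0" "real (den' w) \<le> real (den w)" using den_pos[OF w] den'_le_den[OF w] by auto
      have "wt 1 w = 2 / (real (den w) * (2 * real (den w)))"
        using q by (simp add: wt_def powr_minus powr_numeral power2_eq_square field_simps)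
      also have "\<dots> \<le> 2 / (real (den w) * (real (den w) + real (den' w)))"
        using q by (intro divide_left_mono mult_left_mono mult_pos_pos add_pos_nonneg) auto
      finally show ?thesis by (simp add: cyl_def)
    qed
    then have "sum (wt 1) F \<le> 2 * sum cyl F" unfolding sum_distrib_left by (rule sum_mono)
    also have "\<dots> \<le> 2" using sum_cyl_le_1[OF F] by simp
    finally show "sum (wt 1) F \<le> 2" .
  qed (use wt_summable_words in auto)
  then have "ln (Z {1..} n 1) / n \<le> ln 2 / n" for n
    using Z_pos[of 1 "{1..}" n] by (intro divide_right_mono) (auto simp: ln_mono)
  moreover have "(\<lambda>n. ln 2 / real n) \<longlonglongrightarrow> 0" by (rule lim_const_over_n)
  ultimately show ?thesis
    using LIMSEQ_le[OF ln_Z_pressure_on(2)[of 1 "{1..}"]] by auto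
qed

text \<open>The pressure is nonincreasing, blows up at 1/2 and is at most 0 at 1, whereas the right
  side increases strictly and is positive at 1. The bound \<theta> < 1 is recorded because the
  Frostman argument works with exponents at most 1.\<close>

lemma ex1_pressure_eq:
  assumes "A \<ge> 0" "B \<ge> 0" "A + B > 0"
  shows "\<exists>\<theta>. 1/2 < \<theta> \<and> \<theta> < 1 \<and> pressure \<theta> = A * (2 * \<theta> - 1) + B * \<theta> \<and>
     (\<forall>\<theta>'. 1/2 < \<theta>' \<and> pressure \<theta>' = A * (2 * \<theta>' - 1) + B * \<theta>' \<longrightarrow> \<theta>' = \<theta>)"
proof -
  let ?R = "\<lambda>\<theta>. A * (2 * \<theta> - 1) + B * \<theta>"
  have R: "?R s < ?R t" if "s < t" for s t
  proof (cases "A = 0")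
    case True
    then show ?thesis using assms that by simp
  next
    case False
    then have "A * (2 * s - 1) < A * (2 * t - 1)" using assms that by simp
    moreover have "B * s \<le> B * t" using assms that by (intro mult_left_mono) auto
    ultimately show ?thesis by linarith
  qed
  obtain a where a: "a > 1/2" "a < 1" "A + B < pressure_on {1..} a" using pressure_on_unbounded by blast
  have ga: "pressure_on {1..} a - ?R a > 0" using R[OF a(2)] a by simp
  have g1: "pressure_on {1..} 1 - ?R 1 < 0" using pressure_on_1_le_0 assms by simp
  have "continuous_on {a..1} (\<lambda>\<theta>. pressure_on {1..} \<theta> - ?R \<theta>)"
    using a by (intro continuous_intros continuous_on_pressure_on) auto
  then obtain \<theta> where \<theta>: "a \<le> \<theta>" "\<theta> \<le> 1" "pressure_on {1..} \<theta> - ?R \<theta> = 0"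
    using IVT2'[of "\<lambda>\<theta>. pressure_on {1..} \<theta> - ?R \<theta>" 1 0 a] ga g1 a by auto
  have "\<theta> \<noteq> 1" using \<theta>(3) g1 by auto
  moreover have "\<theta>' = \<theta>" if "1/2 < \<theta>'" "pressure \<theta>' = ?R \<theta>'" for \<theta>'
  proof (rule ccontr)
    assume "\<theta>' \<noteq> \<theta>"
    then consider "\<theta>' < \<theta>" | "\<theta> < \<theta>'" by linarith
    then show False
    proof cases
      case 1
      then show ?thesis using pressure_on_antimono[of \<theta>' \<theta> "{1..}"] R[of \<theta>' \<theta>] that \<theta> by (auto simp:
        pressure_eq_pressure_on)
    next
      case 2
      then show ?thesis using pressure_on_antimono[of \<theta> \<theta>' "{1..}"] R[of \<theta> \<theta>'] that \<theta> a by (auto simp: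
        pressure_eq_pressure_on)
    qed
  qed
  ultimately show ?thesis using \<theta> a by (intro exI[of _ \<theta>]) (auto simp: pressure_eq_pressure_on)
qed

section \<open>Hausdorff measure and dimension\<close>

lemma diam_gauge_nonneg: "0 \<le> diam_gauge s U"
  by (simp add: diam_gauge_def)

lemma hausdorff_premeasure_le:
  assumes "A \<subseteq> (\<Union>i. U i)" "\<And>i. bounded (U i)" "\<And>i. diameter (U i) \<le> \<delta>"
  shows "hausdorff_premeasure s \<delta> A \<le> (\<Sum>i. ennreal (diam_gauge s (U i)))"
  unfolding hausdorff_premeasure_def by (rule INF_lower) (use assms in auto)

lemma hausdorff_premeasure_cover:
  assumes "hausdorff_premeasure s \<delta> A < e"
  shows "\<exists>U. A \<subseteq> (\<Union>i::nat. U i) \<and> (\<forall>i. bounded (U i)) \<and> (\<forall>i. diameter (U i) \<le> \<delta>) \<and>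
    (\<Sum>i. ennreal (diam_gauge s (U i))) < e"
  using assms unfolding hausdorff_premeasure_def INF_less_iff by auto

lemma hausdorff_measure_0_iff:
  "hausdorff_measure s A = 0 \<longleftrightarrow> (\<forall>\<delta>>0. hausdorff_premeasure s \<delta> A = 0)"
proof -
  have "hausdorff_measure s A = 0 \<longleftrightarrow> hausdorff_measure s A \<le> 0" by simp
  also have "\<dots> \<longleftrightarrow> (\<forall>\<delta>>0. hausdorff_premeasure s \<delta> A \<le> 0)"
    unfolding hausdorff_measure_def SUP_le_iff by auto
  finally show ?thesis by simp
qed

lemma hausdorff_measure_null_subset:
  assumes "hausdorff_measure s B = 0" "A \<subseteq> B"
  shows "hausdorff_measure s A = 0"
  unfolding hausdorff_measure_0_iff
proof (intro allI impI)
  fix \<delta> :: real assume "\<delta> > 0"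
  have "hausdorff_premeasure s \<delta> A \<le> hausdorff_premeasure s \<delta> B"
    unfolding hausdorff_premeasure_def using assms(2) by (intro INF_superset_mono) auto
  then show "hausdorff_premeasure s \<delta> A = 0"
    using assms(1) \<open>\<delta> > 0\<close> unfolding hausdorff_measure_0_iff by auto
qed

lemma hausdorff_measure_null_UN:
  fixes A :: "nat \<Rightarrow> 'a::metric_space set"
  assumes "\<And>i. hausdorff_measure s (A i) = 0"
  shows "hausdorff_measure s (\<Union>i. A i) = 0"
  unfolding hausdorff_measure_0_iff
proof (intro allI impI)
  fix \<delta> :: real assume \<delta>: "\<delta> > 0"
  have "hausdorff_premeasure s \<delta> (\<Union>i. A i) \<le> 0 + ennreal e" if e: "e > 0" for e
  proof -
    define P where "P i U \<longleftrightarrow> A i \<subseteq> (\<Union>j::nat. U j) \<and> (\<forall>j. bounded (U j)) \<and> (\<forall>j. diameter (U j) \<le> \<delta>) \<and>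
        (\<Sum>j. ennreal (diam_gauge s (U j))) < ennreal (e * (1/2) ^ Suc i)" for i U
    have "\<exists>U. P i U" for i
    proof -
      have "hausdorff_premeasure s \<delta> (A i) < ennreal (e * (1/2) ^ Suc i)"
        using assms[of i] \<delta> e unfolding hausdorff_measure_0_iff by auto
      then show ?thesis unfolding P_def by (rule hausdorff_premeasure_cover)
    qed
    then have "\<exists>U. \<forall>i. P i (U i)" by (intro choice allI)
    then obtain U where PU: "\<forall>i. P i (U i)" by (rule exE)
    have U: "A i \<subseteq> (\<Union>j. U i j)" "bounded (U i j)" "diameter (U i j) \<le> \<delta>"
      "(\<Sum>j. ennreal (diam_gauge s (U i j))) < ennreal (e * (1/2) ^ Suc i)" for i j
      using spec[OF PU, of i] by (simp_all add: P_def)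
    let ?V = "\<lambda>n. case prod_decode n of (i, j) \<Rightarrow> U i j"
    have "(\<Union>i. A i) \<subseteq> (\<Union>n. ?V n)"
    proof
      fix x assume "x \<in> (\<Union>i. A i)"
      then obtain i where "x \<in> A i" by blast
      then obtain j where "x \<in> U i j" using U(1)[of i] by blast
      then have "x \<in> ?V (prod_encode (i, j))" by simp
      then show "x \<in> (\<Union>n. ?V n)" by (rule UN_I[OF UNIV_I])
    qed
    then have "hausdorff_premeasure s \<delta> (\<Union>i. A i) \<le> (\<Sum>n. ennreal (diam_gauge s (?V n)))"
      by (rule hausdorff_premeasure_le) (use U in \<open>auto split: prod.split\<close>)
    also have "\<dots> = (\<Sum>n. case_prod (\<lambda>i j. ennreal (diam_gauge s (U i j))) (prod_decode n))"
      by (simp add: case_prod_unfold)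
    also have "\<dots> = (\<Sum>i. \<Sum>j. ennreal (diam_gauge s (U i j)))"
      using suminf_ennreal_2dimen[of "\<lambda>i. \<Sum>j. ennreal (diam_gauge s (U i j))"
          "\<lambda>(i, j). ennreal (diam_gauge s (U i j))"] by (simp add: o_def)
    also have "\<dots> \<le> (\<Sum>i. ennreal (e * (1/2) ^ Suc i))"
      using U(4) by (intro suminf_le) (auto intro: less_imp_le)
    also have "\<dots> = ennreal e"
    proof -
      have "(\<lambda>i. e * (1/2) ^ Suc i) sums (e * 1)" by (rule sums_mult[OF power_half_series])
      then show ?thesis using e by (intro suminf_ennreal_eq) auto
    qed
    finally show ?thesis by simp
  qed
  then have "hausdorff_premeasure s \<delta> (\<Union>i. A i) \<le> 0"
    by (rule ennreal_le_epsilon)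
  then show "hausdorff_premeasure s \<delta> (\<Union>i. A i) = 0" by (rule antisym) simp
qed

text \<open>Covers are sequences by definition, so \<open>list_decode\<close> turns an index into a
  word; indices outside \<open>W\<close> get the empty set, whose gauge is 0. Bounds on finite
  partial sums are all that has to be supplied.\<close>

lemma hausdorff_premeasure_le_words:
  fixes V :: "nat list \<Rightarrow> 'a::metric_space set"
  assumes s: "s > 0" and \<delta>: "\<delta> \<ge> 0"
    and cover: "A \<subseteq> (\<Union>w\<in>W. V w)"
    and V: "\<And>w. w \<in> W \<Longrightarrow> bounded (V w)" "\<And>w. w \<in> W \<Longrightarrow> diameter (V w) \<le> \<delta>"
    and sum: "\<And>F. finite F \<Longrightarrow> F \<subseteq> W \<Longrightarrow> (\<Sum>w\<in>F. diameter (V w) powr s) \<le> e"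
  shows "hausdorff_premeasure s \<delta> A \<le> ennreal e"
proof -
  let ?U = "\<lambda>n. if list_decode n \<in> W then V (list_decode n) else {}"
  have "A \<subseteq> (\<Union>n. ?U n)"
  proof
    fix x assume "x \<in> A"
    then obtain w where "w \<in> W" "x \<in> V w" using cover by blast
    then have "x \<in> ?U (list_encode w)" by simp
    then show "x \<in> (\<Union>n. ?U n)" by (rule UN_I[OF UNIV_I])
  qed
  then have "hausdorff_premeasure s \<delta> A \<le> (\<Sum>n. ennreal (diam_gauge s (?U n)))"
    by (rule hausdorff_premeasure_le) (use V \<delta> in auto)
  also have "\<dots> \<le> ennreal e"
  proof (rule suminf_le_const)
    fix n
    let ?F = "list_decode ` {i \<in> {..<n}. list_decode i \<in> W}"
    have inj: "inj_on list_decode X" for X by (metis inj_on_inverseI list_decode_inverse)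
    have "(\<Sum>i<n. diam_gauge s (?U i)) \<le> (\<Sum>i\<in>{i \<in> {..<n}. list_decode i \<in> W}. diameter (V (list_decode i))
      powr s)"
      using s by (subst sum.inter_filter) (auto intro!: sum_mono simp: diam_gauge_def)
    also have "\<dots> = (\<Sum>w\<in>?F. diameter (V w) powr s)"
      by (subst sum.reindex[OF inj]) simp
    also have "\<dots> \<le> e" by (rule sum) auto
    finally show "(\<Sum>i<n. ennreal (diam_gauge s (?U i))) \<le> ennreal e"
      by (simp add: diam_gauge_nonneg ennreal_leI)
  qed simp
  finally show ?thesis .
qed

lemma hausdorff_dim_le:
  assumes "0 \<le> \<theta>" "\<And>s. \<theta> < s \<Longrightarrow> hausdorff_measure s A = 0"
  shows "hausdorff_dim A \<le> ennreal \<theta>"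
proof (rule ennreal_le_epsilon)
  fix e :: real assume e: "e > 0"
  have "hausdorff_dim A \<le> ennreal (\<theta> + e)"
    unfolding hausdorff_dim_def by (rule INF_lower) (use assms e in auto)
  then show "hausdorff_dim A \<le> ennreal \<theta> + ennreal e" using assms e by simp
qed

lemma hausdorff_dim_ge:
  assumes "\<And>t. 0 \<le> t \<Longrightarrow> t < \<theta> \<Longrightarrow> hausdorff_measure t A \<noteq> 0"
  shows "ennreal \<theta> \<le> hausdorff_dim A"
  unfolding hausdorff_dim_def
proof (rule INF_greatest)
  fix t assume "t \<in> {s. 0 \<le> s \<and> hausdorff_measure s A = 0}"
  then have "\<not> t < \<theta>" using assms by blast
  then show "ennreal \<theta> \<le> ennreal t" by (simp add: ennreal_leI)
qed

text \<open>Mass distribution principle, in a form that does not require \<open>f\<close> to be measurable.\<close>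

lemma hausdorff_measure_nonzero:
  fixes f :: "'b \<Rightarrow> 'a::metric_space"
  assumes "prob_space M" and f: "\<And>\<omega>. \<omega> \<in> space M \<Longrightarrow> f \<omega> \<in> A"
    and t: "0 \<le> t" "t \<le> s" and s: "s > 0" and C: "C > 0"
    and ball: "\<And>\<omega>0 r. \<omega>0 \<in> space M \<Longrightarrow> 0 < r \<Longrightarrow> \<exists>E\<in>sets M.
      {\<omega> \<in> space M. dist (f \<omega>) (f \<omega>0) \<le> r} \<subseteq> E \<and> emeasure M E \<le> ennreal (C * r powr s)"
  shows "hausdorff_measure t A \<noteq> 0"
proof
  assume "hausdorff_measure t A = 0"
  then have "hausdorff_premeasure t 1 A = 0" unfolding hausdorff_measure_0_iff by simp
  then have "hausdorff_premeasure t 1 A < ennreal (1 / (4 * C))" using C by simp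
  from hausdorff_premeasure_cover[OF this] obtain U where
    U: "A \<subseteq> (\<Union>i. U i)" "\<And>i. bounded (U i)" "\<And>i. diameter (U i) \<le> 1"
    "(\<Sum>i. ennreal (diam_gauge t (U i))) < ennreal (1 / (4 * C))"
    by auto
  interpret prob_space M by fact
  \<comment> \<open>A covering set may have diameter 0, but \<open>ball\<close> wants a positive
    radius. The paddings \<open>e i\<close> contribute 1/2 in total; with 1/4 from the cover the sum
    stays below 1.\<close>
  define e where "e i = ((1/2) ^ Suc (Suc i) / C) powr (1 / s)" for i :: nat
  have e: "e i > 0" "C * e i powr s = (1/2) ^ Suc (Suc i)" for i
    using C s by (auto simp: e_def powr_powr)
  have "\<exists>E\<in>sets M. {\<omega> \<in> space M. f \<omega> \<in> U i} \<subseteq> E \<and>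
      emeasure M E \<le> ennreal C * ennreal (diam_gauge t (U i)) + ennreal ((1/2) ^ Suc (Suc i))" for i
  proof (cases "{\<omega> \<in> space M. f \<omega> \<in> U i} = {}")
    case True
    then show ?thesis by (intro bexI[of _ "{}"]) auto
  next
    case False
    then obtain \<omega>0 where \<omega>0: "\<omega>0 \<in> space M" "f \<omega>0 \<in> U i" by blast
    define r where "r = max (diameter (U i)) (e i)"
    have "r > 0" using e by (auto simp: r_def less_max_iff_disj)
    from ball[OF \<omega>0(1) this] obtain E where E: "E \<in> sets M"
      "{\<omega> \<in> space M. dist (f \<omega>) (f \<omega>0) \<le> r} \<subseteq> E" "emeasure M E \<le> ennreal (C * r powr s)" by blast
    have "dist (f \<omega>) (f \<omega>0) \<le> r" if "f \<omega> \<in> U i" for \<omega>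
      using diameter_bounded_bound[OF U(2) that \<omega>0(2)] by (auto simp: r_def)
    then have sub: "{\<omega> \<in> space M. f \<omega> \<in> U i} \<subseteq> E" using E(2) by blast
    have d0: "0 \<le> diameter (U i)" by (rule diameter_ge_0[OF U(2)])
    \<comment> \<open>Diameters are at most 1, so passing from exponent \<open>t\<close> to the
      larger \<open>s\<close> only decreases the power.\<close>
    have digit: "diameter (U i) powr s \<le> diam_gauge t (U i)"
    proof (cases "t = 0")
      case True
      then show ?thesis using U(3)[of i] d0 s \<omega>0(2) powr_mono2[of s "diameter (U i)" 1]
        by (auto simp: diam_gauge_def)
    next
      case False
      then show ?thesis using U(3)[of i] d0 t \<omega>0(2) by (auto simp: diam_gauge_def intro!: powr_mono')
    qed
    have "C * r powr s \<le> C * diameter (U i) powr s + C * e i powr s"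
      using C by (auto simp: r_def max_def)
    also have "\<dots> \<le> C * diam_gauge t (U i) + (1/2) ^ Suc (Suc i)"
      unfolding e(2) using digit C by (intro add_right_mono mult_left_mono) auto
    finally have "ennreal (C * r powr s) \<le> ennreal (C * diam_gauge t (U i) + (1/2) ^ Suc (Suc i))"
      by (rule ennreal_leI)
    moreover have "ennreal (C * diam_gauge t (U i) + (1/2) ^ Suc (Suc i))
        = ennreal C * ennreal (diam_gauge t (U i)) + ennreal ((1/2) ^ Suc (Suc i))"
      using C by (subst ennreal_plus) (auto simp: ennreal_mult' diam_gauge_nonneg)
    ultimately have "emeasure M E \<le> ennreal C * ennreal (diam_gauge t (U i)) + ennreal ((1/2) ^ Suc (Suc i))"
      using E(3) by (metis order_trans)
    then show ?thesis using E(1) sub by blast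
  qed
  then obtain E where E: "\<And>i. E i \<in> sets M" "\<And>i. {\<omega> \<in> space M. f \<omega> \<in> U i} \<subseteq> E i"
    "\<And>i. emeasure M (E i) \<le> ennreal C * ennreal (diam_gauge t (U i)) + ennreal ((1/2) ^ Suc (Suc i))"
    by metis
  have "space M \<subseteq> (\<Union>i. E i)"
  proof
    fix \<omega> assume w: "\<omega> \<in> space M"
    then obtain i where "f \<omega> \<in> U i" using f U(1) by blast
    then show "\<omega> \<in> (\<Union>i. E i)" using E(2) w by blast
  qed
  then have "emeasure M (space M) \<le> emeasure M (\<Union>i. E i)" using E(1) by (intro emeasure_mono) auto
  also have "\<dots> \<le> (\<Sum>i. emeasure M (E i))" using E(1) by (intro emeasure_subadditive_countably) auto
  also have "\<dots> \<le> (\<Sum>i. ennreal C * ennreal (diam_gauge t (U i)) + ennreal ((1/2) ^ Suc (Suc i)))"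
    by (intro suminf_le E) auto
  also have "\<dots> = (\<Sum>i. ennreal C * ennreal (diam_gauge t (U i))) + (\<Sum>i. ennreal ((1/2) ^ Suc (Suc i)))"
    by (intro suminf_add[symmetric]) auto
  also have "(\<Sum>i. ennreal C * ennreal (diam_gauge t (U i))) = ennreal C * (\<Sum>i. ennreal (diam_gauge t (U i)))"
    by (rule ennreal_suminf_cmult)
  also have "(\<Sum>i. ennreal ((1/2) ^ Suc (Suc i))) = ennreal (1/2)"
  proof -
    have "(\<lambda>i. 1/2 * (1/2) ^ Suc i :: real) sums (1/2 * 1)" by (rule sums_mult[OF power_half_series])
    then show ?thesis by (intro suminf_ennreal_eq) auto
  qed
  also have "ennreal C * (\<Sum>i. ennreal (diam_gauge t (U i))) \<le> ennreal C * ennreal (1 / (4 * C))"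
    using U(4) by (intro mult_left_mono) auto
  also have "ennreal C * ennreal (1 / (4 * C)) = ennreal (1/4)"
    using C by (simp add: ennreal_mult'[symmetric])
  also have "ennreal (1/4) + ennreal (1/2) = ennreal (3/4)"
    by (subst ennreal_plus[symmetric]) simp_all
  also have "\<dots> < 1" by (simp add: ennreal_less_one_iff)
  finally show False by (simp add: emeasure_space_1)
qed

section \<open>Upper bound\<close>

lemma concI: "u \<in> S \<Longrightarrow> v \<in> T \<Longrightarrow> u @ v \<in> conc S T"
  by (auto simp: conc_def)

text \<open>
  The jump at \<open>N 0 = 2\<close> is a dummy: \<open>\<phi>\<close> is constrained from \<open>N 1\<close> on only, which allows every
  sequence of sufficiently late jump times to be normalised in this way.
\<close>

locale jumps =
  fixes N :: "nat \<Rightarrow> nat" and L :: "nat \<Rightarrow> real" and \<alpha> \<beta> \<rho> :: real and \<phi> :: "nat \<Rightarrow> real"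
  assumes N_0: "N 0 = 2" and N_step: "\<And>k. N k + 2 \<le> N (Suc k)"
    and L_0: "0 \<le> L 0" and L_step: "\<And>k. L k + \<rho> \<le> L (Suc k)" and \<rho>: "0 < \<rho>"
    and lim_\<alpha>: "(\<lambda>k. (\<Sum>j<k. L j) / N k) \<longlonglongrightarrow> \<alpha>"
    and lim_\<beta>: "(\<lambda>k. L k / N k) \<longlonglongrightarrow> \<beta>"
    and sparse: "(\<lambda>k. real k * ln (real (Suc k)) / N k) \<longlonglongrightarrow> 0"
    and fast: "(\<lambda>k. N (Suc k) / exp (L k)) \<longlonglongrightarrow> 0"
    and \<phi>: "\<And>k n. 1 \<le> k \<Longrightarrow> N k \<le> n \<Longrightarrow> n < N (Suc k) \<Longrightarrow> \<phi> n = exp (L k)"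
begin

lemma N_ge: "2 * k + 2 \<le> N k"
proof (induction k)
  case (Suc k)
  then show ?case using N_step[of k] by simp
qed (simp add: N_0)

lemma N_pos: "0 < N k"
  using N_ge[of k] by linarith

lemma N_mono: "i \<le> j \<Longrightarrow> N i \<le> N j"
proof (rule lift_Suc_mono_le[of N])
  show "N n \<le> N (Suc n)" for n using N_step[of n] by linarith
qed

lemma N_inj: "N k - 1 = N l - 1 \<Longrightarrow> k = l"
proof -
  assume e: "N k - 1 = N l - 1"
  have "N i < N j" if "i < j" for i j using N_mono[of "Suc i" j] N_step[of i] that by simp
  then show ?thesis using e N_pos[of k] N_pos[of l] by (metis Suc_pred' linorder_neqE_nat less_irrefl)
qed

lemma L_ge: "k * \<rho> \<le> L k"
proof (induction k)
  case (Suc k)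
  then show ?case using L_step[of k] by (simp add: algebra_simps)
qed (simp add: L_0)

lemma L_nonneg: "0 \<le> L k"
  using L_ge[of k] \<rho> by (meson mult_nonneg_nonneg of_nat_0_le_iff order_trans less_imp_le)

lemma L_at_top: "filterlim L at_top sequentially"
proof (rule filterlim_at_top_mono)
  show "filterlim (\<lambda>k. real k * \<rho>) at_top sequentially"
    using filterlim_tendsto_pos_mult_at_top[OF tendsto_const \<rho> filterlim_real_sequentially]
    by (simp add: mult.commute)
qed (simp add: L_ge)

lemma N_at_top: "filterlim (\<lambda>k. real (N k)) at_top sequentially"
proof (rule filterlim_at_top_mono)
  show "filterlim (\<lambda>k. real k) at_top sequentially" by (rule filterlim_real_sequentially)
  show "\<forall>\<^sub>F k in sequentially. real k \<le> real (N k)"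
  proof (rule always_eventually, rule allI)
    show "real k \<le> real (N k)" for k using N_ge[of k] by linarith
  qed
qed

lemma lim_k: "(\<lambda>k. real k / N k) \<longlonglongrightarrow> 0"
proof (rule Lim_null_comparison[OF _ sparse])
  show "\<forall>\<^sub>F k in sequentially. norm (real k / N k) \<le> real k * ln (real (Suc k)) / N k"
    using eventually_ge_at_top[of 2]
  proof eventually_elim
    case (elim k)
    have "exp 1 \<le> (3::real)" using exp_le by simp
    then have "1 \<le> ln (3::real)" by (subst ln_ge_iff) auto
    also have "\<dots> \<le> ln (real (Suc k))" using elim by (intro ln_mono) auto
    finally have "real k * 1 \<le> real k * ln (real (Suc k))" by (intro mult_left_mono) auto
    then show ?case by (simp add: divide_right_mono)
  qed
qed

text \<open>After division by \<open>N k\<close> the last two terms vanish in the limit, by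
  \<open>lim_k\<close> and \<open>sparse\<close>, and the rest tends to
  \<open>p - a * \<alpha> - b * \<beta>\<close>. Both halves of the dimension formula rest on
  this.\<close>

lemma exponent_at_bot:
  fixes a b c d p :: real
  assumes "p - a * \<alpha> - b * \<beta> < 0"
  shows "filterlim (\<lambda>k. N k * p - a * (\<Sum>j<k. L j) - b * L k + c * k + d * (real k * ln (real (Suc k))))
    at_bot sequentially"
proof -
  let ?X = "\<lambda>k. p - a * ((\<Sum>j<k. L j) / N k) - b * (L k / N k) + c * (real k / N k)
     + d * (real k * ln (real (Suc k)) / N k)"
  have "?X \<longlonglongrightarrow> p - a * \<alpha> - b * \<beta> + c * 0 + d * 0"
    by (intro tendsto_intros lim_\<alpha> lim_\<beta> lim_k sparse)
  then have "?X \<longlonglongrightarrow> p - a * \<alpha> - b * \<beta>" by simp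
  note filterlim_tendsto_neg_mult_at_bot[OF this assms N_at_top]
  moreover have "N k \<noteq> 0" for k using N_pos[of k] by simp
  ultimately show ?thesis by (simp add: algebra_simps)
qed

section \<open>Words and intervals covering the set\<close>

definition upper_win :: "real \<Rightarrow> nat \<Rightarrow> nat set" where
  "upper_win \<kappa> k = {a. 1 \<le> a \<and> \<kappa> * exp (L k) \<le> a \<and> a \<le> 2 * exp (L k)}"

text \<open>Contribution of one jump and the gap after it: at most \<open>2 * exp (L k)\<close>
  values of weight at most \<open>(\<kappa> * exp (L k)) powr (- 2 * s)\<close> each, times the
  bound for \<open>Z\<close> over the gap.\<close>

definition upper_factor :: "real \<Rightarrow> real \<Rightarrow> nat \<Rightarrow> real" where
  "upper_factor \<kappa> s k = 2 * \<kappa> powr (- 2 * s) * exp ((1 - 2 * s) * L k) *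
     (4 powr s * exp (real (N (Suc k) - N k - 1) * pressure_on {1..} s))"

text \<open>Words that end just before position \<open>N (K + i)\<close>: the first
  \<open>N K - 1\<close> letters are free, and the letters at the jumps \<open>K\<close> to
  \<open>K + i - 1\<close> are confined to their windows.\<close>

definition upper_words :: "real \<Rightarrow> nat \<Rightarrow> nat \<Rightarrow> nat list set" where
  "upper_words \<kappa> K = rec_nat (words {1..} (N K - 1))
     (\<lambda>i S. conc (conc S (words (upper_win \<kappa> (K + i)) 1))
       (words {1..} (N (Suc (K + i)) - N (K + i) - 1)))"

lemma upper_words_Suc:
  "upper_words \<kappa> K (Suc i) = conc (conc (upper_words \<kappa> K i)
     (words (upper_win \<kappa> (K + i)) 1))
     (words {1..} (N (Suc (K + i)) - N (K + i) - 1))"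
  by (simp add: upper_words_def)

lemma upper_words_length: "w \<in> upper_words \<kappa> K i \<Longrightarrow> length w = N (K + i) - 1 \<and> 0 \<notin> set w"
proof (induction i arbitrary: w)
  case 0
  then show ?case by (auto simp: upper_words_def words_def)
next
  case (Suc i)
  then obtain u v x where w: "w = (u @ x) @ v" "u \<in> upper_words \<kappa> K i"
    "x \<in> words (upper_win \<kappa> (K + i)) 1"
    "v \<in> words {1..} (N (Suc (K + i)) - N (K + i) - 1)"
    by (auto simp: upper_words_def conc_def)
  have "length w = N (K + i) - 1 + 1 + (N (Suc (K + i)) - N (K + i) - 1)"
    using w Suc.IH[OF w(2)] by (auto simp: words_def)
  moreover have "0 \<notin> set w" using w Suc.IH[OF w(2)] by (auto simp: words_def upper_win_def)
  ultimately show ?case using N_step[of "K + i"] N_pos[of "K + i"] by simp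
qed

lemma upper_words_sum:
  assumes s: "s > 1 / 2" and \<kappa>: "\<kappa> > 0"
  shows "wt s summable_on upper_words \<kappa> K i \<and> infsum (wt s) (upper_words \<kappa> K i) \<le>
    Z {1..} (N K - 1) s * (\<Prod>j<i. upper_factor \<kappa> s (K + j))"
proof (induction i)
  case 0
  show ?case using wt_summable_words[OF s] by (simp add: upper_words_def Z_def)
next
  case (Suc i)
  let ?X = "upper_win \<kappa> (K + i)"
  let ?g = "N (Suc (K + i)) - N (K + i) - 1"
  let ?U = "upper_words \<kappa> K i"
  have e: "upper_words \<kappa> K (Suc i) = conc (conc ?U (words ?X 1)) (words {1..} ?g)"
    by (simp add: upper_words_def)
  have posU: "0 \<notin> set u" "length u = N (K + i) - 1" if "u \<in> ?U" for u
    using upper_words_length that by auto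
  have posX: "0 \<notin> set u" "length u = 1" if "u \<in> words ?X 1" for u
    using that by (auto simp: words_def upper_win_def)
  have posc: "0 \<notin> set u" "length u = N (K + i) - 1 + 1" if "u \<in> conc ?U (words ?X 1)" for u
    using that posU posX by (auto simp: conc_def)
  have posg: "0 \<notin> set u" if "u \<in> words {1..} ?g" for u
    using words_pos[OF subset_refl that] .
  have sX: "wt s summable_on words ?X 1" by (rule wt_singletons(1)[OF s])
  have XI: "infsum (wt s) (words ?X 1) \<le> 2 * \<kappa> powr (- 2 * s) * exp ((1 - 2 * s) * L (K + i))"
  proof -
    have sub: "?X \<subseteq> {1..nat \<lfloor>2 * exp (L (K + i))\<rfloor>}" by (auto simp: upper_win_def le_nat_floor)
    then have fin: "finite ?X" by (rule finite_subset) simp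
    have "card ?X \<le> nat \<lfloor>2 * exp (L (K + i))\<rfloor>" using card_mono[OF _ sub] by simp
    moreover have "real (nat \<lfloor>2 * exp (L (K + i))\<rfloor>) \<le> 2 * exp (L (K + i))" by (rule of_nat_floor) simp
    ultimately have card: "real (card ?X) \<le> 2 * exp (L (K + i))" by linarith
    have "infsum (wt s) (words ?X 1) = (\<Sum>a\<in>?X. real a powr (- 2 * s))"
      unfolding wt_singletons(2)[OF s] using fin by simp
    also have "\<dots> \<le> (\<Sum>a\<in>?X. (\<kappa> * exp (L (K + i))) powr (- 2 * s))"
      using s \<kappa> by (intro sum_mono powr_mono2') (auto simp: upper_win_def)
    also have "\<dots> = card ?X * (\<kappa> * exp (L (K + i))) powr (- 2 * s)" by simp
    also have "\<dots> \<le> 2 * exp (L (K + i)) * (\<kappa> * exp (L (K + i))) powr (- 2 * s)"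
      using card by (intro mult_right_mono) auto
    also have "\<dots> = 2 * \<kappa> powr (- 2 * s) * (exp (L (K + i)) * exp (L (K + i)) powr (- 2 * s))"
      using \<kappa> by (simp add: powr_mult)
    also have "exp (L (K + i)) * exp (L (K + i)) powr (- 2 * s) = exp ((1 - 2 * s) * L (K + i))"
      by (simp add: powr_def exp_add[symmetric] algebra_simps)
    finally show ?thesis .
  qed
  have gI: "infsum (wt s) (words {1..} ?g) \<le> 4 powr s * exp (real ?g * pressure_on {1..} s)"
    using Z_bounds(1)[OF s, of "{1..}" ?g] by (simp add: Z_def)
  have s1: "wt s summable_on conc ?U (words ?X 1)"
    by (rule wt_conc(1)[OF conjunct1[OF Suc] sX _ posU(2)]) (use s posU posX in auto)
  have s2: "wt s summable_on upper_words \<kappa> K (Suc i)" unfolding e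
    by (rule wt_conc(1)[OF s1 _ _ posc(2)]) (use s wt_summable_words[OF s] posc posg in auto)
  have "infsum (wt s) (upper_words \<kappa> K (Suc i)) \<le> infsum (wt s) (conc ?U (words ?X 1)) * infsum (wt s)
    (words {1..} ?g)"
    unfolding e by (rule wt_conc(2)[OF s1 _ _ posc(2)]) (use s wt_summable_words[OF s] posc posg in auto)
  also have "\<dots> \<le> (infsum (wt s) ?U * infsum (wt s) (words ?X 1)) * infsum (wt s) (words {1..} ?g)"
    by (rule mult_right_mono[OF wt_conc(2)[OF conjunct1[OF Suc] sX _ posU(2)]])
      (use s posU posX in \<open>auto intro: infsum_nonneg simp: wt_nonneg\<close>)
  also have "\<dots> \<le> (Z {1..} (N K - 1) s * (\<Prod>j<i. upper_factor \<kappa> s (K + j))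
     * (2 * \<kappa> powr (- 2 * s) * exp ((1 - 2 * s) * L (K + i)))) * (4 powr s * exp (real ?g * pressure_on
       {1..} s))"
    using conjunct2[OF Suc] XI gI Z_pos[OF s, of "{1..}"]
    by (intro mult_mono mult_nonneg_nonneg prod_nonneg)
      (auto intro: infsum_nonneg simp: wt_nonneg less_imp_le upper_factor_def)
  finally show ?case using s2 by (simp add: upper_factor_def mult.assoc)
qed

lemma upper_words_sum_le:
  assumes s: "s > 1 / 2" and \<kappa>: "\<kappa> > 0"
  shows "\<exists>C D :: real. C > 0 \<and> (\<forall>i. infsum (wt s) (upper_words \<kappa> K i) \<le>
    C * exp (N (K + i) * pressure_on {1..} s - (2 * s - 1) * (\<Sum>j<K + i. L j) + D * (K + i)))"
proof -
  let ?P = "pressure_on {1..} s"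
  \<comment> \<open>The summand \<open>- ?P\<close> corrects for the one position per jump that
    belongs to no gap.\<close>
  define D where "D = ln (2 * \<kappa> powr (- 2 * s) * 4 powr s) - ?P"
  define C where "C = Z {1..} (N K - 1) s * exp (- (N K * ?P - (2 * s - 1) * (\<Sum>j<K. L j) + D * K))"
  have c: "2 * \<kappa> powr (- 2 * s) * 4 powr s = exp (D + ?P)" using \<kappa> by (simp add: D_def)
  have "Z {1..} (N K - 1) s * (\<Prod>j<i. upper_factor \<kappa> s (K + j))
    = C * exp (N (K + i) * ?P - (2 * s - 1) * (\<Sum>j<K + i. L j) + D * (K + i))" for i
  proof (induction i)
    case 0
    have "exp (- (N K * ?P - (2 * s - 1) * (\<Sum>j<K. L j) + D * K)) * exp (N K * ?P - (2 * s - 1) * (\<Sum>j<K. L j)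
      + D * K) = 1"
      by (simp add: exp_add[symmetric] del: minus_diff_eq minus_add_distrib)
    then show ?case by (simp add: C_def mult.assoc)
  next
    case (Suc i)
    have g: "real (N (Suc (K + i)) - N (K + i) - 1) = real (N (Suc (K + i))) - real (N (K + i)) - 1"
      using N_step[of "K + i"] by linarith
    have "upper_factor \<kappa> s (K + i)
      = (2 * \<kappa> powr (- 2 * s) * 4 powr s) * (exp ((1 - 2 * s) * L (K + i)) *
       exp (real (N (Suc (K + i)) - N (K + i) - 1) * ?P))" by (simp add: upper_factor_def)
    also have "\<dots> = exp (D + (1 - 2 * s) * L (K + i) + (real (N (Suc (K + i))) - real (N (K + i))) * ?P)"
      unfolding c g by (simp add: exp_add[symmetric] algebra_simps)
    finally show ?case using Suc
      by (simp add: mult.assoc[symmetric]) (simp add: mult.assoc exp_add[symmetric] algebra_simps)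
  qed
  moreover have "C > 0" using Z_pos[OF s, of "{1..}"] by (simp add: C_def)
  ultimately show ?thesis using upper_words_sum[OF s \<kappa>, of K] by (intro exI[of _ C] exI[of _ D]) simp
qed

definition upper_set :: "real \<Rightarrow> nat \<Rightarrow> real set" where
  "upper_set \<kappa> K = {x \<in> unit_irrationals. \<forall>k\<ge>K. \<kappa> * exp (L k) \<le> cf_coeff (N k) x \<and> cf_coeff (N k) x \<le> 2 *
    exp (L k)}"

lemma upper_set_words:
  assumes x: "x \<in> upper_set \<kappa> K"
  shows "map (\<lambda>k. cf_coeff k x) [1..<N (K + i)] \<in> upper_words \<kappa> K i"
proof (induction i)
  case 0
  have "x \<in> unit_irrationals" using x by (simp add: upper_set_def)
  then show ?case using cf_coeff_pos by (auto simp: upper_words_def words_def)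
next
  case (Suc i)
  let ?d = "\<lambda>k. cf_coeff k x"
  have u: "x \<in> unit_irrationals" using x by (simp add: upper_set_def)
  have "N (K + i) \<ge> 1" "N (K + i) + 2 \<le> N (Suc (K + i))" using N_pos[of "K + i"] N_step[of "K + i"] by auto
  then have "[1..<N (Suc (K + i))] = ([1..<N (K + i)] @ [N (K + i)]) @ [Suc (N (K + i))..<N (Suc (K + i))]"
    using upt_add_eq_append[of 1 "N (K + i)" "N (Suc (K + i)) - N (K + i)"]
      upt_conv_Cons[of "N (K + i)" "N (Suc (K + i))"] by simp
  then have e: "map ?d [1..<N (Suc (K + i))] = (map ?d [1..<N (K + i)] @ [?d (N (K + i))]) @ map ?d [Suc (N
    (K + i))..<N (Suc (K + i))]"
    by simp
  have "[?d (N (K + i))] \<in> words (upper_win \<kappa> (K + i)) 1"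
    using x cf_coeff_pos[OF u, of "N (K + i)"] \<open>N (K + i) \<ge> 1\<close> by (auto simp: upper_set_def upper_win_def
      words_def)
  moreover have "map ?d [Suc (N (K + i))..<N (Suc (K + i))] \<in> words {1..} (N (Suc (K + i)) - N (K + i) - 1)"
    using cf_coeff_pos[OF u] by (auto simp: words_def)
  ultimately show ?case using Suc unfolding upper_words_Suc add_Suc_right e by (intro concI)
qed

lemma upper_set_null:
  assumes s: "s > 1 / 2" and \<kappa>: "\<kappa> > 0" and neg: "pressure_on {1..} s - (2 * s - 1) * \<alpha> - s * \<beta> < 0"
  shows "hausdorff_measure s (upper_set \<kappa> K) = 0"
  unfolding hausdorff_measure_0_iff
proof (intro allI impI)
  fix \<delta> :: real assume \<delta>: "\<delta> > 0"
  obtain C D :: real where C: "C > 0" and CD: "\<And>i. infsum (wt s) (upper_words \<kappa> K i) \<le>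
    C * exp (N (K + i) * pressure_on {1..} s - (2 * s - 1) * (\<Sum>j<K + i. L j) + D * (K + i))"
    using upper_words_sum_le[OF s \<kappa>, of K] by auto
  \<comment> \<open>The term \<open>- s * L k\<close> comes from the diameters, the other
    \<open>L\<close> terms from the sum of weights; the zero summand only matches the shape of
    \<open>exponent_at_bot\<close>.\<close>
  let ?X = "\<lambda>k. N k * pressure_on {1..} s - (2 * s - 1) * (\<Sum>j<k. L j) - s * L k + D * k + 0 * (real k * ln
    (real (Suc k)))"
  have X: "filterlim ?X at_bot sequentially" by (rule exponent_at_bot[OF neg])
  have "hausdorff_premeasure s \<delta> (upper_set \<kappa> K) \<le> 0 + ennreal e" if e: "e > 0" for e
  proof -
    have "(\<lambda>k. \<kappa> powr (- s) * C * exp (?X k)) \<longlonglongrightarrow> \<kappa> powr (- s) * C * 0"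
      by (intro tendsto_intros filterlim_compose[OF exp_at_bot X])
    then have "\<forall>\<^sub>F k in sequentially. \<kappa> powr (- s) * C * exp (?X k) < e"
      by (rule order_tendstoD) (use e in simp)
    moreover have "\<forall>\<^sub>F k in sequentially. ln (1 / (\<kappa> * \<delta>)) \<le> L k"
      using L_at_top by (simp add: filterlim_at_top)
    ultimately have "\<forall>\<^sub>F k in sequentially. \<kappa> powr (- s) * C * exp (?X k) < e \<and> ln (1 / (\<kappa> * \<delta>)) \<le> L k \<and> K \<le> k"
      using eventually_ge_at_top[of K] by eventually_elim auto
    then obtain k where k: "\<kappa> powr (- s) * C * exp (?X k) < e" "ln (1 / (\<kappa> * \<delta>)) \<le> L k" "K \<le> k"
      using eventually_happens'[OF sequentially_bot] by blast
    define i where "i = k - K"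
    have ki: "K + i = k" using k(3) by (simp add: i_def)
    \<comment> \<open>Bound for the Gauss iterate after \<open>N k - 1\<close> steps: it is at most
      the reciprocal of the coefficient at \<open>N k\<close>. One interval of this length thus
      takes care of all values of that coefficient.\<close>
    define \<tau> where "\<tau> = 1 / (\<kappa> * exp (L k))"
    have \<tau>: "\<tau> > 0" using \<kappa> by (simp add: \<tau>_def)
    have "1 / (\<kappa> * \<delta>) \<le> exp (L k)" using k(2) \<kappa> \<delta> by (subst (asm) exp_le_cancel_iff[symmetric]) simp
    then have \<tau>\<delta>: "\<tau> \<le> \<delta>" using \<kappa> \<delta> unfolding \<tau>_def by (simp add: field_simps)
    let ?W = "upper_words \<kappa> K i"
    let ?V = "\<lambda>w. ev w ` {0..\<tau>}"
    have dd: "dist x y \<le> \<tau> / (real (den w))\<^sup>2" if "w \<in> ?W" "x \<in> ?V w" "y \<in> ?V w" for w x y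
    proof -
      obtain t u where tu: "0 \<le> t" "t \<le> \<tau>" "x = ev w t" "0 \<le> u" "u \<le> \<tau>" "y = ev w u" using \<open>x \<in> ?V w\<close> \<open>y \<in>
        ?V w\<close> by auto
      have "\<bar>x - y\<bar> \<le> \<bar>t - u\<bar> / (real (den w))\<^sup>2" unfolding tu
        by (rule abs_ev_diff_le) (use upper_words_length that tu in auto)
      also have "\<dots> \<le> \<tau> / (real (den w))\<^sup>2" using tu by (intro divide_right_mono) auto
      finally show ?thesis by (simp add: dist_real_def)
    qed
    have bd: "bounded (?V w)" if "w \<in> ?W" for w
      unfolding bounded_two_points using dd[OF that] by (intro exI[of _ "\<tau> / (real (den w))\<^sup>2"]) blast
    have dia: "diameter (?V w) \<le> \<tau> / (real (den w))\<^sup>2" if "w \<in> ?W" for w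
      using \<tau> dd[OF that] by (intro diameter_le) (auto simp: dist_real_def)
    have dw: "real (den w) \<ge> 1" if "w \<in> ?W" for w using den_pos[of w] upper_words_length[OF that] by simp
    have "hausdorff_premeasure s \<delta> (upper_set \<kappa> K) \<le> ennreal e"
    proof (rule hausdorff_premeasure_le_words[where W = ?W and V = ?V])
      show "upper_set \<kappa> K \<subseteq> (\<Union>w\<in>?W. ?V w)"
      proof
        fix x assume x: "x \<in> upper_set \<kappa> K"
        then have u: "x \<in> unit_irrationals" by (simp add: upper_set_def)
        have N1: "Suc (N k - 1) = N k" using N_pos[of k] by simp
        let ?w = "map (\<lambda>k. cf_coeff k x) [1..<N k]"
        let ?t = "(gauss_map ^^ (N k - 1)) x"
        have "?w \<in> ?W" using upper_set_words[OF x, of i] ki by simp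
        moreover have "x = ev ?w ?t" using ev_cf_coeff[OF u, of "N k - 1"] N1 by simp
        moreover have "?t \<in> {0..\<tau>}"
        proof -
          have "?t \<ge> 0" using gauss_map_funpow_unit_irrationals[OF u] by (simp add: unit_irrationals_def)
          moreover have "?t \<le> 1 / cf_coeff (N k) x" using cf_coeff_bound[OF u, of "N k - 1"] N1 by simp
          moreover have "1 / cf_coeff (N k) x \<le> \<tau>" unfolding \<tau>_def
          proof (rule divide_left_mono)
            show le: "\<kappa> * exp (L k) \<le> cf_coeff (N k) x" using x k(3) by (simp add: upper_set_def)
            have "\<kappa> * exp (L k) > 0" using \<kappa> by simp
            then show "0 < real (cf_coeff (N k) x) * (\<kappa> * exp (L k))" using le by (metis less_le_trans
              mult_pos_pos)
          qed simp
          ultimately show ?thesis by simp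
        qed
        ultimately show "x \<in> (\<Union>w\<in>?W. ?V w)" by blast
      qed
      show "diameter (?V w) \<le> \<delta>" if "w \<in> ?W" for w
      proof -
        have "\<tau> / (real (den w))\<^sup>2 \<le> \<tau> / 1" using dw[OF that] \<tau> by (intro divide_left_mono) (auto simp:
          power2_eq_square mult_ge1_I)
        then show ?thesis using dia[OF that] \<tau>\<delta> by linarith
      qed
      fix F assume F: "finite F" "F \<subseteq> ?W"
      have "(\<Sum>w\<in>F. diameter (?V w) powr s) \<le> (\<Sum>w\<in>F. \<tau> powr s * wt s w)"
      proof (rule sum_mono)
        fix w assume "w \<in> F"
        then have w: "w \<in> ?W" using F by blast
        have "diameter (?V w) powr s \<le> (\<tau> / (real (den w))\<^sup>2) powr s"
          using dia[OF w] s diameter_ge_0[OF bd[OF w]] by (intro powr_mono2) auto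
        also have "\<tau> / (real (den w))\<^sup>2 = \<tau> * real (den w) powr (- 2)"
          using dw[OF w] by (simp add: powr_minus divide_inverse)
        also have "\<dots> powr s = \<tau> powr s * wt s w"
          using \<tau> by (simp add: wt_def powr_mult powr_powr)
        finally show "diameter (?V w) powr s \<le> \<tau> powr s * wt s w" .
      qed
      also have "\<dots> = \<tau> powr s * sum (wt s) F" by (simp add: sum_distrib_left)
      also have "\<dots> \<le> \<tau> powr s * infsum (wt s) ?W"
        using upper_words_sum[OF s \<kappa>, of K i] F by (intro mult_left_mono finite_sum_le_infsum) (auto simp:
          wt_nonneg)
      also have "\<dots> \<le> \<tau> powr s * (C * exp (N k * pressure_on {1..} s - (2 * s - 1) * (\<Sum>j<k. L j) + D * k))"
        using CD[of i] ki by (intro mult_left_mono) auto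
      also have "\<tau> powr s = \<kappa> powr (- s) * exp (- s * L k)"
        using \<kappa> by (simp add: \<tau>_def powr_divide powr_mult powr_minus exp_minus field_simps) (simp add: powr_def)
      also have "\<kappa> powr (- s) * exp (- s * L k) * (C * exp (N k * pressure_on {1..} s - (2 * s - 1) * (\<Sum>j<k.
        L j) + D * k))
         = \<kappa> powr (- s) * C * exp (?X k)"
        by (simp add: exp_add[symmetric] exp_diff[symmetric] algebra_simps)
      finally show "(\<Sum>w\<in>F. diameter (?V w) powr s) \<le> e" using k(1) by linarith
    qed (use s \<delta> bd in auto)
    then show ?thesis by simp
  qed
  then have "hausdorff_premeasure s \<delta> (upper_set \<kappa> K) \<le> 0" by (rule ennreal_le_epsilon)
  then show "hausdorff_premeasure s \<delta> (upper_set \<kappa> K) = 0" by (rule antisym) simp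
qed

text \<open>Just before the jump the sum is still about \<open>exp (L (k - 1))\<close>, at most the
  fraction \<open>exp (- \<rho>)\<close> of \<open>exp (L k)\<close>; the coefficient at
  \<open>N k\<close> has to supply the rest.\<close>

lemma asymp_sum_set_subset:
  "asymp_sum_set \<phi> \<subseteq> (\<Union>K. upper_set ((1 - exp (- \<rho>)) / 2) K)"
proof
  fix x assume x: "x \<in> asymp_sum_set \<phi>"
  \<comment> \<open>Now \<open>exp (- \<rho>) = 1 - 2 * \<kappa>\<close>, and knowing the sums up to
    relative error \<open>\<kappa> / 2\<close> leaves \<open>\<kappa> + \<kappa>\<^sup>2\<close> for
    the coefficient.\<close>
  define \<kappa> where "\<kappa> = (1 - exp (- \<rho>)) / 2"
  have \<kappa>: "0 < \<kappa>" "\<kappa> < 1" using \<rho> by (auto simp: \<kappa>_def less_imp_le intro: less_trans[of _ 0])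
  have u: "x \<in> unit_irrationals" and "(\<lambda>n. real (coeff_sum n x) / \<phi> n) \<longlonglongrightarrow> 1"
    using x by (auto simp: asymp_sum_set_def)
  then have "\<forall>\<^sub>F n in sequentially. dist (real (coeff_sum n x) / \<phi> n) 1 < \<kappa> / 2"
    using \<kappa> by (intro tendstoD) auto
  then obtain n0 where n0: "\<And>n. n \<ge> n0 \<Longrightarrow> \<bar>real (coeff_sum n x) / \<phi> n - 1\<bar> < \<kappa> / 2"
    by (auto simp: eventually_sequentially dist_real_def)
  have S: "(1 - \<kappa> / 2) * exp (L k) \<le> coeff_sum n x" "coeff_sum n x \<le> (1 + \<kappa> / 2) * exp (L k)"
    if "n \<ge> n0" "1 \<le> k" "N k \<le> n" "n < N (Suc k)" for n k
  proof -
    have "\<bar>real (coeff_sum n x) / exp (L k) - 1\<bar> < \<kappa> / 2" using n0[of n] \<phi>[of k n] that by simp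
    then have "1 - \<kappa> / 2 \<le> real (coeff_sum n x) / exp (L k)" "real (coeff_sum n x) / exp (L k) \<le> 1 + \<kappa> / 2"
      by argo+
    then show "(1 - \<kappa> / 2) * exp (L k) \<le> coeff_sum n x" "coeff_sum n x \<le> (1 + \<kappa> / 2) * exp (L k)"
      by (auto simp: pos_le_divide_eq pos_divide_le_eq)
  qed
  \<comment> \<open>The shift by 2 makes the predecessor of \<open>k\<close> positive, so that
    \<phi> is known at \<open>N k - 1\<close> too.\<close>
  have "x \<in> upper_set \<kappa> (n0 + 2)" unfolding upper_set_def
  proof (intro CollectI conjI u allI impI)
    fix k assume k: "n0 + 2 \<le> k"
    then obtain j where j: "k = Suc j" "n0 + 1 \<le> j" by (cases k) auto
    have kn: "N k \<ge> n0" "N k \<ge> 1" "N j \<le> N k - 1" "N k - 1 < N k" "N k - 1 \<ge> n0" "N k < N (Suc k)"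
      using N_ge[of k] k N_step[of j] N_step[of k] j by auto
    obtain m where "N k = Suc m" using kn(2) by (cases "N k") auto
    then have c: "coeff_sum (N k) x = coeff_sum (N k - 1) x + cf_coeff (N k) x"
      by (simp add: coeff_sum_def)
    have "coeff_sum (N k - 1) x \<le> (1 + \<kappa> / 2) * exp (L j)"
      by (rule S(2)) (use kn j in auto)
    also have "\<dots> \<le> (1 + \<kappa> / 2) * exp (L k - \<rho>)" using L_step[of j] \<kappa> j by (intro mult_left_mono) auto
    also have "exp (L k - \<rho>) = exp (L k) * (1 - 2 * \<kappa>)" by (simp add: \<kappa>_def exp_diff exp_minus field_simps)
    finally have up: "coeff_sum (N k - 1) x \<le> (1 + \<kappa> / 2) * (exp (L k) * (1 - 2 * \<kappa>))" .
    have lo: "(1 - \<kappa> / 2) * exp (L k) \<le> coeff_sum (N k) x" "coeff_sum (N k) x \<le> (1 + \<kappa> / 2) * exp (L k)"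
      using S[of "N k" k] kn k by auto
    have "(1 - \<kappa> / 2) * exp (L k) - (1 + \<kappa> / 2) * (exp (L k) * (1 - 2 * \<kappa>)) = (\<kappa> + \<kappa>\<^sup>2) * exp (L k)"
      by (simp add: field_simps power2_eq_square)
    moreover have "\<kappa> * exp (L k) \<le> (\<kappa> + \<kappa>\<^sup>2) * exp (L k)" by (intro mult_right_mono) auto
    ultimately show "\<kappa> * exp (L k) \<le> cf_coeff (N k) x" using up lo c by linarith
    have "(1 + \<kappa> / 2) * exp (L k) \<le> 2 * exp (L k)" using \<kappa> by (intro mult_right_mono) auto
    then show "cf_coeff (N k) x \<le> 2 * exp (L k)" using lo c by linarith
  qed
  then show "x \<in> (\<Union>K. upper_set ((1 - exp (- \<rho>)) / 2) K)" unfolding \<kappa>_def by blast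
qed

lemma asymp_sum_set_null:
  assumes s: "s > 1 / 2" and neg: "pressure_on {1..} s - (2 * s - 1) * \<alpha> - s * \<beta> < 0"
  shows "hausdorff_measure s (asymp_sum_set \<phi>) = 0"
proof (rule hausdorff_measure_null_subset[OF _ asymp_sum_set_subset])
  show "hausdorff_measure s (\<Union>K. upper_set ((1 - exp (- \<rho>)) / 2) K) = 0"
    by (rule hausdorff_measure_null_UN) (use upper_set_null[OF s _ neg] \<rho> in auto)
qed

end

section \<open>Lower bound: the Cantor set\<close>

text \<open>The tails after index \<open>i\<close> lie in an interval of length
  \<open>1 - h\<close>, so they can compensate at most \<open>1 - h\<close> of the difference of the
  digits; as this difference is at least 1, the fraction \<open>h\<close> of it survives. The common
  prefix then contracts distances by at most \<open>4 * q\<^sup>2\<close>, where \<open>q\<close> is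
  its denominator.\<close>

lemma cfval_separation:
  assumes d: "\<And>j. d j > 0" and e: "\<And>j. e j > 0"
    and agree: "\<And>j. j < i \<Longrightarrow> d j = e j" and ne: "d i \<noteq> e i"
    and td: "cfval (\<lambda>j. d (j + Suc i)) \<le> 1 - h" and te: "cfval (\<lambda>j. e (j + Suc i)) \<le> 1 - h"
    and h: "0 < h"
  shows "\<bar>cfval d - cfval e\<bar> \<ge> h * \<bar>real (d i) - real (e i)\<bar> /
     (4 * (real (den (map d [0..<i])))\<^sup>2 * ((real (d i) + 1) * (real (e i) + 1)))"
proof -
  let ?w = "map d [0..<i]"
  have we: "map e [0..<i] = ?w" using agree by auto
  have w: "0 \<notin> set ?w" using d by (metis ex_map_conv less_numeral_extra(3))
  define S where "S = cfval (\<lambda>j. d (j + Suc i))"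
  define T where "T = cfval (\<lambda>j. e (j + Suc i))"
  define a b where "a = real (d i)" and "b = real (e i)"
  have ST: "0 < S" "S < 1" "0 < T" "T < 1" unfolding S_def T_def
    using cfval_bounds[of "\<lambda>j. d (j + Suc i)", OF d] cfval_bounds[of "\<lambda>j. e (j + Suc i)", OF e] by auto
  have ab: "a \<ge> 1" "b \<ge> 1" using d[of i] e[of i] by (auto simp: a_def b_def)
  have x: "cfval d = ev ?w (1 / (a + S))"
    using cfval_ev[of d, OF d, of i] cfval_step[of "\<lambda>j. d (j + i)", OF d] by (simp add: S_def a_def)
  have y: "cfval e = ev ?w (1 / (b + T))"
    using cfval_ev[of e, OF e, of i] cfval_step[of "\<lambda>j. e (j + i)", OF e] by (simp add: T_def b_def we)
  have "\<bar>cfval d - cfval e\<bar> \<ge> \<bar>1 / (a + S) - 1 / (b + T)\<bar> / (4 * (real (den ?w))\<^sup>2)"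
    unfolding x y using ST ab by (intro abs_ev_diff_ge w) auto
  moreover have "\<bar>1 / (a + S) - 1 / (b + T)\<bar> \<ge> h * \<bar>a - b\<bar> / ((a + 1) * (b + 1))"
  proof -
    have p: "a + S > 0" "b + T > 0" using ab ST by auto
    have ab1: "\<bar>a - b\<bar> \<ge> 1" using ne by (auto simp: a_def b_def)
    have "\<bar>S - T\<bar> \<le> 1 - h" using td te ST unfolding S_def[symmetric] T_def[symmetric] by linarith
    then have "\<bar>(b + T) - (a + S)\<bar> \<ge> \<bar>a - b\<bar> - (1 - h)" by linarith
    moreover have "(1 - h) * 1 \<le> (1 - h) * \<bar>a - b\<bar>"
      using ab1 td ST unfolding S_def[symmetric] by (intro mult_left_mono) auto
    ultimately have num: "\<bar>(b + T) - (a + S)\<bar> \<ge> h * \<bar>a - b\<bar>" by (simp add: algebra_simps)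
    have "1 / (a + S) - 1 / (b + T) = ((b + T) - (a + S)) / ((a + S) * (b + T))"
      using p by (simp add: field_simps)
    then have "\<bar>1 / (a + S) - 1 / (b + T)\<bar> = \<bar>(b + T) - (a + S)\<bar> / ((a + S) * (b + T))"
      using p by (simp add: abs_mult)
    also have "\<dots> \<ge> h * \<bar>a - b\<bar> / ((a + 1) * (b + 1))"
      using num p ab ST h by (intro frac_le mult_mono) auto
    finally show ?thesis .
  qed
  then have "h * \<bar>a - b\<bar> / ((a + 1) * (b + 1)) / (4 * (real (den ?w))\<^sup>2)
      \<le> \<bar>1 / (a + S) - 1 / (b + T)\<bar> / (4 * (real (den ?w))\<^sup>2)" by (rule divide_right_mono) simp
  ultimately show ?thesis unfolding a_def b_def by (simp add: mult.commute)
qed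

text \<open>A first digit at least 2 gives a value at most 1/2. After a first digit 1 the rest is at
  least \<open>1 / (M + 1)\<close>, and
  \<open>1 / (1 + 1 / (M + 1)) = 1 - 1 / (M + 2)\<close>.\<close>

lemma cfval_tail_le:
  assumes d: "\<And>j. d j > 0" and M: "d 0 = 1 \<Longrightarrow> d 1 \<le> M"
  shows "cfval d \<le> 1 - 1 / (real M + 2)"
proof -
  let ?e = "\<lambda>j. d (Suc j)" and ?f = "\<lambda>j. d (Suc (Suc j))"
  have x: "cfval d = 1 / (real (d 0) + cfval ?e)" by (rule cfval_step) (rule d)
  have y: "cfval ?e = 1 / (real (d 1) + cfval ?f)" using cfval_step[of ?e, OF d] by simp
  have b: "0 < cfval ?e" "0 < cfval ?f" "cfval ?f < 1" using cfval_bounds[of ?e, OF d] cfval_bounds[of ?f,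
    OF d] by auto
  show ?thesis
  proof (cases "d 0 = 1")
    case True
    have "1 / (real M + 1) \<le> cfval ?e" unfolding y
      using M[OF True] b d[of 1] by (intro divide_left_mono) auto
    then have "cfval d \<le> 1 / (1 + 1 / (real M + 1))" unfolding x True using b
      by (intro divide_left_mono) (auto intro!: mult_pos_pos add_pos_pos)
    also have "\<dots> = 1 - 1 / (real M + 2)" by (simp add: field_simps)
    finally show ?thesis .
  next
    case False
    then have "real (d 0) \<ge> 2" using d[of 0] by simp
    then have "cfval d \<le> 1 / 2" unfolding x using b by (intro divide_left_mono) auto
    also have "1 / 2 \<le> 1 - 1 / (real M + 2)" by (simp add: field_simps)
    finally show ?thesis .
  qed
qed

text \<open>Here \<open>s\<close> is the exponent of the Frostman estimate, and \<open>gap\<close>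
  being strict leaves a margin exponential in \<open>N k\<close>.\<close>

locale jumps_lower = jumps +
  fixes s :: real and M :: nat
  assumes s: "1 / 2 < s" "s \<le> 1" and M: "2 \<le> M"
    and gap: "(2 * s - 1) * \<alpha> + s * \<beta> < pressure_on {1..M} s"
begin

text \<open>Increments of \<phi> rather than its values: the coefficients at all earlier jumps count
  as well, and the increments telescope to \<open>exp (L k)\<close> in \<open>sum_D\<close>.\<close>

definition D :: "nat \<Rightarrow> real" where
  "D k = exp (L k) - (if k = 0 then 0 else exp (L (k - 1)))"

text \<open>Starting at \<open>D k\<close> rounded up makes the error one-sided: the coefficient
  sums never fall below \<open>exp (L k)\<close>.\<close>

definition win :: "nat \<Rightarrow> nat set" where
  "win k = {nat \<lceil>D k\<rceil>..nat \<lceil>D k\<rceil> + nat \<lfloor>D k / (real k + 1)\<rfloor>}"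

text \<open>Number of free letters in block \<open>k\<close>; its other two letters are the leading
  2 and the window coefficient.\<close>

definition gl :: "nat \<Rightarrow> nat" where
  "gl k = N (Suc k) - N k - 2"

definition blocks :: "nat \<Rightarrow> (nat \<times> nat list) set" where
  "blocks k = win k \<times> words {1..M} (gl k)"

text \<open>
  The leading 2 (at position \<open>N k - 1\<close>, just before the window) ensures that a coefficient 1 is
  followed by a coefficient \<open>\<le> M\<close>.  So all tails stay away from 1, where the cylinders of adjacent
  coefficients touch.
\<close>

definition bw :: "nat \<times> nat list \<Rightarrow> nat list" where
  "bw x = 2 # fst x # snd x"

definition cat :: "(nat \<Rightarrow> nat \<times> nat list) \<Rightarrow> nat \<Rightarrow> nat list" where
  "cat p k = concat (map (\<lambda>j. bw (p j)) [0..<k])"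

text \<open>Every block has at least two letters, so \<open>Suc i\<close> blocks reach beyond index
  \<open>i\<close>. Digits count from 0, so digit \<open>N k - 1\<close> is the coefficient number
  \<open>N k\<close>.\<close>

definition digit :: "(nat \<Rightarrow> nat \<times> nat list) \<Rightarrow> nat \<Rightarrow> nat" where
  "digit p i = cat p (Suc i) ! i"

definition \<Omega> :: "(nat \<Rightarrow> nat \<times> nat list) set" where
  "\<Omega> = {p. \<forall>k. p k \<in> blocks k}"

definition \<eta> :: real where "\<eta> = 1 - exp (- \<rho>)"

lemma \<eta>: "0 < \<eta>" "\<eta> < 1"
  using \<rho> by (auto simp: \<eta>_def)

lemma D_ge: "\<eta> * exp (L k) \<le> D k"
proof (cases k)
  case 0
  have "\<eta> * exp (L 0) \<le> 1 * exp (L 0)" using \<eta> by (intro mult_right_mono) auto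
  then show ?thesis using 0 by (simp add: D_def)
next
  case (Suc j)
  have "exp (L j) \<le> exp (L k - \<rho>)" using L_step[of j] Suc by simp
  then show ?thesis using Suc by (simp add: D_def \<eta>_def exp_diff exp_minus field_simps)
qed

lemma D_pos: "0 < D k"
  using D_ge[of k] \<eta> by (meson exp_gt_zero less_le_trans mult_pos_pos)

lemma D_le: "D k \<le> exp (L k)"
  by (simp add: D_def)

lemma sum_D: "(\<Sum>j\<le>k. D j) = exp (L k)"
  by (induction k) (auto simp: D_def)

lemma win_bounds:
  assumes "a \<in> win k"
  shows "D k \<le> a" "a \<le> D k + 1 + D k / (real k + 1)" "1 \<le> a" "a \<le> 3 * exp (L k)"
proof -
  have c: "real (nat \<lceil>D k\<rceil>) = of_int \<lceil>D k\<rceil>" "real (nat \<lfloor>D k / (real k + 1)\<rfloor>) = of_int \<lfloor>D k / (real k + 1)\<rfloor>"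
    using D_pos[of k] by (auto intro!: of_nat_nat simp: less_imp_le)
  have a: "of_int \<lceil>D k\<rceil> \<le> real a" "real a \<le> of_int \<lceil>D k\<rceil> + of_int \<lfloor>D k / (real k + 1)\<rfloor>"
    using assms unfolding win_def c[symmetric] atLeastAtMost_iff of_nat_add[symmetric] of_nat_le_iff by auto
  show 1: "D k \<le> a" using a by linarith
  show 2: "a \<le> D k + 1 + D k / (real k + 1)" using a by linarith
  show "1 \<le> a" using 1 D_pos[of k] by (cases a) auto
  have "D k / (real k + 1) \<le> D k / 1" using D_pos[of k] by (intro divide_left_mono) auto
  moreover have "1 \<le> exp (L k)" using L_nonneg by simp
  ultimately show "a \<le> 3 * exp (L k)" using 2 D_le[of k] by linarith
qed

lemma finite_win: "finite (win k)" and card_win: "D k / (real k + 1) \<le> real (card (win k))"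
proof -
  show "finite (win k)" by (simp add: win_def)
  have "real (nat \<lfloor>D k / (real k + 1)\<rfloor>) = of_int \<lfloor>D k / (real k + 1)\<rfloor>"
    using D_pos[of k] by (intro of_nat_nat) (simp add: less_imp_le)
  then show "D k / (real k + 1) \<le> real (card (win k))" unfolding win_def by simp linarith
qed

lemma card_win_ge: "\<eta> * exp (L k) / (real k + 1) \<le> real (card (win k))"
proof -
  have "\<eta> * exp (L k) / (real k + 1) \<le> D k / (real k + 1)" using D_ge by (intro divide_right_mono) auto
  then show ?thesis using card_win[of k] by linarith
qed

lemma card_win_pos: "0 < real (card (win k))"
proof -
  have "0 < \<eta> * exp (L k) / (real k + 1)" using \<eta> by simp
  then show ?thesis using card_win_ge[of k] by linarith
qed

lemma gl: "gl k + 2 = N (Suc k) - N k" "N (Suc k) - 2 = N k - 2 + (gl k + 2)"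
  using N_step[of k] N_ge[of k] by (auto simp: gl_def)

section \<open>Position of the digits within the blocks\<close>

lemma length_bw: "x \<in> blocks k \<Longrightarrow> length (bw x) = gl k + 2"
  by (auto simp: bw_def blocks_def words_def)

lemma cat_0: "cat p 0 = []"
  and cat_Suc: "cat p (Suc k) = cat p k @ bw (p k)"
  by (auto simp: cat_def)

lemma length_cat: "p \<in> \<Omega> \<Longrightarrow> length (cat p k) = N k - 2"
proof (induction k)
  case (Suc k)
  then have "length (bw (p k)) = gl k + 2" using length_bw by (auto simp: \<Omega>_def)
  then show ?case using Suc gl(2)[of k] by (simp add: cat_Suc)
qed (simp add: cat_0 N_0)

lemma cat_prefix: "j \<le> k \<Longrightarrow> \<exists>z. cat p k = cat p j @ z"
  by (induction k rule: dec_induct) (auto simp: cat_Suc)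

lemma digit_cat:
  assumes "p \<in> \<Omega>" "i < N k - 2"
  shows "digit p i = cat p k ! i"
proof -
  have i: "i < length (cat p (Suc i))" "i < length (cat p k)"
    using length_cat[OF assms(1)] N_ge[of "Suc i"] assms(2) by auto
  consider "Suc i \<le> k" | "k \<le> Suc i" by linarith
  then show ?thesis
  proof cases
    case 1
    then obtain z where "cat p k = cat p (Suc i) @ z" using cat_prefix by blast
    then show ?thesis using i by (simp add: digit_def nth_append)
  next
    case 2
    then obtain z where "cat p (Suc i) = cat p k @ z" using cat_prefix by blast
    then show ?thesis using i by (simp add: digit_def nth_append)
  qed
qed

lemma map_digit_cat: "p \<in> \<Omega> \<Longrightarrow> map (digit p) [0..<N k - 2] = cat p k"
  by (rule nth_equalityI) (auto simp: length_cat digit_cat)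

lemma digit_block:
  assumes "p \<in> \<Omega>" "j < gl k + 2"
  shows "digit p (N k - 2 + j) = bw (p k) ! j"
proof -
  have "digit p (N k - 2 + j) = cat p (Suc k) ! (N k - 2 + j)"
    using assms gl(2)[of k] by (intro digit_cat) auto
  then show ?thesis using length_cat[OF assms(1), of k] by (simp add: cat_Suc nth_append)
qed

lemma map_digit_block:
  assumes "p \<in> \<Omega>" "j \<le> gl k + 2"
  shows "map (digit p) [0..<N k - 2 + j] = cat p k @ take j (bw (p k))"
proof -
  have "p k \<in> blocks k" using assms by (auto simp: \<Omega>_def)
  then have l: "length (bw (p k)) = gl k + 2" by (rule length_bw)
  have t: "map (digit p) [N k - 2..<N k - 2 + j] = take j (bw (p k))"
  proof (rule nth_equalityI)
    fix i assume "i < length (map (digit p) [N k - 2..<N k - 2 + j])"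
    then have i: "i < j" by simp
    then show "map (digit p) [N k - 2..<N k - 2 + j] ! i = take j (bw (p k)) ! i"
      using digit_block[OF assms(1), of i k] assms(2) by simp
  qed (use l assms(2) in simp)
  show ?thesis using map_digit_cat[OF assms(1), of k] t unfolding upt_add_eq_append[of 0 "N k - 2" j, OF
    le0] by simp
qed

lemma block_index: "\<exists>k j. i = N k - 2 + j \<and> j < gl k + 2"
proof (induction i)
  case 0
  show ?case by (intro exI[of _ 0]) (simp add: N_0)
next
  case (Suc i)
  then obtain k j where kj: "i = N k - 2 + j" "j < gl k + 2" by blast
  show ?case
  proof (cases "Suc j < gl k + 2")
    case True
    then show ?thesis using kj by (intro exI[of _ k] exI[of _ "Suc j"]) auto
  next
    case False
    then show ?thesis using kj gl(2)[of k] by (intro exI[of _ "Suc k"] exI[of _ 0]) auto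
  qed
qed

lemma \<Omega>_block: "p \<in> \<Omega> \<Longrightarrow> fst (p k) \<in> win k \<and> snd (p k) \<in> words {1..M} (gl k)"
  unfolding \<Omega>_def blocks_def mem_Times_iff[symmetric] by simp

lemma digit_start: "p \<in> \<Omega> \<Longrightarrow> digit p (N k - 2) = 2"
  using digit_block[of p 0 k] by (simp add: bw_def)

lemma digit_window: "p \<in> \<Omega> \<Longrightarrow> digit p (N k - 1) = fst (p k)"
  using digit_block[of p 1 k] N_ge[of k] by (simp add: bw_def Suc_diff_Suc numeral_2_eq_2)

lemma digit_gap:
  assumes "p \<in> \<Omega>" "j < gl k"
  shows "digit p (N k + j) \<in> {1..M}"
proof -
  have "digit p (N k - 2 + (j + 2)) = snd (p k) ! j" using digit_block[of p "j + 2" k] assms by (simp add: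
    bw_def)
  moreover have "N k - 2 + (j + 2) = N k + j" using N_ge[of k] by linarith
  moreover have "snd (p k) ! j \<in> set (snd (p k))"
    using \<Omega>_block[OF assms(1), of k] assms(2) by (intro nth_mem) (auto simp: words_def)
  moreover have "set (snd (p k)) \<subseteq> {1..M}" using \<Omega>_block[OF assms(1), of k] by (simp add: words_def)
  ultimately show ?thesis by (metis subsetD)
qed

lemma index_cases:
  obtains k where "i = N k - 2" | k where "i = N k - 1" | k j where "i = N k + j" "j < gl k"
proof -
  obtain k j where kj: "i = N k - 2 + j" "j < gl k + 2" using block_index by blast
  consider "j = 0" | "j = 1" | m where "j = m + 2" by (metis One_nat_def Suc_1 add.commute add_2_eq_Suc
    not0_implies_Suc)
  then show ?thesis
  proof cases
    case 1 then show ?thesis using that(1) kj by simp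
  next
    case 2
    then have "i = N k - 1" using kj N_ge[of k] by linarith
    then show ?thesis using that(2) by simp
  next
    case 3
    then have "i = N k + m" "m < gl k" using kj N_ge[of k] by linarith+
    then show ?thesis using that(3) by simp
  qed
qed

lemma digit_nonwindow:
  assumes "p \<in> \<Omega>" "\<And>k. i \<noteq> N k - 1"
  shows "digit p i \<le> M"
proof (cases i rule: index_cases)
  case (1 k)
  then show ?thesis using digit_start[OF assms(1), of k] M by simp
next
  case (2 k)
  then show ?thesis using assms(2)[of k] by simp
next
  case (3 k j)
  then show ?thesis using digit_gap[OF assms(1), of j k] by simp
qed

lemma digit_pos: assumes "p \<in> \<Omega>" shows "0 < digit p i"
proof (cases i rule: index_cases)
  case (1 k)
  then show ?thesis using digit_start[OF assms(1), of k] by simp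
next
  case (2 k)
  have "1 \<le> fst (p k)" using \<Omega>_block[OF assms, of k] win_bounds(3) by blast
  then show ?thesis using digit_window[OF assms(1), of k] 2 by simp
next
  case (3 k j)
  then show ?thesis using digit_gap[OF assms(1), of j k] by simp
qed

lemma digit_tame:
  assumes "p \<in> \<Omega>" "digit p i = 1"
  shows "digit p (Suc i) \<le> M"
proof (rule digit_nonwindow[OF assms(1)])
  fix k show "Suc i \<noteq> N k - 1"
  proof
    assume "Suc i = N k - 1"
    then have "i = N k - 2" by linarith
    then show False using digit_start[OF assms(1), of k] assms(2) by simp
  qed
qed

section \<open>Growth of the coefficient sums and separation of the values\<close>

definition val :: "(nat \<Rightarrow> nat \<times> nat list) \<Rightarrow> real" where
  "val p = cfval (digit p)"

lemma digit_sum_bounds: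
  assumes p: "p \<in> \<Omega>" and n: "N k \<le> n" "n < N (Suc k)"
  shows "(\<Sum>j\<le>k. fst (p j)) \<le> (\<Sum>i<n. digit p i)" "(\<Sum>i<n. digit p i) \<le> (\<Sum>j\<le>k. fst (p j)) + M * n"
proof -
  let ?w = "(\<lambda>j. N j - 1) ` {..k}"
  have inj: "inj_on (\<lambda>j. N j - 1) {..k}"
    by (rule inj_onI) (rule N_inj)
  have sub: "?w \<subseteq> {..<n}"
  proof
    fix i assume "i \<in> ?w"
    then obtain j where "j \<le> k" "i = N j - 1" by auto
    then show "i \<in> {..<n}" using N_mono[of j k] n N_pos[of j] by auto
  qed
  have "(\<Sum>i<n. digit p i) = sum (digit p) ({..<n} - ?w) + sum (digit p) ?w"
    by (rule sum.subset_diff[OF sub]) simp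
  also have "sum (digit p) ?w = (\<Sum>j\<le>k. fst (p j))"
    unfolding sum.reindex[OF inj] o_def digit_window[OF p] ..
  finally have e: "(\<Sum>i<n. digit p i) = sum (digit p) ({..<n} - ?w) + (\<Sum>j\<le>k. fst (p j))" .
  then show "(\<Sum>j\<le>k. fst (p j)) \<le> (\<Sum>i<n. digit p i)" by simp
  have "sum (digit p) ({..<n} - ?w) \<le> (\<Sum>i\<in>{..<n} - ?w. M)"
  proof (rule sum_mono)
    fix i assume i: "i \<in> {..<n} - ?w"
    show "digit p i \<le> M"
    proof (rule digit_nonwindow[OF p])
      fix j show "i \<noteq> N j - 1"
      proof
        assume ij: "i = N j - 1"
        then have "\<not> j \<le> k" using i by auto
        then have "N (Suc k) \<le> N j" by (intro N_mono) auto
        then show False using ij i n by auto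
      qed
    qed
  qed
  also have "\<dots> \<le> n * M" using card_mono[of "{..<n}" "{..<n} - ?w"] by (simp add: mult_le_mono1)
  finally show "(\<Sum>i<n. digit p i) \<le> (\<Sum>j\<le>k. fst (p j)) + M * n" using e by (simp add: mult.commute)
qed

text \<open>A weighted mean of \<open>1 / (j + 1)\<close> with weights \<open>D j\<close> of total
  \<open>exp (L k)\<close>: indices up to \<open>J\<close> contribute at most the fixed amount
  \<open>exp (L J)\<close>, later ones at most \<open>exp (L k) / (J + 1)\<close>.\<close>

lemma window_error: "(\<lambda>k. (\<Sum>j\<le>k. D j / (real j + 1)) / exp (L k)) \<longlonglongrightarrow> 0"
proof (rule tendstoI)
  fix e :: real assume e: "e > 0"
  obtain J :: nat where "2 / e < real J" using reals_Archimedean2 by blast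
  then have J: "1 / (real J + 1) < e / 2" using e by (simp add: field_simps)
  have b: "(\<Sum>j\<le>k. D j / (real j + 1)) \<le> exp (L J) + exp (L k) * (1 / (real J + 1))" for k
  proof -
    have "(\<Sum>j\<le>k. D j / (real j + 1)) \<le> (\<Sum>j\<le>k. (if j \<le> J then D j else 0) + D j * (1 / (real J + 1)))"
    proof (rule sum_mono)
      fix j
      show "D j / (real j + 1) \<le> (if j \<le> J then D j else 0) + D j * (1 / (real J + 1))"
      proof (cases "j \<le> J")
        case True
        have "D j / (real j + 1) \<le> D j / 1" using D_pos[of j] by (intro divide_left_mono) auto
        moreover have "0 \<le> D j * (1 / (real J + 1))" using D_pos[of j] by simp
        ultimately show ?thesis using True by simp
      next
        case False
        then have "D j / (real j + 1) \<le> D j / (real J + 1)" using D_pos[of j] by (intro divide_left_mono) auto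
        then show ?thesis using False by simp
      qed
    qed
    also have "\<dots> = (\<Sum>j\<le>k. (if j \<le> J then D j else 0)) + exp (L k) * (1 / (real J + 1))"
      unfolding sum.distrib sum_distrib_right[symmetric] sum_D ..
    also have "(\<Sum>j\<le>k. (if j \<le> J then D j else 0)) = (\<Sum>j\<in>{..k} \<inter> {..J}. D j)"
      by (subst sum.inter_restrict) auto
    also have "\<dots> \<le> (\<Sum>j\<le>J. D j)" using D_pos by (intro sum_mono2) (auto simp: less_imp_le)
    finally show ?thesis unfolding sum_D by simp
  qed
  have "(\<lambda>k. exp (L J) * exp (- L k)) \<longlonglongrightarrow> exp (L J) * 0"
    by (intro tendsto_intros filterlim_compose[OF exp_at_bot] filterlim_compose[OF
      filterlim_uminus_at_bot_at_top L_at_top])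
  then have "\<forall>\<^sub>F k in sequentially. exp (L J) * exp (- L k) < e / 2"
    by (rule order_tendstoD) (use e in simp)
  then show "\<forall>\<^sub>F k in sequentially. dist ((\<Sum>j\<le>k. D j / (real j + 1)) / exp (L k)) 0 < e"
  proof eventually_elim
    case (elim k)
    have "(\<Sum>j\<le>k. D j / (real j + 1)) / exp (L k) \<le> (exp (L J) + exp (L k) * (1 / (real J + 1))) / exp (L k)"
      by (intro divide_right_mono b) auto
    also have "\<dots> = exp (L J) * exp (- L k) + 1 / (real J + 1)" by (simp add: exp_minus field_simps)
    also have "\<dots> < e" using elim J by linarith
    moreover have "0 \<le> (\<Sum>j\<le>k. D j / (real j + 1)) / exp (L k)"
      using D_pos by (intro divide_nonneg_nonneg sum_nonneg) (auto simp: less_imp_le)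
    ultimately show ?case by (simp add: dist_real_def)
  qed
qed

lemma val_in_asymp_sum_set:
  assumes p: "p \<in> \<Omega>"
  shows "val p \<in> asymp_sum_set \<phi>"
proof -
  have pos: "\<And>i. 0 < digit p i" by (rule digit_pos[OF p])
  have cs: "coeff_sum n (val p) = (\<Sum>i<n. digit p i)" for n
  proof -
    have "coeff_sum n (val p) = (\<Sum>k<n. cf_coeff (Suc k) (val p))"
      unfolding coeff_sum_def by (simp add: sum.atLeast1_atMost_eq)
    then show ?thesis by (simp add: val_def cf_coeff_cfval[of "digit p", OF pos])
  qed
  \<comment> \<open>The factor \<open>M + 1\<close> covers the digits outside the windows, at most
    \<open>M\<close> each, and the \<open>k + 1\<close> roundings up; the second term is the total
    length of the windows.\<close>
  define err where "err k = (real M + 1) * (N (Suc k) / exp (L k)) + (\<Sum>j\<le>k. D j / (real j + 1)) / exp (L k)"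
    for k
  have "err \<longlonglongrightarrow> (real M + 1) * 0 + 0" unfolding err_def
    by (intro tendsto_intros fast window_error)
  then have err: "err \<longlonglongrightarrow> 0" by simp
  have b: "\<bar>coeff_sum n (val p) / \<phi> n - 1\<bar> \<le> err k" if n: "1 \<le> k" "N k \<le> n" "n < N (Suc k)" for k n
  proof -
    have ph: "\<phi> n = exp (L k)" using \<phi> n by simp
    have "(\<Sum>j\<le>k. D j) \<le> (\<Sum>j\<le>k. real (fst (p j)))"
      using \<Omega>_block[OF p] win_bounds(1) by (intro sum_mono) blast
    also have "\<dots> \<le> coeff_sum n (val p)" unfolding cs using digit_sum_bounds(1)[OF p n(2,3)]
      by (metis of_nat_le_iff of_nat_sum)
    finally have lo: "exp (L k) \<le> coeff_sum n (val p)" by (simp add: sum_D)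
    have "coeff_sum n (val p) \<le> (\<Sum>j\<le>k. real (fst (p j))) + M * n" unfolding cs
      using digit_sum_bounds(2)[OF p n(2,3)] by (metis of_nat_add of_nat_le_iff of_nat_sum)
    also have "(\<Sum>j\<le>k. real (fst (p j))) \<le> (\<Sum>j\<le>k. D j + 1 + D j / (real j + 1))"
      using \<Omega>_block[OF p] win_bounds(2) by (intro sum_mono) blast
    also have "\<dots> = exp (L k) + (real k + 1) + (\<Sum>j\<le>k. D j / (real j + 1))"
      by (simp add: sum.distrib sum_D)
    finally have "coeff_sum n (val p) \<le> exp (L k) + (real k + 1) + (\<Sum>j\<le>k. D j / (real j + 1)) + M * n" by simp
    moreover have "k + 1 \<le> N (Suc k)" using N_ge[of "Suc k"] by simp
    then have "real k + 1 \<le> N (Suc k)" by linarith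
    moreover have "real (M * n) \<le> M * real (N (Suc k))" using n(3) by (simp add: mult_left_mono)
    ultimately have "coeff_sum n (val p) \<le> exp (L k) + (real M + 1) * N (Suc k) + (\<Sum>j\<le>k. D j / (real j + 1))"
      by (simp add: algebra_simps)
    also have "\<dots> = exp (L k) * (1 + err k)" by (simp add: err_def field_simps)
    finally have "coeff_sum n (val p) / exp (L k) \<le> 1 + err k" by (simp add: pos_divide_le_eq mult.commute)
    moreover have "1 \<le> coeff_sum n (val p) / exp (L k)" using lo by (simp add: pos_le_divide_eq)
    ultimately show ?thesis unfolding ph by linarith
  qed
  have "(\<lambda>n. real (coeff_sum n (val p)) / \<phi> n) \<longlonglongrightarrow> 1"
  proof (rule tendstoI)
    fix e :: real assume "e > 0"
    then have "\<forall>\<^sub>F k in sequentially. err k < e" using err by (intro order_tendstoD(2)[OF err])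
    then obtain K where K: "\<And>k. k \<ge> K \<Longrightarrow> err k < e" unfolding eventually_sequentially by blast
    show "\<forall>\<^sub>F n in sequentially. dist (real (coeff_sum n (val p)) / \<phi> n) 1 < e"
      unfolding eventually_sequentially
    proof (intro exI allI impI)
      fix n assume n: "n \<ge> N (Suc K)"
      \<comment> \<open>Shifted by 2 because block \<open>k\<close> starts at index
        \<open>N k - 2\<close>.\<close>
      obtain k j where kj: "n - 2 = N k - 2 + j" "j < gl k + 2" using block_index by blast
      have "n \<ge> 2" using n N_ge[of "Suc K"] by linarith
      then have nk: "N k \<le> n" "n < N (Suc k)" using kj gl(1)[of k] N_ge[of k] N_step[of k] by linarith+
      have "\<not> Suc k \<le> Suc K" using N_mono[of "Suc k" "Suc K"] n nk by linarith
      then have "k \<ge> K" "1 \<le> k" by auto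
      then show "dist (real (coeff_sum n (val p)) / \<phi> n) 1 < e"
        using b[OF _ nk] K[of k] by (force simp: dist_real_def)
    qed
  qed
  then show ?thesis using cfval_unit_irrationals[of "digit p", OF pos] by (simp add: asymp_sum_set_def val_def)
qed

definition h :: real where "h = 1 / (real M + 2)"

lemma h_pos: "0 < h"
  by (simp add: h_def)

lemma val_separation:
  assumes w: "p \<in> \<Omega>" "p' \<in> \<Omega>" and agree: "\<And>j. j < i \<Longrightarrow> digit p j = digit p' j" and ne: "digit p i \<noteq> digit p' i"
  shows "h * \<bar>real (digit p i) - real (digit p' i)\<bar> /
     (4 * (real (den (map (digit p) [0..<i])))\<^sup>2 * ((real (digit p i) + 1) * (real (digit p' i) + 1))) \<le>
       \<bar>val p - val p'\<bar>"
proof -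
  have t: "cfval (\<lambda>j. digit p (j + Suc i)) \<le> 1 - h" if "p \<in> \<Omega>" for p
    unfolding h_def by (rule cfval_tail_le) (use digit_pos[OF that] digit_tame[OF that, of "Suc i"] in auto)
  show ?thesis unfolding val_def
    by (rule cfval_separation[OF digit_pos[OF w(1)] digit_pos[OF w(2)] agree ne t[OF w(1)] t[OF w(2)] h_pos])
qed

end

section \<open>Lower bound: the product measure\<close>

lemma at_bot_imp_bdd_above:
  fixes X :: "nat \<Rightarrow> real"
  assumes "filterlim X at_bot sequentially"
  shows "\<exists>H. \<forall>k. X k \<le> H"
proof -
  have "\<forall>\<^sub>F k in sequentially. X k \<le> 0" using assms by (simp add: filterlim_at_bot)
  then obtain K where K: "\<And>k. k \<ge> K \<Longrightarrow> X k \<le> 0" unfolding eventually_sequentially by blast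
  have "X k \<le> Max (insert 0 (X ` {..<K}))" for k
  proof (cases "k < K")
    case True
    then show ?thesis by (intro Max_ge) auto
  next
    case False
    then have "X k \<le> 0" using K by simp
    also have "0 \<le> Max (insert 0 (X ` {..<K}))" by (intro Max_ge) auto
    finally show ?thesis .
  qed
  then show ?thesis by blast
qed

context jumps_lower
begin

definition b :: real where "b = pressure_on {1..M} s"

lemma alphabet: "{1..M} \<subseteq> {1..}" "{1..M} \<noteq> {}"
  using M by auto

lemma s_half: "s > 1/2" by (rule s)

lemma b_pos: "0 < b"
proof -
  have "0 \<le> \<alpha>"
    by (rule LIMSEQ_le_const[OF lim_\<alpha>]) (auto intro!: divide_nonneg_nonneg sum_nonneg L_nonneg)
  moreover have "0 \<le> \<beta>"
    by (rule LIMSEQ_le_const[OF lim_\<beta>]) (auto intro!: divide_nonneg_nonneg L_nonneg)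
  ultimately have "0 \<le> (2 * s - 1) * \<alpha> + s * \<beta>" using s by (intro add_nonneg_nonneg mult_nonneg_nonneg) auto
  then show ?thesis using gap by (simp add: b_def)
qed

abbreviation ZM :: "nat \<Rightarrow> real" where "ZM n \<equiv> Z {1..M} n s"

lemma ZM_pos: "0 < ZM n"
  by (rule Z_pos[OF s_half alphabet])

lemma ZM_ge: "4 powr (- s) * exp (n * b) \<le> ZM n"
  unfolding b_def by (rule Z_bounds(2)[OF s_half alphabet])

lemma finite_words: "finite (words {1..M} n)"
proof -
  have "words {1..M} n = {w. set w \<subseteq> {1..M} \<and> length w = n}" by (auto simp: words_def)
  then show ?thesis by (simp add: finite_lists_length_eq)
qed

lemma ZM_eq: "ZM n = (\<Sum>w\<in>words {1..M} n. wt s w)"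
  using finite_words by (simp add: Z_def)

lemma finite_blocks: "finite (blocks k)"
  unfolding blocks_def using finite_win finite_words by simp

definition mass :: "nat \<Rightarrow> nat \<times> nat list \<Rightarrow> real" where
  "mass k x = wt s (snd x) / (ZM (gl k) * card (win k))"

lemma mass_nonneg: "0 \<le> mass k x"
  using ZM_pos[of "gl k"] by (simp add: mass_def wt_nonneg)

lemma sum_mass:
  assumes "S \<subseteq> win k" "T \<subseteq> words {1..M} (gl k)"
  shows "sum (mass k) (S \<times> T) = card S / card (win k) * (sum (wt s) T / ZM (gl k))"
proof -
  have "sum (mass k) (S \<times> T) = (\<Sum>a\<in>S. \<Sum>v\<in>T. mass k (a, v))"
    by (simp add: sum.cartesian_product)
  also have "\<dots> = (\<Sum>a\<in>S. \<Sum>v\<in>T. wt s v / (ZM (gl k) * card (win k)))"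
    by (simp add: mass_def)
  also have "\<dots> = card S * (sum (wt s) T / (ZM (gl k) * card (win k)))"
    by (simp add: sum_divide_distrib)
  finally show ?thesis by simp
qed

definition Mk :: "nat \<Rightarrow> (nat \<times> nat list) measure" where
  "Mk k = point_measure (blocks k) (\<lambda>x. ennreal (mass k x))"

lemma emeasure_Mk: "X \<subseteq> blocks k \<Longrightarrow> emeasure (Mk k) X = ennreal (sum (mass k) X)"
  unfolding Mk_def using finite_blocks by (simp add: emeasure_point_measure_finite mass_nonneg)

lemma space_Mk: "space (Mk k) = blocks k" and sets_Mk: "sets (Mk k) = Pow (blocks k)"
  by (auto simp: Mk_def space_point_measure sets_point_measure)

lemma sum_mass_1: "sum (mass k) (blocks k) = 1"
  unfolding blocks_def sum_mass[OF subset_refl subset_refl] ZM_eq[symmetric]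
  using card_win_pos[of k] ZM_pos[of "gl k"] by simp

lemma prob_space_Mk: "prob_space (Mk k)"
  by (rule prob_spaceI) (simp add: space_Mk emeasure_Mk sum_mass_1)

definition PM :: "(nat \<Rightarrow> nat \<times> nat list) measure" where
  "PM = PiM UNIV Mk"

lemma prob_space_PM: "prob_space PM"
  unfolding PM_def by (intro prob_space_PiM prob_space_Mk)

lemma space_PM: "space PM = \<Omega>"
  by (auto simp: PM_def space_PiM space_Mk \<Omega>_def)

text \<open>Every ball will be enclosed in such a set: the blocks before \<open>k\<close> are
  determined and \<open>X\<close> records what is known about block \<open>k\<close>.\<close>

definition event :: "(nat \<Rightarrow> nat \<times> nat list) \<Rightarrow> nat \<Rightarrow> (nat \<times> nat list) set \<Rightarrow> (nat \<Rightarrow> nat \<times> nat list) set" where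
  "event p0 k X = {p \<in> \<Omega>. (\<forall>j<k. p j = p0 j) \<and> p k \<in> X}"

lemma event:
  assumes p0: "p0 \<in> \<Omega>" and X: "X \<subseteq> blocks k"
  shows "event p0 k X \<in> sets PM"
    and "emeasure PM (event p0 k X) = ennreal ((\<Prod>j<k. mass j (p0 j)) * sum (mass k) X)"
proof -
  define F where "F j = (if j < k then {p0 j} else X)" for j
  have F: "F j \<subseteq> blocks j" if "j \<in> {..k}" for j
    using that p0 X by (auto simp: F_def \<Omega>_def)
  have e: "event p0 k X = prod_emb UNIV Mk {..k} (Pi\<^sub>E {..k} F)"
  proof -
    have "p \<in> event p0 k X \<longleftrightarrow> (\<forall>i. p i \<in> (if i \<in> {..k} then F i else blocks i))" for p
    proof
      assume "p \<in> event p0 k X"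
      then show "\<forall>i. p i \<in> (if i \<in> {..k} then F i else blocks i)"
        by (auto simp: event_def F_def \<Omega>_def)
    next
      assume a: "\<forall>i. p i \<in> (if i \<in> {..k} then F i else blocks i)"
      have 1: "p i \<in> blocks i" for i using spec[OF a, of i] F[of i] by (auto split: if_splits)
      have 2: "p i \<in> F i" if "i \<le> k" for i using spec[OF a, of i] that by simp
      have "p j = p0 j" if "j < k" for j using 2[of j] that by (simp add: F_def)
      then show "p \<in> event p0 k X" using 1 2[of k] by (simp add: event_def F_def \<Omega>_def)
    qed
    then have "event p0 k X = (\<Pi>\<^sub>E i\<in>UNIV. if i \<in> {..k} then F i else space (Mk i))"
      unfolding space_Mk PiE_UNIV_domain Pi_def by blast
    then show ?thesis using F by (subst prod_emb_PiE) (auto simp: space_Mk)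
  qed
  show "event p0 k X \<in> sets PM" unfolding e PM_def
    by (rule sets_PiM_I) (use F in \<open>auto simp: sets_Mk\<close>)
  have "emeasure PM (event p0 k X) = (\<Prod>j\<le>k. emeasure (Mk j) (F j))"
    unfolding e PM_def by (rule emeasure_PiM_emb) (use F in \<open>auto simp: sets_Mk prob_space_Mk\<close>)
  also have "\<dots> = (\<Prod>j\<le>k. ennreal (sum (mass j) (F j)))"
    using F by (intro prod.cong) (auto simp: emeasure_Mk)
  also have "\<dots> = ennreal (\<Prod>j\<le>k. sum (mass j) (F j))"
    by (intro prod_ennreal sum_nonneg mass_nonneg)
  also have "(\<Prod>j\<le>k. sum (mass j) (F j)) = (\<Prod>j<k. mass j (p0 j)) * sum (mass k) X"
    unfolding lessThan_Suc_atMost[symmetric] by (simp add: F_def)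
  finally show "emeasure PM (event p0 k X) = ennreal ((\<Prod>j<k. mass j (p0 j)) * sum (mass k) X)" .
qed

text \<open>Here 1296 is \<open>16 * 81\<close>: splitting off prefix and gap word costs
  \<open>4 powr s\<close> twice, and \<open>den [2, a] \<le> 9 * exp (L k)\<close> gives 81. The
  other factors come from \<open>inverse_ZM\<close> and \<open>inverse_card_win\<close>.\<close>

definition C1 :: real where "C1 = 1296 powr s * 4 powr s / \<eta>"

text \<open>Bound for the excess of the mass of block \<open>k\<close> over the factor by which
  \<open>wt s\<close> drops when this block is appended.\<close>

definition Y :: "nat \<Rightarrow> real" where
  "Y k = C1 * (real k + 1) * exp ((2 * s - 1) * L k - b * gl k)"

lemma C1_pos: "0 < C1"
  using \<eta> by (simp add: C1_def)

lemma Y_nonneg: "0 \<le> Y k"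
  using C1_pos by (simp add: Y_def)

lemma inverse_card_win: "1 / card (win k) \<le> (real k + 1) * exp (- L k) / \<eta>"
proof -
  have "1 / card (win k) \<le> 1 / (\<eta> * exp (L k) / (real k + 1))"
    using card_win_ge[of k] card_win_pos[of k] \<eta> by (intro divide_left_mono) auto
  then show ?thesis by (simp add: exp_minus divide_inverse mult_ac)
qed

lemma inverse_ZM: "1 / ZM n \<le> 4 powr s * exp (- b * n)"
proof -
  have "1 / ZM n \<le> 1 / (4 powr (- s) * exp (n * b))"
    using ZM_ge[of n] ZM_pos[of n] by (intro divide_left_mono) auto
  then show ?thesis by (simp add: exp_minus powr_minus divide_inverse mult_ac)
qed

lemma wt_block_ge:
  assumes u: "0 \<notin> set u" and v: "0 \<notin> set v" and a: "1 \<le> a" "a \<le> 3 * exp (L k)"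
  shows "wt s u * wt s v \<le> 1296 powr s * exp (2 * s * L k) * wt s (u @ 2 # a # v)"
proof -
  \<comment> \<open>The denominator is \<open>2 * a + 1\<close>, at most
    \<open>3 * a\<close>.\<close>
  have d: "real (den [2, a]) \<le> 9 * exp (L k)" using a by simp
  have "(9 * exp (L k)) powr (- 2 * s) \<le> wt s [2, a]"
    unfolding wt_def using d s a by (intro powr_mono2') auto
  moreover have "(9 * exp (L k)) powr (- 2 * s) = 81 powr (- s) * exp (- 2 * s * L k)"
    using powr_powr[of 9 2 "- s"] by (simp add: powr_mult) (simp add: powr_def)
  ultimately have w2: "81 powr (- s) * exp (- 2 * s * L k) \<le> wt s [2, a]" by simp
  have n2: "0 \<notin> set [2, a]" "0 \<notin> set ([2, a] @ v)" using a v by auto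
  have "4 powr (- s) * (4 powr (- s) * (wt s u * ((81 powr (- s) * exp (- 2 * s * L k)) * wt s v)))
     \<le> 4 powr (- s) * (4 powr (- s) * (wt s u * (wt s [2, a] * wt s v)))"
    by (intro mult_left_mono mult_right_mono w2) (auto simp: wt_nonneg)
  also have "\<dots> = 4 powr (- s) * (wt s u * (4 powr (- s) * (wt s [2, a] * wt s v)))" by simp
  also have "\<dots> \<le> 4 powr (- s) * (wt s u * wt s ([2, a] @ v))"
    using wt_append_ge[OF n2(1) v, of s] s by (intro mult_left_mono) (auto simp: wt_nonneg)
  also have "\<dots> \<le> wt s (u @ [2, a] @ v)" using wt_append_ge[OF u n2(2), of s] s by auto
  finally have "1296 powr (- s) * exp (- 2 * s * L k) * (wt s u * wt s v) \<le> wt s (u @ [2, a] @ v)"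
    using powr_mult[of 4 4 "- s"] powr_mult[of 16 81 "- s"] by (simp add: mult_ac)
  then have le: "1296 powr s * exp (2 * s * L k) * (1296 powr (- s) * exp (- 2 * s * L k) * (wt s u * wt s v))
      \<le> 1296 powr s * exp (2 * s * L k) * wt s (u @ [2, a] @ v)" by (intro mult_left_mono) auto
  have "1296 powr s * exp (2 * s * L k) * (1296 powr (- s) * exp (- 2 * s * L k)) = 1"
    by (simp add: powr_minus exp_minus field_simps)
  then have e: "1296 powr s * exp (2 * s * L k) * (1296 powr (- s) * exp (- 2 * s * L k) * (wt s u * wt s
    v)) = wt s u * wt s v"
    by (metis mult.assoc mult_1)
  show ?thesis using le unfolding e by simp
qed

lemma pos_cat: "p \<in> \<Omega> \<Longrightarrow> 0 \<notin> set (cat p k)"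
  using map_digit_cat[of p k] digit_pos[of p] by (metis ex_map_conv less_numeral_extra(3))

lemma pos_snd: "p \<in> \<Omega> \<Longrightarrow> 0 \<notin> set (snd (p k))"
  using \<Omega>_block[of p k] words_pos[OF alphabet(1)] by blast

lemma fst_bounds: "p \<in> \<Omega> \<Longrightarrow> 1 \<le> fst (p k) \<and> real (fst (p k)) \<le> 3 * exp (L k)"
  using \<Omega>_block[of p k] win_bounds(3,4) by blast

text \<open>The weight has the order of the \<open>s\<close>-th power of the length of the cylinder,
  so this compares measure with length; \<open>prod_Y_bounded\<close> controls the remaining
  product.\<close>

lemma prod_mass_le:
  assumes p: "p \<in> \<Omega>"
  shows "(\<Prod>j<k. mass j (p j)) \<le> wt s (cat p k) * (\<Prod>j<k. Y j)"
proof (induction k)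
  case (Suc k)
  have "wt s (cat p k) * mass k (p k) = (wt s (cat p k) * wt s (snd (p k))) * (1 / ZM (gl k)) * (1 / card
    (win k))"
    by (simp add: mass_def)
  also have "\<dots> \<le> (1296 powr s * exp (2 * s * L k) * wt s (cat p (Suc k))) *
      (4 powr s * exp (- b * gl k)) * ((real k + 1) * exp (- L k) / \<eta>)"
  proof -
    have "wt s (cat p k) * wt s (snd (p k)) \<le> 1296 powr s * exp (2 * s * L k) * wt s (cat p (Suc k))"
      unfolding cat_Suc bw_def using fst_bounds[OF p, of k] by (intro wt_block_ge pos_cat pos_snd p) auto
    then show ?thesis using ZM_pos[of "gl k"] \<eta>
      by (intro mult_mono[OF mult_mono inverse_card_win] inverse_ZM) (auto simp: wt_nonneg less_imp_le)
  qed
  also have "\<dots> = wt s (cat p (Suc k)) * Y k"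
  proof -
    have "exp ((2 * s - 1) * L k - b * gl k) = exp (2 * s * L k) * exp (- b * gl k) * exp (- L k)"
      by (simp add: exp_add[symmetric] algebra_simps)
    then show ?thesis by (simp add: Y_def C1_def)
  qed
  finally have st: "wt s (cat p k) * mass k (p k) \<le> wt s (cat p (Suc k)) * Y k" .
  have "(\<Prod>j<Suc k. mass j (p j)) \<le> (wt s (cat p k) * (\<Prod>j<k. Y j)) * mass k (p k)"
    using Suc by (simp add: mult_right_mono mass_nonneg)
  also have "\<dots> = (\<Prod>j<k. Y j) * (wt s (cat p k) * mass k (p k))" by simp
  also have "\<dots> \<le> (\<Prod>j<k. Y j) * (wt s (cat p (Suc k)) * Y k)"
    by (intro mult_left_mono st prod_nonneg) (simp add: Y_nonneg)
  finally show ?case by (simp add: mult_ac)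
qed (simp add: cat_0 wt_def)

lemma sum_gl: "(\<Sum>j<k. real (gl j)) = real (N k) - 2 - 2 * real k"
proof (induction k)
  case (Suc k)
  have "real (gl k) + 2 = real (N (Suc k)) - real (N k)" using gl(1)[of k] N_step[of k] by linarith
  then show ?case using Suc by simp
qed (simp add: N_0)

text \<open>Up to terms of order \<open>k * ln k\<close> and constants, the logarithm is
  \<open>(2 * s - 1) * (\<Sum>j<k. L j) + s * L k - b * N k\<close>, which \<open>gap\<close> drives
  to minus infinity. The factor \<open>(k + 1) * exp (s * L k)\<close> is the reserve that
  \<open>estimate_window\<close> spends.\<close>

lemma prod_Y_bounded: "\<exists>H>0. \<forall>k. (\<Prod>j<k. Y j) * (real k + 1) * exp (s * L k) \<le> H"
proof -
  define E where "E k = (\<Sum>j<k. ln C1 + ln (real j + 1) + ((2 * s - 1) * L j - b * gl j)) + ln (real k + 1) +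
    s * L k" for k
  have Ye: "Y k = exp (ln C1 + ln (real k + 1) + ((2 * s - 1) * L k - b * gl k))" for k
    using C1_pos by (simp add: Y_def exp_add)
  have e: "(\<Prod>j<k. Y j) * (real k + 1) * exp (s * L k) = exp (E k)" for k
    unfolding E_def exp_add by (simp add: Ye exp_sum)
  \<comment> \<open>All signs are opposite to those of the upper bound. The coefficient 2 of the
    last term covers the sum of logarithms in \<open>l\<close> and the single one in
    \<open>l2\<close>.\<close>
  let ?X = "\<lambda>k. N k * (- b) - (- (2 * s - 1)) * (\<Sum>j<k. L j) - (- s) * L k + (ln C1 + 2 * b) * k
      + 2 * (real k * ln (real (Suc k)))"
  have "filterlim ?X at_bot sequentially"
    by (rule exponent_at_bot) (use gap in \<open>simp add: b_def algebra_simps\<close>)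
  then obtain H where H: "\<And>k. ?X k \<le> H" using at_bot_imp_bdd_above by blast
  have "E k \<le> H + 2 * b" for k
  proof -
    have l: "(\<Sum>j<k. ln (real j + 1)) \<le> real k * ln (real (Suc k))"
    proof -
      have "(\<Sum>j<k. ln (real j + 1)) \<le> (\<Sum>j<k. ln (real (Suc k)))" by (intro sum_mono) auto
      then show ?thesis by simp
    qed
    have l2: "ln (real k + 1) \<le> real k * ln (real (Suc k))"
    proof (cases k)
      case (Suc j)
      have "1 * ln (real (Suc k)) \<le> real k * ln (real (Suc k))" using Suc by (intro mult_right_mono) auto
      then show ?thesis by (simp add: add.commute)
    qed simp
    have "E k = k * ln C1 + (\<Sum>j<k. ln (real j + 1)) + (2 * s - 1) * (\<Sum>j<k. L j) - b * (real (N k) - 2 - 2 *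
      real k)
       + ln (real k + 1) + s * L k"
      unfolding E_def sum.distrib sum_subtractf sum_distrib_left[symmetric] sum_gl by simp
    also have "\<dots> \<le> ?X k + 2 * b" using l l2 by (simp add: algebra_simps)
    also have "\<dots> \<le> H + 2 * b" using H[of k] by simp
    finally show ?thesis .
  qed
  then show ?thesis unfolding e by (intro exI[of _ "exp (H + 2 * b)"]) auto
qed

lemma sum_wt_prefix:
  assumes v: "v \<in> words {1..M} n" and m: "m \<le> n"
  shows "sum (wt s) {w \<in> words {1..M} n. take m w = take m v} \<le> wt s (take m v) * ZM (n - m)"
proof -
  let ?p = "take m v"
  have sub: "{w \<in> words {1..M} n. take m w = ?p} \<subseteq> (\<lambda>u. ?p @ u) ` words {1..M} (n - m)"
  proof
    fix w assume w: "w \<in> {w \<in> words {1..M} n. take m w = ?p}"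
    then have "w = ?p @ drop m w" by (metis (mono_tags) append_take_drop_id mem_Collect_eq)
    moreover have "drop m w \<in> words {1..M} (n - m)" using w by (auto simp: words_def dest: in_set_dropD)
    ultimately show "w \<in> (\<lambda>u. ?p @ u) ` words {1..M} (n - m)" by blast
  qed
  have "sum (wt s) {w \<in> words {1..M} n. take m w = ?p} \<le> sum (wt s) ((\<lambda>u. ?p @ u) ` words {1..M} (n - m))"
    by (intro sum_mono2 sub finite_imageI finite_words) (simp add: wt_nonneg)
  also have "\<dots> = (\<Sum>u\<in>words {1..M} (n - m). wt s (?p @ u))" by (subst sum.reindex) (auto simp: inj_on_def)
  also have "\<dots> \<le> (\<Sum>u\<in>words {1..M} (n - m). wt s ?p * wt s u)"
  proof (rule sum_mono)
    fix u assume "u \<in> words {1..M} (n - m)"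
    then have "0 \<notin> set u" "0 \<notin> set ?p" using words_pos[OF alphabet(1)] v by (auto dest: in_set_takeD)
    then show "wt s (?p @ u) \<le> wt s ?p * wt s u" using s by (intro wt_append_le) auto
  qed
  finally show ?thesis unfolding ZM_eq sum_distrib_left .
qed

text \<open>By \<open>Z_add_ge\<close> the sum over the continuations cancels up to
  \<open>4 powr s\<close>; another \<open>4 powr s\<close> comes from bounding \<open>ZM m\<close>
  below, where \<open>b_pos\<close> allows the exponential to be dropped.\<close>

lemma prefix_mass:
  assumes v: "v \<in> words {1..M} (gl k)" and m: "m \<le> gl k"
  shows "sum (wt s) {w \<in> words {1..M} (gl k). take m w = take m v} / ZM (gl k) \<le> 16 powr s * wt s (take m v)"
proof -
  let ?p = "take m v"
  have "sum (wt s) {w \<in> words {1..M} (gl k). take m w = ?p} / ZM (gl k) \<le> wt s ?p * ZM (gl k - m) / ZM (gl k)"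
    using ZM_pos[of "gl k"] by (intro divide_right_mono sum_wt_prefix v m) auto
  also have "\<dots> \<le> wt s ?p * ZM (gl k - m) / (4 powr (- s) * (ZM m * ZM (gl k - m)))"
  proof (intro divide_left_mono)
    show "4 powr (- s) * (ZM m * ZM (gl k - m)) \<le> ZM (gl k)"
      using Z_add_ge[OF s_half alphabet, of m "gl k - m"] m by simp
  qed (use ZM_pos in \<open>auto simp: wt_nonneg less_imp_le\<close>)
  also have "\<dots> = wt s ?p * (4 powr s * (1 / ZM m))"
    using ZM_pos[of "gl k - m"] by (simp add: powr_minus divide_inverse)
  also have "\<dots> \<le> wt s ?p * (4 powr s * (4 powr s * exp (- b * m)))"
    by (intro mult_left_mono inverse_ZM) (auto simp: wt_nonneg)
  also have "\<dots> \<le> wt s ?p * (4 powr s * (4 powr s * 1))"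
    using b_pos by (intro mult_left_mono) (auto simp: wt_nonneg)
  also have "\<dots> = 16 powr s * wt s ?p" using powr_mult[of 4 4 s] by simp
  finally show ?thesis .
qed

text \<open>From \<open>cfval_separation\<close> with digits at most \<open>M\<close> that differ by
  at least 1.\<close>

definition c1 :: real where "c1 = h / (4 * (real M + 1)\<^sup>2)"
text \<open>From \<open>cfval_separation\<close>: each window digit plus 1 is at most
  \<open>4 * exp (L k)\<close>, and \<open>4 * 4 * 4 = 64\<close>.\<close>

definition c2 :: real where "c2 = h / 64"

lemma c_pos: "0 < c1" "0 < c2"
  using h_pos by (auto simp: c1_def c2_def)

definition q :: "(nat \<Rightarrow> nat \<times> nat list) \<Rightarrow> nat \<Rightarrow> real" where
  "q p i = real (den (map (digit p) [0..<i]))"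

lemma q_ge: assumes "p \<in> \<Omega>" shows "1 \<le> q p i" "real i \<le> q p i"
proof -
  have p: "0 \<notin> set (map (digit p) [0..<i])" using digit_pos[OF assms] by (metis ex_map_conv
    less_numeral_extra(3))
  show "1 \<le> q p i" using den_pos[OF p] by (simp add: q_def)
  show "real i \<le> q p i" using length_le_den[OF p] by (simp add: q_def)
qed

lemma separation_nonwindow:
  assumes w: "p \<in> \<Omega>" "p' \<in> \<Omega>" and agree: "\<And>j. j < i \<Longrightarrow> digit p j = digit p' j" and ne: "digit p i \<noteq> digit p' i"
    and i: "\<And>k. i \<noteq> N k - 1"
  shows "c1 / (q p i)\<^sup>2 \<le> \<bar>val p - val p'\<bar>"
proof -
  have "c1 / (q p i)\<^sup>2 = h * 1 / (4 * (q p i)\<^sup>2 * ((real M + 1) * (real M + 1)))"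
    by (simp add: c1_def power2_eq_square)
  also have "\<dots> \<le> h * \<bar>real (digit p i) - real (digit p' i)\<bar> / (4 * (q p i)\<^sup>2 * ((real (digit p i) + 1) *
    (real (digit p' i) + 1)))"
  proof (intro frac_le mult_left_mono)
    show "1 \<le> \<bar>real (digit p i) - real (digit p' i)\<bar>" using ne by auto
    show "(real (digit p i) + 1) * (real (digit p' i) + 1) \<le> (real M + 1) * (real M + 1)"
      using digit_nonwindow[OF w(1) i] digit_nonwindow[OF w(2) i] by (intro mult_mono) auto
    show "0 < 4 * (q p i)\<^sup>2 * ((real (digit p i) + 1) * (real (digit p' i) + 1))"
      using q_ge(1)[OF w(1), of i] by (intro mult_pos_pos) auto
  qed (use h_pos in auto)
  also have "\<dots> \<le> \<bar>val p - val p'\<bar>" unfolding q_def by (rule val_separation[OF w agree ne])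
  finally show ?thesis .
qed

text \<open>The distance of the window coefficients is kept in the bound: a ball may meet many of
  them, and they have to be counted.\<close>

lemma separation_window:
  assumes w: "p \<in> \<Omega>" "p' \<in> \<Omega>" and agree: "\<And>j. j < N k - 1 \<Longrightarrow> digit p j = digit p' j"
  shows "c2 * \<bar>real (fst (p k)) - real (fst (p' k))\<bar> / ((q p (N k - 1))\<^sup>2 * exp (2 * L k)) \<le> \<bar>val p - val p'\<bar>"
proof (cases "fst (p k) = fst (p' k)")
  case False
  have ne: "digit p (N k - 1) \<noteq> digit p' (N k - 1)" using False digit_window w by simp
  define Q where "Q = q p (N k - 1)"
  define x y where "x = real (fst (p k))" and "y = real (fst (p' k))"
  have Q: "1 \<le> Q" unfolding Q_def by (rule q_ge(1)[OF w(1)])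
  have x: "1 \<le> x" "x + 1 \<le> 4 * exp (L k)" and y: "1 \<le> y" "y + 1 \<le> 4 * exp (L k)"
    using fst_bounds[OF w(1), of k] fst_bounds[OF w(2), of k] L_nonneg[of k] one_le_exp_iff[of "L k"]
      unfolding x_def y_def by linarith+
  have "c2 * \<bar>x - y\<bar> / (Q\<^sup>2 * exp (2 * L k)) = h * \<bar>x - y\<bar> / (4 * Q\<^sup>2 * ((4 * exp (L k)) * (4 * exp (L k))))"
    by (simp add: c2_def exp_double power2_eq_square)
  also have "\<dots> \<le> h * \<bar>x - y\<bar> / (4 * Q\<^sup>2 * ((x + 1) * (y + 1)))"
  proof (intro frac_le mult_left_mono order_refl)
    show "(x + 1) * (y + 1) \<le> (4 * exp (L k)) * (4 * exp (L k))" using x y by (intro mult_mono) auto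
    show "0 < 4 * Q\<^sup>2 * ((x + 1) * (y + 1))" using Q x y by (intro mult_pos_pos) auto
  qed (use h_pos in auto)
  also have "\<dots> \<le> \<bar>val p - val p'\<bar>"
    using val_separation[OF w agree ne] unfolding Q_def q_def x_def y_def digit_window[OF w(1)]
      digit_window[OF w(2)] .
  finally show ?thesis unfolding Q_def x_def y_def .
qed simp

end

section \<open>The Frostman estimate for balls\<close>

context jumps_lower
begin

lemma agree_blocks:
  assumes w: "p \<in> \<Omega>" "p' \<in> \<Omega>" and agree: "\<And>j. j < i \<Longrightarrow> digit p j = digit p' j"
    and i: "N k - 2 \<le> i" and j: "j < k"
  shows "p j = p' j"
proof -
  have cat: "cat p l = cat p' l" if "l \<le> k" for l
  proof -
    have "N l - 2 \<le> i" using N_mono[OF that] i by linarith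
    then have "map (digit p) [0..<N l - 2] = map (digit p') [0..<N l - 2]" using agree by auto
    then show ?thesis using map_digit_cat w by simp
  qed
  have "bw (p j) = bw (p' j)" using cat[of j] cat[of "Suc j"] j by (simp add: cat_Suc)
  then show ?thesis by (simp add: bw_def prod_eq_iff)
qed

lemma q_start: "p \<in> \<Omega> \<Longrightarrow> q p (N k - 2) = real (den (cat p k))"
  by (simp add: q_def map_digit_cat)

lemma q_window:
  assumes "p \<in> \<Omega>" shows "q p (N k - 1) \<le> 4 * real (den (cat p k))"
proof -
  have e: "N k - 1 = N k - 2 + 1" using N_ge[of k] by linarith
  have "q p (N k - 1) = real (den (cat p k @ [2]))"
    unfolding e q_def by (subst map_digit_block[OF assms]) (auto simp: bw_def)
  moreover have "den (cat p k @ [2]) \<le> 2 * den (cat p k) * den [2]"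
    using pos_cat[OF assms] by (intro den_append_le) auto
  then have "den (cat p k @ [2]) \<le> 4 * den (cat p k)" by simp
  ultimately show ?thesis by linarith
qed

lemma wt_gap:
  assumes "p \<in> \<Omega>" "m < gl k"
  shows "q p (N k + m) powr (- 2 * s) = wt s (cat p k @ 2 # fst (p k) # take m (snd (p k)))"
proof -
  have e: "N k + m = N k - 2 + (m + 2)" using N_ge[of k] by linarith
  show ?thesis unfolding e q_def wt_def
    by (subst map_digit_block[OF assms(1)]) (use assms(2) in \<open>auto simp: bw_def\<close>)
qed

lemma powr_le_of_threshold:
  fixes Q r :: real
  assumes "1 \<le> Q" "c1 / Q\<^sup>2 \<le> r" "0 < r"
  shows "Q powr (- 2 * s) \<le> c1 powr (- s) * r powr s"
proof -
  have "Q powr (- 2) = 1 / Q\<^sup>2" using assms by (simp add: powr_minus divide_inverse)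
  also have "\<dots> \<le> r / c1" using assms c_pos by (simp add: field_simps)
  finally have "(Q powr (- 2)) powr s \<le> (r / c1) powr s" using s by (intro powr_mono2) auto
  moreover have "(Q powr (- 2)) powr s = Q powr (- 2 * s)" by (simp only: powr_powr)
  moreover have "(r / c1) powr s = c1 powr (- s) * r powr s"
    using c_pos assms by (subst powr_divide) (auto simp: powr_minus_divide)
  ultimately show ?thesis by simp
qed

text \<open>The number 48 is the 3 of \<open>card_near\<close> times the square of the 4 in
  \<open>q_window\<close>.\<close>

definition c3 :: real where "c3 = 48 / (c2 * \<eta>)"
text \<open>The factors come from \<open>wt_block_ge\<close>, \<open>prefix_mass\<close> and
  \<open>inverse_card_win\<close>.\<close>

definition c4 :: real where "c4 = 1296 powr s * 16 powr s / \<eta>"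

lemma c34_pos: "0 < c3" "0 < c4"
  using c_pos \<eta> by (auto simp: c3_def c4_def)

definition H :: real where
  "H = (SOME H. 0 < H \<and> (\<forall>k. (\<Prod>j<k. Y j) * (real k + 1) * exp (s * L k) \<le> H))"

lemma H: "0 < H" "(\<Prod>j<k. Y j) * (real k + 1) * exp (s * L k) \<le> H"
proof -
  have "0 < H \<and> (\<forall>k. (\<Prod>j<k. Y j) * (real k + 1) * exp (s * L k) \<le> H)"
    unfolding H_def by (rule someI_ex) (use prod_Y_bounded in blast)
  then show "0 < H" "(\<Prod>j<k. Y j) * (real k + 1) * exp (s * L k) \<le> H" by auto
qed

lemma prod_Y_nonneg: "0 \<le> (\<Prod>j<k. Y j)"
  by (intro prod_nonneg) (simp add: Y_nonneg)

text \<open>When the scale \<open>r\<close> is reached at the leading 2, fixing the \<open>k\<close>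
  complete blocks before it is enough.\<close>

lemma estimate_start:
  assumes w: "p \<in> \<Omega>" and r: "0 < r" "c1 / (q p (N k - 2))\<^sup>2 \<le> r"
  shows "emeasure PM (event p k (blocks k)) \<le> ennreal (H * c1 powr (- s) * r powr s)"
proof -
  have "(\<Prod>j<k. Y j) * 1 * 1 \<le> (\<Prod>j<k. Y j) * (real k + 1) * exp (s * L k)"
    using s L_nonneg[of k] prod_Y_nonneg by (intro mult_mono) auto
  then have Y: "(\<Prod>j<k. Y j) \<le> H" using H(2)[of k] by simp
  have "(\<Prod>j<k. mass j (p j)) \<le> wt s (cat p k) * (\<Prod>j<k. Y j)" by (rule prod_mass_le[OF w])
  also have "\<dots> \<le> wt s (cat p k) * H" by (intro mult_left_mono Y wt_nonneg)
  also have "wt s (cat p k) \<le> c1 powr (- s) * r powr s"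
    using powr_le_of_threshold[OF q_ge(1)[OF w] r(2,1)] by (simp add: q_start[OF w] wt_def)
  finally have "(\<Prod>j<k. mass j (p j)) \<le> H * c1 powr (- s) * r powr s" using H(1) by (simp add: mult_ac)
  then show ?thesis by (simp add: event(2)[OF w order_refl] sum_mass_1 ennreal_leI)
qed

text \<open>Fixing the window coefficient gains \<open>exp (- L k)\<close>, while its share in the
  denominator costs \<open>exp (2 * s * L k)\<close>; the net cost is within the reserve
  \<open>exp (s * L k)\<close> of \<open>H\<close> because \<open>2 * s - 1 \<le> s\<close>.\<close>

lemma estimate_gap:
  assumes w: "p \<in> \<Omega>" and m: "m < gl k" and r: "0 < r" "c1 / (q p (N k + m))\<^sup>2 \<le> r"
  shows "emeasure PM (event p k ({fst (p k)} \<times> {v \<in> words {1..M} (gl k). take m v = take m (snd (p k))}))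
    \<le> ennreal (c4 * H * c1 powr (- s) * r powr s)"
proof -
  let ?v = "snd (p k)" and ?a = "fst (p k)"
  let ?T = "{v \<in> words {1..M} (gl k). take m v = take m ?v}"
  have bl: "?a \<in> win k" "?v \<in> words {1..M} (gl k)" using \<Omega>_block[OF w, of k] by auto
  have sub: "{?a} \<times> ?T \<subseteq> blocks k" using bl by (auto simp: blocks_def)
  have sm: "sum (mass k) ({?a} \<times> ?T) \<le> ((real k + 1) * exp (- L k) / \<eta>) * (16 powr s * wt s (take m ?v))"
  proof -
    have "sum (mass k) ({?a} \<times> ?T) = (1 / card (win k)) * (sum (wt s) ?T / ZM (gl k))"
      by (subst sum_mass) (use bl in auto)
    also have "\<dots> \<le> ((real k + 1) * exp (- L k) / \<eta>) * (16 powr s * wt s (take m ?v))"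
      using \<eta> ZM_pos[of "gl k"] m bl
      by (intro mult_mono inverse_card_win prefix_mass) (auto intro!: divide_nonneg_pos sum_nonneg simp:
        wt_nonneg)
    finally show ?thesis .
  qed
  have p: "0 \<notin> set (take m ?v)" using pos_snd[OF w, of k] by (auto dest: in_set_takeD)
  have wtb: "wt s (cat p k) * wt s (take m ?v) \<le> 1296 powr s * exp (2 * s * L k) * q p (N k + m) powr (- 2 * s)"
    unfolding wt_gap[OF w m] using fst_bounds[OF w, of k] by (intro wt_block_ge pos_cat[OF w] p) auto
  have "(\<Prod>j<k. mass j (p j)) * sum (mass k) ({?a} \<times> ?T)
      \<le> (wt s (cat p k) * (\<Prod>j<k. Y j)) * (((real k + 1) * exp (- L k) / \<eta>) * (16 powr s * wt s (take m ?v)))"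
    by (intro mult_mono prod_mass_le[OF w] sm sum_nonneg mult_nonneg_nonneg) (auto simp: mass_nonneg
      wt_nonneg prod_Y_nonneg)
  also have "\<dots> = (wt s (cat p k) * wt s (take m ?v)) * ((\<Prod>j<k. Y j) * (real k + 1) * exp (- L k) * (16 powr
    s / \<eta>))"
    by simp
  also have "\<dots> \<le> (1296 powr s * exp (2 * s * L k) * q p (N k + m) powr (- 2 * s))
      * ((\<Prod>j<k. Y j) * (real k + 1) * exp (- L k) * (16 powr s / \<eta>))"
    using \<eta> prod_Y_nonneg by (intro mult_right_mono wtb mult_nonneg_nonneg) auto
  also have "\<dots> = c4 * q p (N k + m) powr (- 2 * s) *
      ((\<Prod>j<k. Y j) * (real k + 1) * exp ((2 * s - 1) * L k))"
    by (simp add: c4_def exp_diff exp_minus field_simps)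
  also have "\<dots> \<le> c4 * (c1 powr (- s) * r powr s) * H"
  proof (intro mult_mono mult_left_mono powr_le_of_threshold[OF q_ge(1)[OF w] r(2,1)])
    have "(2 * s - 1) * L k \<le> s * L k" using s L_nonneg[of k] by (intro mult_right_mono) auto
    then have "(\<Prod>j<k. Y j) * (real k + 1) * exp ((2 * s - 1) * L k) \<le> (\<Prod>j<k. Y j) * (real k + 1) * exp (s *
      L k)"
      using prod_Y_nonneg by (intro mult_left_mono) auto
    then show "(\<Prod>j<k. Y j) * (real k + 1) * exp ((2 * s - 1) * L k) \<le> H" using H(2)[of k] by linarith
  qed (use c34_pos prod_Y_nonneg in auto)
  finally show ?thesis unfolding event(2)[OF w sub] by (intro ennreal_leI) (simp add: mult_ac)
qed

text \<open>Interpolation between the trivial bound 1 and a linear bound: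
  \<open>x \<le> x powr s \<le> y powr s\<close>, as \<open>s \<le> 1\<close>.\<close>

lemma min_1_powr: "0 \<le> x \<Longrightarrow> x \<le> 1 \<Longrightarrow> x \<le> y \<Longrightarrow> x \<le> y powr s" for x y :: real
proof -
  assume x: "0 \<le> x" "x \<le> 1" "x \<le> y"
  show ?thesis
  proof (cases "x = 0")
    case False
    then have "x = x powr 1" using x by simp
    also have "\<dots> \<le> x powr s" using x s False by (intro powr_mono') auto
    also have "\<dots> \<le> y powr s" using x s by (intro powr_mono2) auto
    finally show ?thesis .
  qed simp
qed

lemma card_near:
  assumes "1 \<le> z"
  shows "real (card {y \<in> A. \<bar>real y - real a\<bar> \<le> z}) \<le> 3 * z"
proof -
  let ?f = "nat \<lfloor>z\<rfloor>"
  have f: "real ?f \<le> z" using assms by (intro of_nat_floor) auto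
  have "{y \<in> A. \<bar>real y - real a\<bar> \<le> z} \<subseteq> {a - ?f..a + ?f}"
  proof
    fix y assume "y \<in> {y \<in> A. \<bar>real y - real a\<bar> \<le> z}"
    then have "\<bar>real y - real a\<bar> \<le> z" by simp
    then have "\<bar>int y - int a\<bar> \<le> \<lfloor>z\<rfloor>" by linarith
    then show "y \<in> {a - ?f..a + ?f}" by auto
  qed
  then have "card {y \<in> A. \<bar>real y - real a\<bar> \<le> z} \<le> card {a - ?f..a + ?f}" by (rule card_mono[rotated]) simp
  also have "\<dots> \<le> 2 * ?f + 1" by simp
  finally have "real (card {y \<in> A. \<bar>real y - real a\<bar> \<le> z}) \<le> 2 * real ?f + 1" by linarith
  then show ?thesis using f assms by linarith
qed

text \<open>At this scale the ball meets between one and all values in the window. Their proportion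
  is at most 1 and at most linear in \<open>r\<close>, and \<open>min_1_powr\<close> turns this into
  a bound by \<open>r powr s\<close>. The power of the denominator that appears cancels against
  \<open>wt s (cat p k)\<close>, and \<open>exp (s * L k) * (k + 1)\<close> is absorbed by
  \<open>H\<close>; this is where \<open>s * \<beta>\<close> in \<open>gap\<close> is
  consumed.\<close>

lemma estimate_window:
  assumes w: "p \<in> \<Omega>" and r: "0 < r" and z: "1 \<le> z"
    and zr: "z = r * (q p (N k - 1))\<^sup>2 * exp (2 * L k) / c2"
  shows "emeasure PM (event p k ({y \<in> win k. \<bar>real y - real (fst (p k))\<bar> \<le> z} \<times> words {1..M} (gl k)))
    \<le> ennreal (c3 powr s * H * r powr s)"
proof -
  let ?S = "{y \<in> win k. \<bar>real y - real (fst (p k))\<bar> \<le> z}"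
  let ?d = "real (den (cat p k))"
  have d: "?d > 0" using den_pos[OF pos_cat[OF w]] by simp
  have sub: "?S \<times> words {1..M} (gl k) \<subseteq> blocks k" by (auto simp: blocks_def)
  have sm: "sum (mass k) (?S \<times> words {1..M} (gl k)) = card ?S / card (win k)"
    by (subst sum_mass) (use ZM_pos[of "gl k"] in \<open>auto simp: ZM_eq[symmetric] simp del: One_nat_def\<close>)
  have "card ?S / card (win k) \<le> (c3 * r * ?d\<^sup>2 * exp (L k) * (real k + 1)) powr s"
  proof (rule min_1_powr)
    have "card ?S \<le> card (win k)" using finite_win by (intro card_mono) auto
    then show "card ?S / card (win k) \<le> 1" using card_win_pos[of k] by (simp add: divide_le_eq)
    have "card ?S / card (win k) = card ?S * (1 / card (win k))" by simp
    also have "\<dots> \<le> 3 * z * ((real k + 1) * exp (- L k) / \<eta>)"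
      using z by (intro mult_mono card_near inverse_card_win) auto
    also have "\<dots> \<le> 3 * (r * (4 * ?d)\<^sup>2 * exp (2 * L k) / c2) * ((real k + 1) * exp (- L k) / \<eta>)"
      unfolding zr using q_window[OF w, of k] q_ge(1)[OF w, of "N k - 1"] r c_pos \<eta>
      by (intro divide_right_mono mult_right_mono mult_left_mono power_mono) auto
    also have "\<dots> = c3 * r * ?d\<^sup>2 * exp (L k) * (real k + 1)"
    proof -
      have "3 * (r * (4 * ?d)\<^sup>2 * x / c2) * ((real k + 1) * y / \<eta>) = c3 * r * ?d\<^sup>2 * (x * y) * (real k + 1)"
        for x y by (simp add: c3_def power2_eq_square)
      moreover have "exp (2 * L k) * exp (- L k) = exp (L k)" by (simp add: exp_add[symmetric])
      ultimately show ?thesis by simp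
    qed
    finally show "card ?S / card (win k) \<le> c3 * r * ?d\<^sup>2 * exp (L k) * (real k + 1)" .
  qed simp
  also have "\<dots> = c3 powr s * r powr s * ?d powr (2 * s) * exp (s * L k) * (real k + 1) powr s"
  proof -
    have "(?d\<^sup>2) powr s = ?d powr (2 * s)" using d powr_powr[of ?d 2 s] by simp
    moreover have "exp (L k) powr s = exp (s * L k)" by (simp add: powr_def)
    ultimately show ?thesis using r c34_pos d by (simp add: powr_mult)
  qed
  also have "\<dots> \<le> c3 powr s * r powr s * ?d powr (2 * s) * exp (s * L k) * (real k + 1)"
  proof (rule mult_left_mono)
    have "(real k + 1) powr s \<le> (real k + 1) powr 1" using s by (intro powr_mono) auto
    then show "(real k + 1) powr s \<le> real k + 1" by simp
  qed simp
  finally have S: "card ?S / card (win k) \<le> c3 powr s * r powr s * ?d powr (2 * s) * exp (s * L k) * (real k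
    + 1)" .
  have "(\<Prod>j<k. mass j (p j)) * sum (mass k) (?S \<times> words {1..M} (gl k))
    \<le> (wt s (cat p k) * (\<Prod>j<k. Y j)) * (c3 powr s * r powr s * ?d powr (2 * s) * exp (s * L k) * (real k + 1))"
    unfolding sm by (intro mult_mono prod_mass_le[OF w] S) (auto simp: wt_nonneg prod_Y_nonneg)
  also have "\<dots> = (wt s (cat p k) * ?d powr (2 * s)) * (c3 powr s * r powr s) * ((\<Prod>j<k. Y j) * (real k + 1) *
    exp (s * L k))"
    by (simp only: mult_ac)
  also have "wt s (cat p k) * ?d powr (2 * s) = 1" using d by (simp add: wt_def powr_add[symmetric])
  also have "1 * (c3 powr s * r powr s) * ((\<Prod>j<k. Y j) * (real k + 1) * exp (s * L k))
    \<le> 1 * (c3 powr s * r powr s) * H" by (intro mult_left_mono H(2)) auto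
  finally show ?thesis unfolding event(2)[OF w sub] by (intro ennreal_leI) (simp add: mult_ac)
qed

definition CB :: real where
  "CB = (H * c1 powr (- s) + c4 * H * c1 powr (- s)) + c3 powr s * H"

lemma CB: "0 < CB" "H * c1 powr (- s) \<le> CB" "c4 * H * c1 powr (- s) \<le> CB"
  "c3 powr s * H \<le> CB"
proof -
  have "0 < H * c1 powr (- s)" "0 < c4 * H * c1 powr (- s)" "0 < c3 powr s * H"
    using H(1) c_pos c34_pos by auto
  then show "0 < CB" "H * c1 powr (- s) \<le> CB" "c4 * H * c1 powr (- s) \<le> CB"
    "c3 powr s * H \<le> CB" unfolding CB_def by linarith+
qed

text \<open>The separation of points of the Cantor set that first differ at index \<open>i\<close> is below the scale \<open>r\<close>.\<close>

definition below :: "(nat \<Rightarrow> nat \<times> nat list) \<Rightarrow> real \<Rightarrow> nat \<Rightarrow> bool" where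
  "below p r i \<longleftrightarrow> (if \<exists>k. i = N k - 1 then \<exists>k. i = N k - 1 \<and> c2 / ((q p i)\<^sup>2 * exp (2 * L k)) \<le> r
     else c1 / (q p i)\<^sup>2 \<le> r)"

text \<open>Denominators are at least the index, so both kinds of separation bound eventually drop
  below \<open>r\<close>.\<close>

lemma below_ex: assumes w: "p \<in> \<Omega>" and r: "0 < r" shows "\<exists>i. below p r i"
proof -
  obtain i :: nat where i: "(c1 + c2) / r < real i" using reals_Archimedean2 by blast
  define Q where "Q = q p i"
  have Q: "1 \<le> Q" "real i \<le> Q" using q_ge[OF w] by (auto simp: Q_def)
  have "(c1 + c2) / r \<le> Q * 1" using i Q by simp
  also have "\<dots> \<le> Q * Q" using Q by (intro mult_left_mono) auto
  finally have le: "c1 + c2 \<le> r * Q\<^sup>2" using r by (simp add: pos_divide_le_eq mult.commute power2_eq_square)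
  have 1: "c1 / Q\<^sup>2 \<le> r" using le c_pos Q by (simp add: pos_divide_le_eq)
  have 2: "c2 / (Q\<^sup>2 * exp (2 * L k)) \<le> r" for k
  proof -
    have "Q\<^sup>2 * 1 \<le> Q\<^sup>2 * exp (2 * L k)" using L_nonneg[of k] by (intro mult_left_mono) auto
    then have "c2 / (Q\<^sup>2 * exp (2 * L k)) \<le> c2 / (Q\<^sup>2 * 1)" using c_pos Q by (intro divide_left_mono) auto
    also have "\<dots> \<le> r" using le c_pos Q by (simp add: pos_divide_le_eq)
    finally show ?thesis .
  qed
  show ?thesis using 1 2 unfolding Q_def below_def by (intro exI[of _ i]) auto
qed

text \<open>A first disagreement at an index that is not below the scale would separate the values
  by more than \<open>r\<close>; the induction supplies the earlier agreement that the separation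
  lemmas presuppose.\<close>

lemma agree_below:
  assumes w: "p \<in> \<Omega>" "p' \<in> \<Omega>" and d: "\<bar>val p - val p'\<bar> \<le> r"
    and nb: "\<And>j. j < i \<Longrightarrow> \<not> below p r j" and j: "j < i"
  shows "digit p j = digit p' j"
  using j
proof (induction j rule: less_induct)
  case (less j)
  then have agree: "\<And>l. l < j \<Longrightarrow> digit p l = digit p' l" by simp
  show ?case
  proof (rule ccontr)
    assume ne: "digit p j \<noteq> digit p' j"
    show False
    proof (cases "\<exists>k. j = N k - 1")
      case False
      then have "c1 / (q p j)\<^sup>2 \<le> r" using separation_nonwindow[OF w agree ne] d by fastforce
      then show False using nb[OF less.prems] False by (simp add: below_def)
    next
      case True
      then obtain k where k: "j = N k - 1" by blast
      have ne': "fst (p k) \<noteq> fst (p' k)" using ne digit_window w unfolding k by metis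
      have "c2 * 1 / ((q p j)\<^sup>2 * exp (2 * L k)) \<le> c2 * \<bar>real (fst (p k)) - real (fst (p' k))\<bar> / ((q p j)\<^sup>2
        * exp (2 * L k))"
        using ne' c_pos by (intro divide_right_mono mult_left_mono) auto
      also have "\<dots> \<le> r" using separation_window[OF w, of k] agree d unfolding k by fastforce
      finally have "c2 / ((q p j)\<^sup>2 * exp (2 * L k)) \<le> r" by simp
      then have "below p r j" unfolding below_def if_P[OF True] using k by blast
      then show False using nb[OF less.prems] by blast
    qed
  qed
qed

lemma not_window: "N k - 2 \<noteq> N l - 1" "m < gl k \<Longrightarrow> N k + m \<noteq> N l - 1"
proof -
  consider "l < k" | "k = l" | "Suc k \<le> l" by linarith
  then have "N k - 2 \<noteq> N l - 1 \<and> (m < gl k \<longrightarrow> N k + m \<noteq> N l - 1)"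
  proof cases
    case 1
    then show ?thesis using N_mono[of "Suc l" k] N_step[of l] N_ge[of l] by linarith
  next
    case 2
    then show ?thesis using N_ge[of k] by auto
  next
    case 3
    then show ?thesis using N_mono[OF 3] gl(1)[of k] N_step[of k] by linarith
  qed
  then show "N k - 2 \<noteq> N l - 1" "m < gl k \<Longrightarrow> N k + m \<noteq> N l - 1" by auto
qed

text \<open>At the first index \<open>i\<close> below the scale, all points of the ball still agree
  before \<open>i\<close>, which fixes the blocks completed by then. The kind of position of
  \<open>i\<close> selects one of the three estimates.\<close>

lemma ball_estimate:
  assumes w0: "p0 \<in> \<Omega>" and r: "0 < r"
  shows "\<exists>E\<in>sets PM. {p \<in> space PM. dist (val p) (val p0) \<le> r} \<subseteq> E \<and> emeasure PM E \<le> ennreal (CB * r powr s)"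
proof -
  define i where "i = (LEAST i. below p0 r i)"
  have bi: "below p0 r i" unfolding i_def by (rule LeastI_ex[OF below_ex[OF w0 r]])
  have nb: "\<And>j. j < i \<Longrightarrow> \<not> below p0 r j" unfolding i_def by (rule not_less_Least)
  have agree: "digit p0 j = digit p j" if "p \<in> \<Omega>" "dist (val p) (val p0) \<le> r" "j < i" for p j
    using agree_below[OF w0 that(1) _ nb that(3)] that(2) by (simp add: dist_real_def abs_minus_commute)
  have blocks: "p j = p0 j" if "p \<in> \<Omega>" "dist (val p) (val p0) \<le> r" "N k - 2 \<le> i" "j < k" for p j k
    using agree_blocks[OF w0 that(1) agree[OF that(1,2)] that(3,4)] by simp
  have finish: ?thesis
    if X: "X \<subseteq> blocks k" and c: "c \<le> CB" "emeasure PM (event p0 k X) \<le> ennreal (c * r powr s)"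
      and i: "N k - 2 \<le> i" and sub: "\<And>p. p \<in> \<Omega> \<Longrightarrow> dist (val p) (val p0) \<le> r \<Longrightarrow> p k \<in> X" for k X c
  proof (intro bexI[OF _ event(1)[OF w0 X]] conjI subsetI)
    fix p assume "p \<in> {p \<in> space PM. dist (val p) (val p0) \<le> r}"
    then show "p \<in> event p0 k X" using sub[of p] blocks[of p k] i by (simp add: event_def space_PM)
  next
    have "ennreal (c * r powr s) \<le> ennreal (CB * r powr s)"
      using c(1) by (intro ennreal_leI mult_right_mono) auto
    with c(2) show "emeasure PM (event p0 k X) \<le> ennreal (CB * r powr s)" by (rule order_trans)
  qed
  show ?thesis
  proof (cases i rule: index_cases)
    case (1 k)
    have le: "c1 / (q p0 (N k - 2))\<^sup>2 \<le> r" using bi not_window(1) 1 by (auto simp: below_def)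
    show ?thesis
      by (rule finish[OF order_refl CB(2) estimate_start[OF w0 r le]]) (use 1 in \<open>auto simp: \<Omega>_def\<close>)
  next
    case (2 k)
    \<comment> \<open>The index of the window in \<open>below\<close> is existential;
      \<open>N_inj\<close> identifies it with \<open>k\<close>.\<close>
    have le: "c2 / ((q p0 i)\<^sup>2 * exp (2 * L k)) \<le> r"
      using bi 2 N_inj unfolding below_def by (metis (mono_tags, lifting))
    define z where "z = r * (q p0 (N k - 1))\<^sup>2 * exp (2 * L k) / c2"
    have q: "0 < (q p0 (N k - 1))\<^sup>2 * exp (2 * L k)" using q_ge(1)[OF w0, of "N k - 1"] by simp
    have z1: "1 \<le> z" using le q c_pos unfolding 2 z_def by (simp add: field_simps)
    show ?thesis
    proof (rule finish[OF _ CB(4) estimate_window[OF w0 r z1 z_def]])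
      fix p assume w: "p \<in> \<Omega>" "dist (val p) (val p0) \<le> r"
      have "c2 * \<bar>real (fst (p0 k)) - real (fst (p k))\<bar> / ((q p0 (N k - 1))\<^sup>2 * exp (2 * L k)) \<le> \<bar>val p0 -
        val p\<bar>"
        by (rule separation_window[OF w0 w(1)]) (rule agree[OF w], use 2 in simp)
      also have "\<dots> \<le> r" using w(2) by (simp add: dist_real_def abs_minus_commute)
      finally have "\<bar>real (fst (p k)) - real (fst (p0 k))\<bar> \<le> z"
        using q c_pos unfolding z_def by (simp add: field_simps abs_minus_commute)
      then show "p k \<in> {y \<in> win k. \<bar>real y - real (fst (p0 k))\<bar> \<le> z} \<times> words {1..M} (gl k)"
        using \<Omega>_block[OF w(1), of k] by (simp add: mem_Times_iff)
    qed (use 2 in \<open>auto simp: blocks_def\<close>)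
  next
    case (3 k m)
    have le: "c1 / (q p0 (N k + m))\<^sup>2 \<le> r" using bi not_window(2)[OF 3(2)] 3(1) by (auto simp: below_def)
    have i: "i = N k - 2 + (m + 2)" using 3 N_ge[of k] by linarith
    show ?thesis
    proof (rule finish[OF _ CB(3) estimate_gap[OF w0 3(2) r le]])
      fix p assume w: "p \<in> \<Omega>" "dist (val p) (val p0) \<le> r"
      have m: "m + 2 \<le> gl k + 2" using 3 by simp
      have "cat p k @ take (m + 2) (bw (p k)) = map (digit p) [0..<i]"
        unfolding i by (rule map_digit_block[OF w(1) m, symmetric])
      also have "\<dots> = map (digit p0) [0..<i]" using agree[OF w] by simp
      also have "\<dots> = cat p0 k @ take (m + 2) (bw (p0 k))"
        unfolding i by (rule map_digit_block[OF w0 m])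
      finally have "take (m + 2) (bw (p k)) = take (m + 2) (bw (p0 k))"
        using length_cat[OF w(1), of k] length_cat[OF w0, of k] by simp
      then have "fst (p k) = fst (p0 k)" "take m (snd (p k)) = take m (snd (p0 k))" by (auto simp: bw_def)
      then show "p k \<in> {fst (p0 k)} \<times> {v \<in> words {1..M} (gl k). take m v = take m (snd (p0 k))}"
        using \<Omega>_block[OF w(1), of k] by (simp add: mem_Times_iff)
    qed (use i \<Omega>_block[OF w0, of k] in \<open>auto simp: blocks_def\<close>)
  qed
qed

lemma asymp_sum_set_not_null:
  assumes "0 \<le> t" "t \<le> s"
  shows "hausdorff_measure t (asymp_sum_set \<phi>) \<noteq> 0"
proof (rule hausdorff_measure_nonzero[OF prob_space_PM _ assms _ CB(1), where f = val])
  show "val p \<in> asymp_sum_set \<phi>" if "p \<in> space PM" for p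
    using val_in_asymp_sum_set that by (simp add: space_PM)
  show "0 < s" using s by simp
  show "\<exists>E\<in>sets PM. {p \<in> space PM. dist (val p) (val p0) \<le> r} \<subseteq> E \<and> emeasure PM E \<le> ennreal (CB * r powr s)"
    if "p0 \<in> space PM" "0 < r" for p0 r using ball_estimate that by (simp add: space_PM)
qed

end

lemma (in jumps) hausdorff_dim_asymp_sum_set:
  assumes \<theta>: "1/2 < \<theta>" "\<theta> < 1" "pressure \<theta> = \<alpha> * (2 * \<theta> - 1) + \<beta> * \<theta>"
    and nn: "0 \<le> \<alpha>" "0 \<le> \<beta>" "0 < \<alpha> + \<beta>"
  shows "hausdorff_dim (asymp_sum_set \<phi>) = ennreal \<theta>"
proof (rule antisym)
  let ?R = "\<lambda>s. (2 * s - 1) * \<alpha> + s * \<beta>"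
  have R: "?R s < ?R t" if "s < t" for s t
  proof (cases "\<alpha> = 0")
    case True
    then show ?thesis using nn that by simp
  next
    case False
    then have "(2 * s - 1) * \<alpha> < (2 * t - 1) * \<alpha>" using nn that by (intro mult_strict_right_mono) auto
    moreover have "s * \<beta> \<le> t * \<beta>" using nn that by (intro mult_right_mono) auto
    ultimately show ?thesis by linarith
  qed
  have P: "pressure_on {1..} \<theta> = ?R \<theta>" using \<theta>(3) by (simp add: pressure_eq_pressure_on mult.commute)
  show "hausdorff_dim (asymp_sum_set \<phi>) \<le> ennreal \<theta>"
  proof (rule hausdorff_dim_le)
    fix s assume s: "\<theta> < s"
    have "pressure_on {1..} s \<le> pressure_on {1..} \<theta>" by (rule pressure_on_antimono) (use s \<theta> in auto)
    then have "pressure_on {1..} s < ?R s" using P R[OF s] by linarith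
    then show "hausdorff_measure s (asymp_sum_set \<phi>) = 0"
      by (intro asymp_sum_set_null) (use s \<theta> in auto)
  qed (use \<theta> in simp)
  show "ennreal \<theta> \<le> hausdorff_dim (asymp_sum_set \<phi>)"
  proof (rule hausdorff_dim_ge)
    fix t assume t: "0 \<le> t" "t < \<theta>"
    \<comment> \<open>A point above 1/2 and \<open>t\<close> but below \<theta>: there the pressure
      exceeds the linear term strictly, and so does the pressure of some finite alphabet.\<close>
    define s where "s = (max t (1/2) + \<theta>) / 2"
    have s': "1/2 < s" "t \<le> s" "s < \<theta>" using t \<theta> by (auto simp: s_def max_def)
    have "pressure_on {1..} \<theta> \<le> pressure_on {1..} s" by (rule pressure_on_antimono) (use s' \<theta> in auto)
    then have "?R s < pressure_on {1..} s" using P R[OF s'(3)] by linarith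
    then obtain M where M: "M \<ge> 2" "?R s < pressure_on {1..M} s" using pressure_on_restrict[OF s'(1)] by blast
    interpret jumps_lower N L \<alpha> \<beta> \<rho> \<phi> s M
      by unfold_locales (use s' \<theta> M in auto)
    show "hausdorff_measure t (asymp_sum_set \<phi>) \<noteq> 0" by (rule asymp_sum_set_not_null[OF t(1) s'(2)])
  qed
qed

section \<open>The two families of functions\<close>

lemma increments_at_top:
  fixes f :: "nat \<Rightarrow> real"
  assumes c: "c > 0" and step: "\<forall>\<^sub>F k in sequentially. f k + c \<le> f (Suc k)"
  shows "filterlim f at_top sequentially"
proof -
  obtain K where K: "\<And>k. k \<ge> K \<Longrightarrow> f k + c \<le> f (Suc k)"
    using step unfolding eventually_sequentially by blast
  have ge: "(f K - c * K) + c * real k \<le> f k" if "k \<ge> K" for k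
    using that
  proof (induction k rule: dec_induct)
    case (step k)
    then show ?case using K[of k] by (simp add: algebra_simps)
  qed simp
  show ?thesis
  proof (rule filterlim_at_top_mono)
    show "filterlim (\<lambda>k. (f K - c * K) + c * real k) at_top sequentially"
      by (intro filterlim_tendsto_add_at_top[OF tendsto_const]
        filterlim_tendsto_pos_mult_at_top[OF tendsto_const c] filterlim_real_sequentially)
    show "\<forall>\<^sub>F k in sequentially. (f K - c * K) + c * real k \<le> f k"
      using ge unfolding eventually_sequentially by blast
  qed
qed

text \<open>Rounding changes a quantity that tends to infinity by a factor tending to 1; so real
  jump times may replace the integer ones in all limits.\<close>

lemma tendsto_div_ceiling:
  fixes f x :: "nat \<Rightarrow> real"
  assumes x: "filterlim x at_top sequentially" and f: "(\<lambda>k. f k / x k) \<longlonglongrightarrow> l"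
  shows "(\<lambda>k. f k / real (nat \<lceil>x k\<rceil>)) \<longlonglongrightarrow> l"
proof -
  have "(\<lambda>k. inverse (x k)) \<longlonglongrightarrow> 0" by (rule tendsto_inverse_0_at_top[OF x])
  then have i: "(\<lambda>k. 1 + inverse (x k)) \<longlonglongrightarrow> 1 + 0" by (intro tendsto_intros)
  have pos: "\<forall>\<^sub>F k in sequentially. 0 < x k" using x by (simp add: filterlim_at_top_dense)
  have "(\<lambda>k. real (nat \<lceil>x k\<rceil>) / x k) \<longlonglongrightarrow> 1"
  proof (rule tendsto_sandwich[OF _ _ tendsto_const])
    show "\<forall>\<^sub>F k in sequentially. 1 \<le> real (nat \<lceil>x k\<rceil>) / x k" using pos
      by eventually_elim (simp add: pos_le_divide_eq)
    show "\<forall>\<^sub>F k in sequentially. real (nat \<lceil>x k\<rceil>) / x k \<le> 1 + inverse (x k)" using pos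
    proof eventually_elim
      case (elim k)
      then have "real (nat \<lceil>x k\<rceil>) \<le> x k + 1" by linarith
      then show ?case using elim by (simp add: pos_divide_le_eq field_simps)
    qed
    show "(\<lambda>k. 1 + inverse (x k)) \<longlonglongrightarrow> 1" using i by simp
  qed
  then have "(\<lambda>k. (f k / x k) / (real (nat \<lceil>x k\<rceil>) / x k)) \<longlonglongrightarrow> l / 1"
    by (intro tendsto_divide f) auto
  moreover have "\<forall>\<^sub>F k in sequentially. (f k / x k) / (real (nat \<lceil>x k\<rceil>) / x k) = f k / real (nat \<lceil>x k\<rceil>)"
    using pos by eventually_elim simp
  ultimately show ?thesis using Lim_transform_eventually by fastforce
qed

text \<open>Jumps at \<open>\<lceil>x k\<rceil>\<close>, for all large \<open>k\<close> only; \<^locale>\<open>jumps\<close> arises by dropping an initial segment.\<close>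

lemma jumps_exist:
  fixes x l :: "nat \<Rightarrow> real" and \<phi> :: "nat \<Rightarrow> real"
  assumes x_step: "\<forall>\<^sub>F k in sequentially. x k + 3 \<le> x (Suc k)"
    and \<rho>: "0 < \<rho>" and l_step: "\<forall>\<^sub>F k in sequentially. l k + \<rho> \<le> l (Suc k)"
    and lim_\<alpha>: "(\<lambda>k. (\<Sum>j<k. l j) / x k) \<longlonglongrightarrow> \<alpha>" and lim_\<beta>: "(\<lambda>k. l k / x k) \<longlonglongrightarrow> \<beta>"
    and sparse: "(\<lambda>k. real k * ln (real (Suc k)) / x k) \<longlonglongrightarrow> 0"
    and fast: "(\<lambda>k. x (Suc k) / exp (l k)) \<longlonglongrightarrow> 0"
    and \<phi>: "\<forall>\<^sub>F k in sequentially. \<forall>m::nat. x k \<le> m \<longrightarrow> m < x (Suc k) \<longrightarrow> \<phi> m = exp (l k)"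
  shows "\<exists>N L. jumps N L \<alpha> \<beta> \<rho> \<phi>"
proof -
  have x_top: "filterlim x at_top sequentially" by (rule increments_at_top[OF _ x_step]) simp
  have l_top: "filterlim l at_top sequentially" by (rule increments_at_top[OF \<rho> l_step])
  define n where "n k = nat \<lceil>x k\<rceil>" for k
  \<comment> \<open>The 4 leaves the required distance 2 from the dummy \<open>N 0 = 2\<close>, and
    \<open>\<rho> \<le> l k\<close> the required step from \<open>L 0 = 0\<close>.\<close>
  have "\<forall>\<^sub>F k in sequentially. 4 \<le> x k" "\<forall>\<^sub>F k in sequentially. \<rho> \<le> l k"
    using x_top l_top by (simp_all add: filterlim_at_top)
  then have "\<forall>\<^sub>F k in sequentially. (4 \<le> x k \<and> \<rho> \<le> l k) \<and> x k + 3 \<le> x (Suc k) \<and> l k + \<rho> \<le> l (Suc k) \<and>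
      (\<forall>m::nat. x k \<le> m \<longrightarrow> m < x (Suc k) \<longrightarrow> \<phi> m = exp (l k))"
    using x_step l_step \<phi> by eventually_elim simp
  then obtain K where "\<forall>k\<ge>K. (4 \<le> x k \<and> \<rho> \<le> l k) \<and> x k + 3 \<le> x (Suc k) \<and> l k + \<rho> \<le> l (Suc k) \<and>
      (\<forall>m::nat. x k \<le> m \<longrightarrow> m < x (Suc k) \<longrightarrow> \<phi> m = exp (l k))"
    unfolding eventually_sequentially by blast
  then have K: "4 \<le> x k" "\<rho> \<le> l k" "x k + 3 \<le> x (Suc k)" "l k + \<rho> \<le> l (Suc k)"
    "x k \<le> real m \<Longrightarrow> m < x (Suc k) \<Longrightarrow> \<phi> m = exp (l k)" if "k \<ge> K" for k and m :: nat
    using that by auto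
  define N where "N k = (if k = 0 then 2 else n (k + K))" for k
  define L where "L k = (if k = 0 then 0 else l (k + K))" for k
  have n_at_top: "(\<lambda>k. 1 / real (n k)) \<longlonglongrightarrow> 0"
  proof -
    have "(\<lambda>k. 1 / x k) \<longlonglongrightarrow> 0" using tendsto_inverse_0_at_top[OF x_top] by (simp add: divide_inverse)
    then show ?thesis unfolding n_def by (rule tendsto_div_ceiling[OF x_top])
  qed
  have pos: "\<forall>\<^sub>F k in sequentially. 0 < k" by (rule eventually_gt_at_top)
  have "jumps N L \<alpha> \<beta> \<rho> \<phi>"
  proof
    show "N 0 = 2" "0 \<le> L 0" "0 < \<rho>" using \<rho> by (auto simp: N_def L_def)
    show "N k + 2 \<le> N (Suc k)" for k
    proof (cases k)
      case 0
      have "4 \<le> x (Suc K)" using K(1)[of "Suc K"] by simp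
      then show ?thesis using 0 by (simp add: N_def n_def) linarith
    next
      case (Suc j)
      have "4 \<le> x (k + K)" "x (k + K) + 3 \<le> x (Suc (k + K))" using K(1)[of "k + K"] K(3)[of "k + K"] by auto
      then have "nat \<lceil>x (k + K)\<rceil> + 2 \<le> nat \<lceil>x (Suc (k + K))\<rceil>" by linarith
      then show ?thesis using Suc by (simp add: N_def n_def)
    qed
    show "L k + \<rho> \<le> L (Suc k)" for k
      using K(2)[of "Suc K"] K(4)[of "k + K"] by (auto simp: L_def)
    show "\<phi> m = exp (L k)" if "1 \<le> k" "N k \<le> m" "m < N (Suc k)" for k m
    proof -
      \<comment> \<open>Rounding up loses no value of \<open>m\<close>: an integer is at least
        \<open>x\<close> exactly if it is at least the ceiling.\<close>
      have "nat \<lceil>x (k + K)\<rceil> \<le> m" "m < nat \<lceil>x (Suc (k + K))\<rceil>" using that by (auto simp: N_def n_def)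
      then have "x (k + K) \<le> m" "m < x (Suc (k + K))" by linarith+
      then show ?thesis using K(5)[of "k + K" m] that by (simp add: L_def)
    qed
    show "(\<lambda>k. L k / N k) \<longlonglongrightarrow> \<beta>"
    proof (rule Lim_transform_eventually)
      show "(\<lambda>k. l (k + K) / n (k + K)) \<longlonglongrightarrow> \<beta>"
        using LIMSEQ_ignore_initial_segment[OF tendsto_div_ceiling[OF x_top lim_\<beta>], of K] by (simp add: n_def)
      show "\<forall>\<^sub>F k in sequentially. l (k + K) / n (k + K) = L k / N k"
        using pos by eventually_elim (simp add: L_def N_def)
    qed
    show "(\<lambda>k. (\<Sum>j<k. L j) / N k) \<longlonglongrightarrow> \<alpha>"
    proof (rule Lim_transform_eventually)
      \<comment> \<open>The summand \<open>l K\<close> is subtracted too, because \<open>L 0\<close>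
        is 0 and not \<open>l K\<close>.\<close>
      let ?C = "(\<Sum>j<K. l j) + l K"
      have "(\<lambda>k. (\<Sum>j<k. l j) / n k - ?C * (1 / n k)) \<longlonglongrightarrow> \<alpha> - ?C * 0"
        using tendsto_div_ceiling[OF x_top lim_\<alpha>] by (intro tendsto_intros n_at_top) (simp add: n_def)
      then show "(\<lambda>k. (\<Sum>j<k + K. l j) / n (k + K) - ?C * (1 / n (k + K))) \<longlonglongrightarrow> \<alpha>"
        using LIMSEQ_ignore_initial_segment[of "\<lambda>k. (\<Sum>j<k. l j) / n k - ?C * (1 / n k)" \<alpha> K] by simp
      show "\<forall>\<^sub>F k in sequentially. (\<Sum>j<k + K. l j) / n (k + K) - ?C * (1 / n (k + K)) = (\<Sum>j<k. L j) / N k"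
        using pos
      proof eventually_elim
        case (elim k)
        have "(\<Sum>j<k. L j) = (\<Sum>j<k + K. l j) - ?C" using elim
        proof (induction k rule: nat_induct_non_zero)
          case (Suc k)
          then show ?case by (simp add: L_def)
        qed (simp add: L_def)
        then show ?case using elim by (simp add: N_def diff_divide_distrib)
      qed
    qed
    have s0: "(\<lambda>k. real (k + K) * ln (real (Suc (k + K))) / n (k + K)) \<longlonglongrightarrow> 0"
      using LIMSEQ_ignore_initial_segment[OF tendsto_div_ceiling[OF x_top sparse], of K] by (simp add: n_def)
    show "(\<lambda>k. real k * ln (real (Suc k)) / N k) \<longlonglongrightarrow> 0"
    proof (rule Lim_null_comparison[OF _ s0])
      show "\<forall>\<^sub>F k in sequentially. norm (real k * ln (real (Suc k)) / N k)
          \<le> real (k + K) * ln (real (Suc (k + K))) / n (k + K)"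
        using pos
      proof eventually_elim
        case (elim k)
        have "real k * ln (real (Suc k)) \<le> real (k + K) * ln (real (Suc (k + K)))"
          by (intro mult_mono) auto
        then show ?case using elim by (simp add: N_def divide_right_mono)
      qed
    qed
    show "(\<lambda>k. N (Suc k) / exp (L k)) \<longlonglongrightarrow> 0"
    proof (rule Lim_null_comparison)
      have "(\<lambda>k. exp (- l k)) \<longlonglongrightarrow> 0"
        by (rule filterlim_compose[OF exp_at_bot filterlim_compose[OF filterlim_uminus_at_bot_at_top l_top]])
      then have "(\<lambda>k. x (Suc k) / exp (l k) + exp (- l k)) \<longlonglongrightarrow> 0 + 0" by (intro tendsto_intros fast)
      then show "(\<lambda>k. x (Suc (k + K)) / exp (l (k + K)) + exp (- l (k + K))) \<longlonglongrightarrow> 0"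
        using LIMSEQ_ignore_initial_segment[of "\<lambda>k. x (Suc k) / exp (l k) + exp (- l k)" 0 K] by simp
      show "\<forall>\<^sub>F k in sequentially. norm (N (Suc k) / exp (L k)) \<le> x (Suc (k + K)) / exp (l (k + K)) + exp (-
        l (k + K))"
        using pos
      proof eventually_elim
        case (elim k)
        have "4 \<le> x (Suc (k + K))" using K(1)[of "Suc (k + K)"] by simp
        then have "real (n (Suc (k + K))) \<le> x (Suc (k + K)) + 1" unfolding n_def by linarith
        then have "real (n (Suc (k + K))) / exp (l (k + K)) \<le> (x (Suc (k + K)) + 1) / exp (l (k + K))"
          by (rule divide_right_mono) simp
        also have "\<dots> = x (Suc (k + K)) / exp (l (k + K)) + exp (- l (k + K))"
          by (simp add: add_divide_distrib exp_minus inverse_eq_divide)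
        finally show ?case using elim by (simp add: N_def L_def)
      qed
    qed
  qed
  then show ?thesis by blast
qed

text \<open>For the exponent \<open>r / (1 - r)\<close> the hypothesis is
  \<open>r \<ge> 1 / 2\<close>; it makes \<open>L\<close> grow by a fixed amount at every jump, so
  that the new coefficient is comparable to the whole sum.\<close>

lemma powr_Suc_ge:
  assumes "1 \<le> a"
  shows "real k powr a + 1 \<le> real (Suc k) powr a"
proof -
  have e: "real m powr a = real m * real m powr (a - 1)" for m
    by (cases "m = 0") (auto simp: powr_mult_base)
  have "real k powr (a - 1) \<le> real (Suc k) powr (a - 1)" "1 \<le> real (Suc k) powr (a - 1)"
    using assms by (auto intro: powr_mono2 ge_one_powr_ge_zero)
  then have "real k * real k powr (a - 1) + 1 \<le> real k * real (Suc k) powr (a - 1) + real (Suc k) powr (a - 1)"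
    by (intro add_mono mult_left_mono) auto
  then show ?thesis unfolding e by (simp add: algebra_simps)
qed

text \<open>Comparison with the integral of \<open>y powr a\<close>, carried out by the mean value
  theorem for \<open>y powr (a + 1)\<close> on each unit interval.\<close>

lemma sum_powr_bounds:
  assumes a: "0 < a"
  shows "(\<Sum>j<k. real j powr a) \<le> real k powr (a + 1) / (a + 1)"
    and "real k powr (a + 1) / (a + 1) - real k powr a \<le> (\<Sum>j<k. real j powr a)"
proof -
  have step: "real j powr a \<le> (real (Suc j) powr (a + 1) - real j powr (a + 1)) / (a + 1) \<and>
      (real (Suc j) powr (a + 1) - real j powr (a + 1)) / (a + 1) \<le> real (Suc j) powr a" for j
  proof -
    have cont: "continuous_on {real j..real (Suc j)} (\<lambda>y. y powr (a + 1))"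
      using a by (intro continuous_on_powr' continuous_intros) auto
    have der: "((\<lambda>y. y powr (a + 1)) has_real_derivative (a + 1) * y powr a) (at y)" if "real j < y" for y
    proof -
      have "y > 0" using that of_nat_0_le_iff[of j] by linarith
      then show ?thesis by (auto intro!: derivative_eq_intros)
    qed
    obtain D z where z: "real j < z" "z < real (Suc j)" "((\<lambda>y. y powr (a + 1)) has_real_derivative D) (at z)"
      "real (Suc j) powr (a + 1) - real j powr (a + 1) = (real (Suc j) - real j) * D"
      using MVT[OF _ cont] der by (metis lessI of_nat_less_iff real_differentiable_def)
    have "D = (a + 1) * z powr a" using DERIV_unique[OF z(3) der[OF z(1)]] .
    then have z3: "real (Suc j) powr (a + 1) - real j powr (a + 1) = (a + 1) * z powr a" using z(4) by simp
    have "real j powr a \<le> z powr a" "z powr a \<le> real (Suc j) powr a"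
      using z a by (auto intro!: powr_mono2)
    then show ?thesis using z3 a by simp
  qed
  have tele: "(\<Sum>j<k. (real (Suc j) powr (a + 1) - real j powr (a + 1)) / (a + 1)) = real k powr (a + 1) / (a
    + 1)"
    unfolding sum_divide_distrib[symmetric] by (induction k) (use a in auto)
  show "(\<Sum>j<k. real j powr a) \<le> real k powr (a + 1) / (a + 1)"
    unfolding tele[symmetric] using step by (intro sum_mono) blast
  have "real k powr (a + 1) / (a + 1) \<le> (\<Sum>j<k. real (Suc j) powr a)"
    unfolding tele[symmetric] using step by (intro sum_mono) blast
  also have "\<dots> = (\<Sum>j<k. real j powr a) + real k powr a"
    by (induction k) (use a in auto)
  finally show "real k powr (a + 1) / (a + 1) - real k powr a \<le> (\<Sum>j<k. real j powr a)" by simp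
qed

text \<open>The floor in \<phi> reaches \<open>k\<close> at
  \<open>n = (k / d) powr (1 / (1 - r))\<close>, and \<open>1 / (1 - r) = a + 1\<close> with
  \<open>a = r / (1 - r)\<close>. So \<open>L k / N k\<close> is of order \<open>1 / k\<close>,
  whence \<beta> = 0, whereas the sum of the \<open>L j\<close> has the same order
  \<open>k powr (a + 1)\<close> as \<open>N k\<close>.\<close>

lemma jumps_phi_poly:
  assumes c: "0 < c" and d: "0 < d" and r: "1 / 2 \<le> r" "r < 1"
  shows "\<exists>N L \<rho>. jumps N L (c * d * (1 - r)) 0 \<rho> (phi_poly c d r)"
proof -
  define a where "a = r / (1 - r)"
  have a: "1 \<le> a" "a + 1 = 1 / (1 - r)" using r by (auto simp: a_def field_simps)
  define x where "x k = (real k / d) powr (a + 1)" for k :: nat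
  define l where "l k = c * (real k powr a / d powr a)" for k :: nat
  have "\<exists>N L. jumps N L (c * d * (1 - r)) 0 (c / d powr a) (phi_poly c d r)"
  proof (rule jumps_exist)
    show "0 < c / d powr a" using c d by simp
    show "\<forall>\<^sub>F k in sequentially. l k + c / d powr a \<le> l (Suc k)"
    proof (rule always_eventually, rule allI)
      fix k
      have "c / d powr a * (real k powr a + 1) \<le> c / d powr a * real (Suc k) powr a"
        using c by (intro mult_left_mono powr_Suc_ge a) auto
      then show "l k + c / d powr a \<le> l (Suc k)" by (simp add: l_def algebra_simps)
    qed
    have "filterlim (\<lambda>k. real k powr a / d powr (a + 1)) at_top sequentially"
      using a d by real_asymp
    then have "\<forall>\<^sub>F k in sequentially. 3 \<le> real k powr a / d powr (a + 1)"
      by (simp add: filterlim_at_top)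
    then show "\<forall>\<^sub>F k in sequentially. x k + 3 \<le> x (Suc k)"
    proof eventually_elim
      case (elim k)
      have e: "real j powr (a + 1) = real j * real j powr a" for j
        by (cases "j = 0") (use a(1) in \<open>auto simp: powr_add\<close>)
      have "(real k + 1) * real k powr a \<le> real (Suc k) * real (Suc k) powr a"
        using a by (intro mult_mono powr_mono2) auto
      then have "real k powr (a + 1) + real k powr a \<le> real (Suc k) powr (a + 1)"
        unfolding e by (simp add: algebra_simps)
      then have "(real k powr (a + 1) + real k powr a) / d powr (a + 1) \<le> real (Suc k) powr (a + 1) / d powr
        (a + 1)"
        by (rule divide_right_mono) simp
      moreover have "x j = real j powr (a + 1) / d powr (a + 1)" for j
        unfolding x_def using d by (subst powr_divide) auto
      ultimately show ?case using elim by (simp add: add_divide_distrib)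
    qed
    show "(\<lambda>k. l k / x k) \<longlonglongrightarrow> 0" unfolding l_def x_def using a c d by real_asymp
    show "(\<lambda>k. real k * ln (real (Suc k)) / x k) \<longlonglongrightarrow> 0" unfolding x_def using a d by real_asymp
    show "(\<lambda>k. x (Suc k) / exp (l k)) \<longlonglongrightarrow> 0" unfolding l_def x_def using a c d by real_asymp
    show "(\<lambda>k. (\<Sum>j<k. l j) / x k) \<longlonglongrightarrow> c * d * (1 - r)"
    proof (rule tendsto_sandwich)
      let ?S = "\<lambda>k. \<Sum>j<k. real j powr a"
      have e: "(\<Sum>j<k. l j) = c / d powr a * ?S k" for k
        by (simp add: l_def sum_distrib_left)
      show "\<forall>\<^sub>F k in sequentially. c / d powr a * (real k powr (a + 1) / (a + 1) - real k powr a) / x k \<le>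
        (\<Sum>j<k. l j) / x k"
        unfolding e using c a sum_powr_bounds(2)[of a]
        by (intro always_eventually allI divide_right_mono mult_left_mono) (auto simp: x_def)
      show "\<forall>\<^sub>F k in sequentially. (\<Sum>j<k. l j) / x k \<le> c / d powr a * (real k powr (a + 1) / (a + 1)) / x k"
        unfolding e using c a sum_powr_bounds(1)[of a]
        by (intro always_eventually allI divide_right_mono mult_left_mono) (auto simp: x_def)
      have lim: "c / d powr a / (a + 1) * d powr (a + 1) = c * d * (1 - r)"
      proof -
        have "d powr (a + 1) = d powr a * d" using d by (simp only: powr_add powr_one)
        then have "c / d powr a / (a + 1) * d powr (a + 1) = c * d * (1 / (a + 1))" using d by simp
        also have "1 / (a + 1) = 1 - r" using a(2) by simp
        finally show ?thesis .
      qed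
      show main: "(\<lambda>k. c / d powr a * (real k powr (a + 1) / (a + 1)) / x k) \<longlonglongrightarrow> c * d * (1 - r)"
      proof (rule Lim_transform_eventually[OF tendsto_const])
        show "\<forall>\<^sub>F k in sequentially. c * d * (1 - r) = c / d powr a * (real k powr (a + 1) / (a + 1)) / x k"
          using eventually_gt_at_top[of 0]
        proof eventually_elim
          case (elim k)
          have "x k = real k powr (a + 1) / d powr (a + 1)"
            unfolding x_def using d by (subst powr_divide) auto
          then show ?case unfolding lim[symmetric] using elim by simp
        qed
      qed
      have "(\<lambda>k. c / d powr a * real k powr a / x k) \<longlonglongrightarrow> 0"
        unfolding x_def using a(1) c d by real_asymp
      from tendsto_diff[OF main this]
      show "(\<lambda>k. c / d powr a * (real k powr (a + 1) / (a + 1) - real k powr a) / x k) \<longlonglongrightarrow> c * d * (1 - r)"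
        by (simp add: diff_divide_distrib right_diff_distrib)
    qed
    show "\<forall>\<^sub>F k in sequentially. \<forall>m::nat. x k \<le> m \<longrightarrow> m < x (Suc k) \<longrightarrow> phi_poly c d r m = exp (l k)"
    proof (intro always_eventually allI impI)
      fix k m :: nat assume m: "x k \<le> m" "m < x (Suc k)"
      have inv: "x j powr (1 - r) = real j / d" for j
      proof -
        have "(a + 1) * (1 - r) = 1" using a(2) r by simp
        then show ?thesis using d by (simp add: x_def powr_powr)
      qed
      have "real k / d \<le> real m powr (1 - r)"
        unfolding inv[symmetric] using m r by (intro powr_mono2) (auto simp: x_def)
      moreover have "real m powr (1 - r) < real (Suc k) / d"
        unfolding inv[symmetric] using m r by (intro powr_less_mono2) (auto simp: x_def)
      ultimately have "real k \<le> d * real m powr (1 - r)" "d * real m powr (1 - r) < real k + 1"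
        using d by (auto simp: field_simps)
      then have "\<lfloor>d * real m powr (1 - r)\<rfloor> = int k" by linarith
      then show "phi_poly c d r m = exp (l k)" by (simp add: phi_poly_def l_def a_def)
    qed
  qed
  then show ?thesis by blast
qed

text \<open>The floor reaches \<open>k\<close> at \<open>n = exp (\<gamma> * k)\<close>, where
  \<open>L\<close> is exactly \<open>c\<close> times the jump time before rounding; the sum of the
  earlier \<open>L j\<close> is a geometric series.\<close>

lemma jumps_phi_exp:
  assumes c: "0 < c" and \<gamma>: "0 < \<gamma>"
  shows "\<exists>N L \<rho>. jumps N L (c / (exp \<gamma> - 1)) c \<rho> (phi_exp c \<gamma>)"
proof -
  define x where "x k = exp (\<gamma> * real k)" for k :: nat
  define l where "l k = c * exp (\<gamma> * real k)" for k :: nat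
  have g1: "exp \<gamma> > 1" using \<gamma> by simp
  have "\<exists>N L. jumps N L (c / (exp \<gamma> - 1)) c (c * (exp \<gamma> - 1)) (phi_exp c \<gamma>)"
  proof (rule jumps_exist)
    show "0 < c * (exp \<gamma> - 1)" using c g1 by simp
    show "\<forall>\<^sub>F k in sequentially. l k + c * (exp \<gamma> - 1) \<le> l (Suc k)"
    proof (rule always_eventually, rule allI)
      fix k
      have "c * (exp \<gamma> - 1) * 1 \<le> c * (exp \<gamma> - 1) * exp (\<gamma> * real k)"
        using c \<gamma> g1 by (intro mult_left_mono) auto
      moreover have "exp (\<gamma> * real (Suc k)) = exp \<gamma> * exp (\<gamma> * real k)" by (simp add: exp_add[symmetric]
        algebra_simps)
      ultimately show "l k + c * (exp \<gamma> - 1) \<le> l (Suc k)" by (simp add: l_def algebra_simps)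
    qed
    have "filterlim (\<lambda>k. exp (\<gamma> * real (k + 1)) - exp (\<gamma> * real k)) at_top sequentially"
      using \<gamma> by real_asymp
    then have "\<forall>\<^sub>F k in sequentially. 3 \<le> x (Suc k) - x k"
      unfolding x_def filterlim_at_top by simp
    then show "\<forall>\<^sub>F k in sequentially. x k + 3 \<le> x (Suc k)"
      by eventually_elim simp
    show "(\<lambda>k. l k / x k) \<longlonglongrightarrow> c" by (simp add: l_def x_def)
    show "(\<lambda>k. real k * ln (real (Suc k)) / x k) \<longlonglongrightarrow> 0" unfolding x_def using \<gamma> by real_asymp
    show "(\<lambda>k. x (Suc k) / exp (l k)) \<longlonglongrightarrow> 0" unfolding l_def x_def using \<gamma> c by real_asymp
    have "(\<Sum>j<k. l j) = c * (exp (\<gamma> * real k) - 1) / (exp \<gamma> - 1)" for k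
    proof (induction k)
      case (Suc k)
      have "exp (\<gamma> * real (Suc k)) = exp \<gamma> * exp (\<gamma> * real k)" by (simp add: exp_add[symmetric] algebra_simps)
      then show ?case using Suc g1 by (simp add: l_def field_simps)
    qed simp
    then have "(\<Sum>j<k. l j) / x k = c / (exp \<gamma> - 1) * (1 - exp (- (\<gamma> * real k)))" for k
      by (simp add: x_def exp_minus field_simps)
    moreover have "(\<lambda>k. 1 - exp (- (\<gamma> * real k))) \<longlonglongrightarrow> 1" using \<gamma> by real_asymp
    then have "(\<lambda>k. c / (exp \<gamma> - 1) * (1 - exp (- (\<gamma> * real k)))) \<longlonglongrightarrow> c / (exp \<gamma> - 1) * 1"
      by (intro tendsto_intros)
    ultimately show "(\<lambda>k. (\<Sum>j<k. l j) / x k) \<longlonglongrightarrow> c / (exp \<gamma> - 1)" by simp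
    show "\<forall>\<^sub>F k in sequentially. \<forall>m::nat. x k \<le> m \<longrightarrow> m < x (Suc k) \<longrightarrow> phi_exp c \<gamma> m = exp (l k)"
    proof (intro always_eventually allI impI)
      fix k m :: nat assume m: "x k \<le> m" "m < x (Suc k)"
      have "real m > 0" using m(1) exp_gt_zero[of "\<gamma> * real k"] unfolding x_def by linarith
      then have "\<gamma> * real k \<le> ln (real m)" using m by (simp add: x_def ln_ge_iff)
      moreover have "ln (real m) < ln (x (Suc k))" using m(2) \<open>real m > 0\<close> by (subst ln_less_cancel_iff)
        (auto simp: x_def)
      then have "ln (real m) < \<gamma> * real (Suc k)" unfolding x_def by simp
      ultimately have "real k \<le> ln (real m) / \<gamma>" "ln (real m) / \<gamma> < real k + 1"
        using \<gamma> by (auto simp: field_simps)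
      then have "\<lfloor>ln (real m) / \<gamma>\<rfloor> = int k" by linarith
      then show "phi_exp c \<gamma> m = exp (l k)" by (simp add: phi_exp_def l_def)
    qed
  qed
  then show ?thesis by blast
qed

text \<open>The predicate \<open>Q\<close> is a parameter, so that \<open>eta_eq\<close> and
  \<open>xi_eq\<close> can be inserted as they stand under the description operator.\<close>

lemma hausdorff_dim_unique_solution:
  assumes j: "\<exists>N L \<rho>. jumps N L \<alpha> \<beta> \<rho> \<phi>" and nn: "0 \<le> \<alpha>" "0 \<le> \<beta>" "0 < \<alpha> + \<beta>"
    and eq: "\<And>\<theta>. Q \<theta> \<longleftrightarrow> 1 / 2 < \<theta> \<and> pressure \<theta> = \<alpha> * (2 * \<theta> - 1) + \<beta> * \<theta>"
  shows "(\<exists>!\<theta>. Q \<theta>) \<and> hausdorff_dim (asymp_sum_set \<phi>) = ennreal (THE \<theta>. Q \<theta>)"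
proof -
  obtain \<theta> where \<theta>: "1 / 2 < \<theta>" "\<theta> < 1" "pressure \<theta> = \<alpha> * (2 * \<theta> - 1) + \<beta> * \<theta>"
    "\<And>\<theta>'. 1 / 2 < \<theta>' \<Longrightarrow> pressure \<theta>' = \<alpha> * (2 * \<theta>' - 1) + \<beta> * \<theta>' \<Longrightarrow> \<theta>' = \<theta>"
    using ex1_pressure_eq[OF nn] by blast
  have Q: "Q \<theta>" using \<theta>(1,3) by (simp add: eq)
  have Q': "\<theta>' = \<theta>" if "Q \<theta>'" for \<theta>' using that \<theta>(4)[of \<theta>'] unfolding eq by blast
  have the: "(THE \<theta>. Q \<theta>) = \<theta>" by (rule the_equality[of Q, OF Q Q'])
  obtain N L \<rho> where "jumps N L \<alpha> \<beta> \<rho> \<phi>" using j by blast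
  then interpret jumps N L \<alpha> \<beta> \<rho> \<phi> .
  have "hausdorff_dim (asymp_sum_set \<phi>) = ennreal \<theta>"
    by (rule hausdorff_dim_asymp_sum_set[OF \<theta>(1-3) nn])
  then show ?thesis unfolding the using ex1I[of Q, OF Q Q'] by blast
qed

theorem theorem6:
  shows "(\<forall>c d r :: real. 0 < c \<and> 0 < d \<and> 1 / 2 \<le> r \<and> r < 1 \<longrightarrow>
            (\<exists>!\<theta>. eta_eq c d r \<theta>) \<and>
            hausdorff_dim (asymp_sum_set (phi_poly c d r)) = ennreal (eta c d r))
       \<and> (\<forall>c \<gamma> :: real. 0 < c \<and> 0 < \<gamma> \<longrightarrow>
            (\<exists>!\<theta>. xi_eq c \<gamma> \<theta>) \<and>
            hausdorff_dim (asymp_sum_set (phi_exp c \<gamma>)) = ennreal (xi c \<gamma>))"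
proof (rule conjI; intro allI impI)
  fix c d r :: real assume a: "0 < c \<and> 0 < d \<and> 1 / 2 \<le> r \<and> r < 1"
  show "(\<exists>!\<theta>. eta_eq c d r \<theta>) \<and> hausdorff_dim (asymp_sum_set (phi_poly c d r)) = ennreal (eta c d r)"
    unfolding eta_def
    by (rule hausdorff_dim_unique_solution[OF jumps_phi_poly]) (use a in \<open>auto simp: eta_eq_def\<close>)
next
  fix c \<gamma> :: real assume a: "0 < c \<and> 0 < \<gamma>"
  then have g: "exp \<gamma> - 1 > 0" by simp
  have "c * ((exp \<gamma> + 1) / (exp \<gamma> - 1) * \<theta> - 1 / (exp \<gamma> - 1)) = c / (exp \<gamma> - 1) * (2 * \<theta> - 1) + c * \<theta>" for \<theta>
  proof -
    \<comment> \<open>Here \<open>y\<close> stands for \<open>exp \<gamma> - 1\<close>, so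
      \<open>exp \<gamma> + 1\<close> is \<open>y + 2\<close>.\<close>
    have "c * ((y + 2) / y * \<theta> - 1 / y) = c / y * (2 * \<theta> - 1) + c * \<theta>" if "y > 0" for y
      using that by (simp add: field_simps)
    from this[OF g] show ?thesis by (simp add: add.commute)
  qed
  then show "(\<exists>!\<theta>. xi_eq c \<gamma> \<theta>) \<and> hausdorff_dim (asymp_sum_set (phi_exp c \<gamma>)) = ennreal (xi c \<gamma>)"
    unfolding xi_def
    by (intro hausdorff_dim_unique_solution[OF jumps_phi_exp]) (use a g in \<open>auto simp: xi_eq_def intro:
      add_pos_pos\<close>)
qed

end
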